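(* Let $M,M'\subseteq\mathbb{C}^{n+1}$ be real analytic hypersurfaces through $0$, given near $0$ in normal coordinates by $w=Q(z,\bar z,\bar w)$ and $w'=Q'(z',\bar z',\bar w')$ respectively, with complexifications $\mathcal{M}$ and $\mathcal{M}'$. Assume that $M$ is finitely nondegenerate at $0$, and let $\mathcal{H}=(f,g,\tilde f,\tilde g)$ be a holomorphic Segre preserving map (HSPM) sending $(\mathcal{M},0)$ into $(\mathcal{M}',0)$. Then one of the following two possibilities must hold: (1) $\mathcal{H}$ is transversally null, and $Q'\big(f(z,w),\tilde f(\chi,\tau),0\big)\equiv 0$; that is, $\mathcal{H}$ maps a neighborhood of $0$ in $\mathbb{C}^{2n+2}$ into $\mathcal{M}'$. (2) $\mathcal{H}$ is Segre transversal to $\mathcal{M}'$ at $0$, $\det\big(f_z(0)\big)\ne 0$, and $\det\big(\tilde f_\chi(0)\big)\ne 0$; that is, $\mathcal{H}$ is a biholomorphism near $0$. Furthermore, $M'$ is finitely nondegenerate at $0$.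
   Context: Here $n\ge 1$, and everything is local near $0$. Coordinates on $\mathbb{C}^{n+1}\times\mathbb{C}^{n+1}$ are $(Z,\zeta)$ with $Z=(z,w)\in\mathbb{C}^n\times\mathbb{C}$, $\zeta=(\chi,\tau)\in\mathbb{C}^n\times\mathbb{C}$ (primed for the target). Normal coordinates: the real analytic hypersurface $M\subseteq\mathbb{C}^{n+1}$ is given near $0\in M$ by $w=Q(z,\bar z,\bar w)$, where $Q(z,\chi,\tau)$ is holomorphic near $0$ in $\mathbb{C}^n\times\mathbb{C}^n\times\mathbb{C}$ and $Q(0,\chi,\tau)\equiv Q(z,0,\tau)\equiv\tau$. Since $M$ is a real hypersurface, $Q(z,\chi,\overline{Q}(\chi,z,w))\equiv w$, where $\overline{\varphi}(x):=\overline{\varphi(\bar x)}$. Similarly for $M'$ and $Q'$. Complexification: $\mathcal{M}$ is the holomorphic hypersurface $\{(z,w,\chi,\tau): w=Q(z,\chi,\tau)\}$ in $\mathbb{C}^{2n+2}$ near $0$; similarly $\mathcal{M}'$ with $Q'$. HSPM: a holomorphic Segre preserving map sending $(\mathcal{M},0)$ into $(\mathcal{M}',0)$ is a holomorphic map, defined near $0$ in $\mathbb{C}^{2n+2}$, of the form $\mathcal{H}(z,w,\chi,\tau)=\big(H(z,w),\widetilde H(\chi,\tau)\big)=\big(f(z,w),g(z,w),\tilde f(\chi,\tau),\tilde g(\chi,\tau)\big)$ with $\mathcal{H}(0)=0$ and $\mathcal{H}$ mapping $\mathcal{M}$ (near $0$) into $\mathcal{M}'$; here $f,\tilde f$ are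 $\mathbb{C}^n$-valued and $g,\tilde g$ are $\mathbb{C}$-valued holomorphic functions. ($\widetilde H$ need not be related to $\overline H$.) Transversally null: $g(z,w)\equiv 0$ and $\tilde g(\chi,\tau)\equiv 0$. Segre transversal to $\mathcal{M}'$ at $0$: $g_w(0)=\tilde g_\tau(0)\ne 0$ (the equality $g_w(0)=\tilde g_\tau(0)$ always holds in normal coordinates). Finitely nondegenerate at $0$: there is an integer $K$ such that the matrix with rows $\big(Q_{\chi_j z^\alpha}(0,0,0)\big)_{|\alpha|\le K}$, $1\le j\le n$, has rank $n$. The same definition applies to $M'$ with $Q'$. *)

theory Defs
  imports "HOL-Analysis.Analysis"
begin

section \<open>Holomorphic maps of several complex variables\<close>

class complex_normed_space = real_normed_vector +
  fixes scaleC :: "complex \<Rightarrow> 'a \<Rightarrow> 'a"  (infixr \<open>*\<^sub>C\<close> 75)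
  assumes scaleC_add_right: "c *\<^sub>C (x + y) = c *\<^sub>C x + c *\<^sub>C y"
    and scaleC_add_left: "(c + d) *\<^sub>C x = c *\<^sub>C x + d *\<^sub>C x"
    and scaleC_scaleC: "c *\<^sub>C (d *\<^sub>C x) = (c * d) *\<^sub>C x"
    and scaleC_of_real: "complex_of_real r *\<^sub>C x = r *\<^sub>R x"
    and norm_scaleC: "norm (c *\<^sub>C x) = cmod c * norm x"

instantiation complex :: complex_normed_space
begin

definition scaleC_complex_def: "c *\<^sub>C (x::complex) = c * x"

instance
  by standard (simp_all add: scaleC_complex_def algebra_simps norm_mult scaleR_conv_of_real)

end

instantiation vec :: (complex_normed_space, finite) complex_normed_space
begin

definition scaleC_vec_def: "c *\<^sub>C x = (\<chi> i. c *\<^sub>C (x $ i))"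

instance
proof
  fix c :: complex and x :: "('a, 'b) vec"
  show "norm (c *\<^sub>C x) = cmod c * norm x"
    by (simp add: scaleC_vec_def norm_vec_def norm_scaleC L2_set_right_distrib)
qed (simp_all add: scaleC_vec_def vec_eq_iff scaleC_add_right scaleC_add_left
      scaleC_scaleC scaleC_of_real)

end

instantiation prod :: (complex_normed_space, complex_normed_space) complex_normed_space
begin

definition scaleC_prod_def: "c *\<^sub>C x = (c *\<^sub>C fst x, c *\<^sub>C snd x)"

instance
proof
  fix c :: complex and x :: "'a \<times> 'b"
  have "(cmod c * norm (fst x))\<^sup>2 + (cmod c * norm (snd x))\<^sup>2
      = (cmod c)\<^sup>2 * ((norm (fst x))\<^sup>2 + (norm (snd x))\<^sup>2)"
    by (simp add: power_mult_distrib algebra_simps)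
  then show "norm (c *\<^sub>C x) = cmod c * norm x"
    by (simp add: scaleC_prod_def norm_prod_def norm_scaleC real_sqrt_mult)
qed (simp_all add: scaleC_prod_def scaleC_add_right scaleC_add_left
      scaleC_scaleC scaleC_of_real prod_eq_iff)

end

definition complex_differentiable_at ::
    "('a::complex_normed_space \<Rightarrow> 'b::complex_normed_space) \<Rightarrow> 'a \<Rightarrow> bool" where
  "complex_differentiable_at F p \<longleftrightarrow>
     (\<exists>D. (F has_derivative D) (at p) \<and> (\<forall>c v. D (c *\<^sub>C v) = c *\<^sub>C D v))"

definition hol_near0 ::
    "('a::complex_normed_space \<Rightarrow> 'b::complex_normed_space) \<Rightarrow> bool" where
  "hol_near0 F \<longleftrightarrow> (\<forall>\<^sub>F p in nhds 0. complex_differentiable_at F p)"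

definition biholomorphism_near0 ::
    "('a::complex_normed_space \<Rightarrow> 'b::complex_normed_space) \<Rightarrow> bool" where
  "biholomorphism_near0 F \<longleftrightarrow>
     (\<exists>U V G. open U \<and> open V \<and> 0 \<in> U \<and> F ` U = V \<and> G ` V = U \<and>
        (\<forall>p\<in>U. G (F p) = p) \<and> (\<forall>q\<in>V. F (G q) = q) \<and>
        (\<forall>p\<in>U. complex_differentiable_at F p) \<and>
        (\<forall>q\<in>V. complex_differentiable_at G q))"


section \<open>Hypersurfaces in normal coordinates\<close>

text \<open>
  A point $Z = (z,w)$ of $C^{n+1}$ has type \<^typ>\<open>(complex^'n) \<times> complex\<close>, where $n$ is the
  cardinality of the index type \<^typ>\<open>'n\<close>.  Functions are total, but only their germs at $0$ are
  constrained: an identity of germs is expressed with the filter \<^term>\<open>nhds 0\<close>.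
\<close>

definition vcnj :: "complex^'n \<Rightarrow> complex^'n" where
  "vcnj z = (\<chi> i. cnj (z $ i))"

text \<open>
  A real-valued $\rho$ is real analytic near $0$ iff its power series in $Z$, $\bar Z$ converges
  there, that is, iff $\rho(Z) = R(Z, \bar Z)$ with $R$ holomorphic near $0$.
\<close>

definition real_analytic_near0 :: "((complex^'n) \<times> complex \<Rightarrow> real) \<Rightarrow> bool" where
  "real_analytic_near0 \<rho> \<longleftrightarrow>
     (\<exists>R :: ((complex^'n) \<times> complex) \<times> ((complex^'n) \<times> complex) \<Rightarrow> complex.
        hol_near0 R \<and>
        (\<forall>\<^sub>F (z, w) in nhds 0. complex_of_real (\<rho> (z, w)) = R ((z, w), (vcnj z, cnj w))))"

definition real_analytic_hypersurface_at0 :: "((complex^'n) \<times> complex) set \<Rightarrow> bool" where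
  "real_analytic_hypersurface_at0 M \<longleftrightarrow>
     (\<exists>\<rho> D. real_analytic_near0 \<rho> \<and> \<rho> 0 = 0 \<and>
        (\<rho> has_derivative D) (at 0) \<and> (\<exists>v. D v \<noteq> 0) \<and>
        (\<forall>\<^sub>F Z in nhds 0. Z \<in> M \<longleftrightarrow> \<rho> Z = 0))"

definition bar :: "((complex^'n) \<times> (complex^'n) \<times> complex \<Rightarrow> complex)
    \<Rightarrow> (complex^'n) \<times> (complex^'n) \<times> complex \<Rightarrow> complex" where
  "bar Q = (\<lambda>(chi, z, w). cnj (Q (vcnj chi, vcnj z, cnj w)))"

text \<open>
  The reality identity $Q(z,\chi,\bar Q(\chi,z,w)) = w$ (the fourth clause) holds because the set
  $w = Q(z,\bar z,\bar w)$ is a real hypersurface; it is kept as part of the data.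
\<close>

definition normal_coordinates ::
    "((complex^'n) \<times> complex) set
      \<Rightarrow> ((complex^'n) \<times> (complex^'n) \<times> complex \<Rightarrow> complex) \<Rightarrow> bool" where
  "normal_coordinates M Q \<longleftrightarrow>
     hol_near0 Q \<and>
     (\<forall>\<^sub>F (chi, \<tau>) in nhds 0. Q (0, chi, \<tau>) = \<tau>) \<and>
     (\<forall>\<^sub>F (z, \<tau>) in nhds 0. Q (z, 0, \<tau>) = \<tau>) \<and>
     (\<forall>\<^sub>F (z, chi, w) in nhds 0. Q (z, chi, bar Q (chi, z, w)) = w) \<and>
     (\<forall>\<^sub>F (z, w) in nhds 0. (z, w) \<in> M \<longleftrightarrow> w = Q (z, vcnj z, cnj w))"

definition complexification ::
    "((complex^'n) \<times> (complex^'n) \<times> complex \<Rightarrow> complex)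
      \<Rightarrow> (((complex^'n) \<times> complex) \<times> ((complex^'n) \<times> complex)) set" where
  "complexification Q = {((z, w), (chi, \<tau>)) | z w chi \<tau>. w = Q (z, chi, \<tau>)}"


section \<open>Finite nondegeneracy\<close>

definition d_z :: "'n \<Rightarrow> ((complex^'n) \<times> (complex^'n) \<times> complex \<Rightarrow> complex)
    \<Rightarrow> (complex^'n) \<times> (complex^'n) \<times> complex \<Rightarrow> complex" where
  "d_z j F = (\<lambda>(z, chi, \<tau>). deriv (\<lambda>t. F (z + axis j t, chi, \<tau>)) 0)"

definition d_chi :: "'n \<Rightarrow> ((complex^'n) \<times> (complex^'n) \<times> complex \<Rightarrow> complex)
    \<Rightarrow> (complex^'n) \<times> (complex^'n) \<times> complex \<Rightarrow> complex" where
  "d_chi j F = (\<lambda>(z, chi, \<tau>). deriv (\<lambda>t. F (z, chi + axis j t, \<tau>)) 0)"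

text \<open>
  A multi-index $\alpha$ with $|\alpha| = k$ is represented by a list of $k$ directions in which
  each $i$ occurs $\alpha_i$ times.  Since partial derivatives commute, two lists representing the
  same $\alpha$ give the same column below.
\<close>

definition d_z_list :: "'n list \<Rightarrow> ((complex^'n) \<times> (complex^'n) \<times> complex \<Rightarrow> complex)
    \<Rightarrow> (complex^'n) \<times> (complex^'n) \<times> complex \<Rightarrow> complex" where
  "d_z_list js F = foldr d_z js F"

text \<open>
  The matrix $(Q_{\chi_j z^\alpha}(0,0,0))$ has $n$ rows, indexed by $j$, and columns indexed by
  $|\alpha| \le K$; its rank is the complex dimension of its column space
  (\<^term>\<open>vec.dim\<close> is the dimension of the span).
\<close>

definition finitely_nondegenerate ::
    "((complex^'n) \<times> (complex^'n) \<times> complex \<Rightarrow> complex) \<Rightarrow> bool" where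
  "finitely_nondegenerate Q \<longleftrightarrow>
     (\<exists>K. vec.dim {(\<chi> j. d_z_list \<alpha> (d_chi j Q) (0, 0, 0)) :: complex^'n | \<alpha>. length \<alpha> \<le> K}
            = CARD('n))"


section \<open>Holomorphic Segre preserving maps\<close>

definition segre_map ::
    "((complex^'n) \<times> complex \<Rightarrow> complex^'n) \<Rightarrow> ((complex^'n) \<times> complex \<Rightarrow> complex)
      \<Rightarrow> ((complex^'n) \<times> complex \<Rightarrow> complex^'n) \<Rightarrow> ((complex^'n) \<times> complex \<Rightarrow> complex)
      \<Rightarrow> ((complex^'n) \<times> complex) \<times> ((complex^'n) \<times> complex)
      \<Rightarrow> ((complex^'n) \<times> complex) \<times> ((complex^'n) \<times> complex)" where
  "segre_map f g ft gt = (\<lambda>((z, w), (chi, \<tau>)). ((f (z, w), g (z, w)), (ft (chi, \<tau>), gt (chi, \<tau>))))"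

definition HSPM ::
    "((complex^'n) \<times> (complex^'n) \<times> complex \<Rightarrow> complex)
      \<Rightarrow> ((complex^'n) \<times> (complex^'n) \<times> complex \<Rightarrow> complex)
      \<Rightarrow> ((complex^'n) \<times> complex \<Rightarrow> complex^'n) \<Rightarrow> ((complex^'n) \<times> complex \<Rightarrow> complex)
      \<Rightarrow> ((complex^'n) \<times> complex \<Rightarrow> complex^'n) \<Rightarrow> ((complex^'n) \<times> complex \<Rightarrow> complex)
      \<Rightarrow> bool" where
  "HSPM Q Q' f g ft gt \<longleftrightarrow>
     hol_near0 (segre_map f g ft gt) \<and>
     segre_map f g ft gt 0 = 0 \<and>
     (\<forall>\<^sub>F p in nhds 0. p \<in> complexification Q \<longrightarrow> segre_map f g ft gt p \<in> complexification Q')"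

definition transversally_null ::
    "((complex^'n) \<times> complex \<Rightarrow> complex) \<Rightarrow> ((complex^'n) \<times> complex \<Rightarrow> complex) \<Rightarrow> bool" where
  "transversally_null g gt \<longleftrightarrow>
     (\<forall>\<^sub>F (z, w) in nhds 0. g (z, w) = 0) \<and> (\<forall>\<^sub>F (chi, \<tau>) in nhds 0. gt (chi, \<tau>) = 0)"

definition d_last_at0 :: "((complex^'n) \<times> complex \<Rightarrow> complex) \<Rightarrow> complex" where
  "d_last_at0 g = deriv (\<lambda>t. g (0, t)) 0"

definition segre_transversal_at0 ::
    "((complex^'n) \<times> complex \<Rightarrow> complex) \<Rightarrow> ((complex^'n) \<times> complex \<Rightarrow> complex) \<Rightarrow> bool" where
  "segre_transversal_at0 g gt \<longleftrightarrow> d_last_at0 g = d_last_at0 gt \<and> d_last_at0 gt \<noteq> 0"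

text \<open>
  The Jacobian matrix at $0$ with respect to the first $n$ variables only: $f_z(0)$, respectively
  $\tilde f_\chi(0)$.
\<close>

definition jacobian_at0 :: "((complex^'n) \<times> complex \<Rightarrow> complex^'n) \<Rightarrow> complex^'n^'n" where
  "jacobian_at0 f = (\<chi> i j. deriv (\<lambda>t. f (axis j t, 0) $ i) 0)"

end

theory Submission
  imports Defs "HOL-Complex_Analysis.Complex_Analysis"
begin

text \<open>
Write \<open>H = (f, g)\<close> and \<open>Ht = (ft, gt)\<close> for the two halves of the map. In normal coordinates the
complexification of \<open>M\<close> is the graph \<open>\<tau> = P (\<chi>, Z)\<close> with \<open>P = bar Q\<close>, and that the map is Segre
preserving means that \<open>h (Z, \<zeta>) = gt \<zeta> - bar Q' (ft \<zeta>, H Z)\<close> vanishes on this graph. The proof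
studies how \<open>h\<close> vanishes, and does the same with the two factors exchanged; exchanging them replaces
\<open>bar Q, bar Q'\<close> by \<open>Q, Q'\<close>. The locale \<open>segre_germ\<close> covers both roles at once.

The basic step. Since \<open>h\<close> depends on \<open>Z\<close> only through \<open>H Z\<close>, a vector \<open>v\<close> in the kernel of the
derivative of \<open>H\<close> at \<open>Z\<close> annihilates \<open>h\<close> at \<open>(Z, \<zeta>)\<close> for every \<open>\<zeta>\<close>. Differentiating \<open>h = 0\<close>
along the graph in the direction \<open>v\<close> therefore leaves
\<open>(\<partial>h/\<partial>\<tau>) (Z, \<chi>, P (\<chi>, Z)) * (D\<^sub>Z P) (\<chi>, Z) v = 0\<close> for all \<open>\<chi>\<close>.
Finite nondegeneracy of \<open>M\<close> says that the second factor is not identically zero in \<open>\<chi>\<close>, for every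
nonzero \<open>v\<close> and every \<open>Z\<close> in a fixed neighbourhood of \<open>0\<close>; so \<open>\<partial>h/\<partial>\<tau>\<close> vanishes on the whole Segre
variety of \<open>Z\<close>. If \<open>H\<close> is singular at all points of an open set, the step can be repeated with
\<open>\<partial>h/\<partial>\<tau>\<close>, and so on; then \<open>h\<close> vanishes identically (\<open>vanishing_propagates\<close>,
\<open>singular_open_imp_flat\<close>). Setting \<open>\<zeta> = 0\<close> and \<open>Z = 0\<close> in \<open>h = 0\<close> gives \<open>g = 0\<close> and \<open>gt = 0\<close>, which
is the first alternative.

It remains to see that singularity at the single point \<open>0\<close> already forces singularity on open sets.
If \<open>H\<close> is singular at \<open>0\<close>, the basic step at \<open>Z = 0\<close> shows that the normal derivative of \<open>gt\<close>
vanishes along \<open>\<tau> = 0\<close>, where \<open>gt\<close> itself vanishes; hence \<open>Ht\<close> is singular at all points of that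
variety. Now exchange the roles of \<open>H\<close> and \<open>Ht\<close>: the basic step at those points shows that
\<open>Q' (f Z, ft (\<chi>, 0), 0)\<close>, as a function of \<open>\<chi>\<close> with \<open>f Z\<close> held fixed, has vanishing derivative
whenever \<open>Z\<close> lies on the Segre variety of \<open>(\<chi>, 0)\<close>. These Segre varieties sweep out an open set of
points \<open>Z\<close>, again by nondegeneracy. If the pairs \<open>(f Z, \<chi>)\<close> fill an open set as well, the derivative
vanishes identically, so \<open>Q' (\<cdot>, ft (\<chi>, 0), 0) = 0\<close> and \<open>g\<close> vanishes at the swept points; if they
do not, \<open>f\<close> has a kernel tangent to the Segre varieties, and this kernel lies in that of \<open>g\<close> too.
Either way \<open>H\<close> is singular on an open set arbitrarily close to \<open>0\<close> (\<open>flat_bottom_imp_singular\<close>).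

If both halves are nonsingular at \<open>0\<close>, the map is a local biholomorphism by the inverse function
theorem. As \<open>g\<close> vanishes on \<open>w = 0\<close>, its Jacobian matrix at \<open>0\<close> is block triangular, which gives the
determinants and the normal derivatives, and the identity obtained by differentiating \<open>h\<close> along the
graph carries nondegeneracy over to \<open>M'\<close> (\<open>nondegenerate_target\<close>).
\<close>

section \<open>Holomorphic functions of several complex variables\<close>

abbreviation deriv_at :: "('a::complex_normed_space \<Rightarrow> 'b::complex_normed_space) \<Rightarrow> 'a \<Rightarrow> 'a \<Rightarrow> 'b" (\<open>\<DD>\<close>)
  where "\<DD> F p \<equiv> frechet_derivative F (at p)"

definition hol_on ::
    "'a set \<Rightarrow> ('a::complex_normed_space \<Rightarrow> 'b::complex_normed_space) \<Rightarrow> bool" where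
  "hol_on S F \<longleftrightarrow> (\<forall>p\<in>S. complex_differentiable_at F p)"

lemma bounded_bilinear_scaleC:
  "bounded_bilinear (scaleC :: complex \<Rightarrow> 'a::complex_normed_space \<Rightarrow> 'a)"
proof
  fix c d :: complex and x y :: 'a and r :: real
  show "(c + d) *\<^sub>C x = c *\<^sub>C x + d *\<^sub>C x" "c *\<^sub>C (x + y) = c *\<^sub>C x + c *\<^sub>C y"
    by (simp_all add: scaleC_add_left scaleC_add_right)
  show "(r *\<^sub>R c) *\<^sub>C x = r *\<^sub>R (c *\<^sub>C x)" "c *\<^sub>C (r *\<^sub>R x) = r *\<^sub>R (c *\<^sub>C x)"
    by (simp_all add: scaleR_conv_of_real scaleC_scaleC mult.commute flip: scaleC_of_real)
  show "\<exists>K. \<forall>a b. norm (a *\<^sub>C (b::'a)) \<le> norm a * norm b * K"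
    by (rule exI[of _ 1]) (simp add: norm_scaleC)
qed

interpretation scaleC: bounded_bilinear scaleC
  by (rule bounded_bilinear_scaleC)

lemmas [continuous_intros] = scaleC.continuous_on

lemma scaleC_one [simp]: "1 *\<^sub>C (x::'a::complex_normed_space) = x"
  using scaleC_of_real[of 1 x] by simp

lemma scaleC_prod [simp]: "c *\<^sub>C (a, b) = (c *\<^sub>C a, c *\<^sub>C b)"
  by (simp add: scaleC_prod_def)

lemma scaleC_complex [simp]: "c *\<^sub>C (x::complex) = c * x"
  by (simp add: scaleC_complex_def)

lemma scaleC_nth [simp]: "(c *\<^sub>C x) $ i = c *\<^sub>C (x $ i)"
  by (simp add: scaleC_vec_def)

lemma deriv_at_eqI: "(F has_derivative D) (at p) \<Longrightarrow> \<DD> F p = D"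
  by (rule frechet_derivative_at[symmetric])

lemma has_derivative_deriv_at:
  "complex_differentiable_at F p \<Longrightarrow> (F has_derivative \<DD> F p) (at p)"
  unfolding complex_differentiable_at_def using deriv_at_eqI by blast

lemma deriv_at_scaleC:
  "complex_differentiable_at F p \<Longrightarrow> \<DD> F p (c *\<^sub>C v) = c *\<^sub>C \<DD> F p v"
  unfolding complex_differentiable_at_def using deriv_at_eqI by metis

lemma bounded_linear_deriv_at:
  "complex_differentiable_at F p \<Longrightarrow> bounded_linear (\<DD> F p)"
  using has_derivative_deriv_at has_derivative_bounded_linear by blast

lemma deriv_at_add:
  "complex_differentiable_at F p \<Longrightarrow> \<DD> F p (v + w) = \<DD> F p v + \<DD> F p w"
  using bounded_linear_deriv_at linear_add bounded_linear.linear by blast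

lemma deriv_at_zero [simp]:
  "complex_differentiable_at F p \<Longrightarrow> \<DD> F p 0 = 0"
  using bounded_linear_deriv_at linear_0 bounded_linear.linear by blast

lemma complex_differentiable_atI:
  "(F has_derivative D) (at p) \<Longrightarrow> (\<And>c v. D (c *\<^sub>C v) = c *\<^sub>C D v) \<Longrightarrow> complex_differentiable_at F p"
  unfolding complex_differentiable_at_def by blast

lemma complex_differentiable_imp_isCont:
  "complex_differentiable_at F p \<Longrightarrow> isCont F p"
  using has_derivative_continuous has_derivative_deriv_at by blast

lemma hol_on_imp_continuous_on: "hol_on S F \<Longrightarrow> continuous_on S F"
  unfolding hol_on_def
  by (meson complex_differentiable_imp_isCont continuous_at_imp_continuous_on)

lemma slice_has_field_derivative:
  fixes F :: "'a::complex_normed_space \<Rightarrow> complex"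
  assumes "complex_differentiable_at F (p + t *\<^sub>C v)"
  shows "((\<lambda>t. F (p + t *\<^sub>C v)) has_field_derivative \<DD> F (p + t *\<^sub>C v) v) (at t)"
proof -
  have "((\<lambda>t. p + t *\<^sub>C v) has_derivative (\<lambda>s. s *\<^sub>C v)) (at t)"
    using has_derivative_add[OF has_derivative_const bounded_linear_imp_has_derivative[OF scaleC.bounded_linear_left]]
    by simp
  from has_derivative_compose[OF this has_derivative_deriv_at[OF assms]]
  show ?thesis
    by (simp add: has_field_derivative_def deriv_at_scaleC[OF assms] mult_commute_abs)
qed

lemma open_slice: "open S \<Longrightarrow> open {t. p + t *\<^sub>C v \<in> S}"
  for p v :: "'a::complex_normed_space"
  using open_vimage[of S "\<lambda>t. p + t *\<^sub>C v"] by (simp add: vimage_def continuous_intros)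

lemma slice_holomorphic:
  fixes F :: "'a::complex_normed_space \<Rightarrow> complex"
  assumes "hol_on S F" "open S"
  shows "(\<lambda>t. F (p + t *\<^sub>C v)) holomorphic_on {t. p + t *\<^sub>C v \<in> S}"
  using assms slice_has_field_derivative unfolding holomorphic_on_open[OF open_slice[OF assms(2)]] hol_on_def
  by blast

lemma convex_slice: "convex S \<Longrightarrow> convex {t. p + t *\<^sub>C v \<in> S}"
  for p v :: "'a::complex_normed_space"
proof (rule convexI, clarsimp)
  fix x y :: complex and a b :: real
  assume "convex S" "p + x *\<^sub>C v \<in> S" "p + y *\<^sub>C v \<in> S" "0 \<le> a" "0 \<le> b" "a + b = 1"
  then have "a *\<^sub>R (p + x *\<^sub>C v) + b *\<^sub>R (p + y *\<^sub>C v) \<in> S"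
    by (simp add: convexD)
  moreover have "a *\<^sub>R (p + x *\<^sub>C v) + b *\<^sub>R (p + y *\<^sub>C v) = (a + b) *\<^sub>R p + (a *\<^sub>R x + b *\<^sub>R y) *\<^sub>C v"
    by (simp add: algebra_simps scaleC.add_left scaleC.scaleR_left)
  ultimately show "p + (a *\<^sub>R x + b *\<^sub>R y) *\<^sub>C v \<in> S"
    by (simp add: \<open>a + b = 1\<close>)
qed

text \<open>
The restriction of \<open>F\<close> to the complex line through \<open>q\<close> and a point of \<open>U\<close> is holomorphic on a convex
open set and vanishes near one of its points.
\<close>

lemma hol_on_identity:
  fixes F :: "'a::complex_normed_space \<Rightarrow> complex"
  assumes hol: "hol_on S F" and S: "open S" "convex S"
    and U: "open U" "U \<noteq> {}" "U \<subseteq> S" "\<And>p. p \<in> U \<Longrightarrow> F p = 0" and q: "q \<in> S"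
  shows "F q = 0"
proof -
  obtain p where p: "p \<in> U" using U by auto
  define \<phi> where "\<phi> = (\<lambda>t. F (p + t *\<^sub>C (q - p)))"
  let ?T = "{t. p + t *\<^sub>C (q - p) \<in> S}"
  have "\<phi> 1 = 0"
  proof (rule analytic_continuation_open[of "{t. p + t *\<^sub>C (q - p) \<in> U}" ?T \<phi> "\<lambda>_. 0"])
    show "{t. p + t *\<^sub>C (q - p) \<in> U} \<noteq> {}"
      using p by (auto intro!: exI[of _ 0] simp: scaleC.zero_left)
    show "\<phi> holomorphic_on ?T"
      unfolding \<phi>_def by (rule slice_holomorphic[OF hol S(1)])
  qed (use S U q in \<open>auto intro!: open_slice convex_connected convex_slice simp: \<phi>_def\<close>)
  then show ?thesis by (simp add: \<phi>_def)
qed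

text \<open>
Cauchy's formula for the first derivative on the disc \<open>p + u *\<^sub>C v\<close> writes a directional derivative as
a mean of values of \<open>F\<close>. All regularity of the derivative follows from this formula, because its
right-hand side depends on \<open>p\<close> only through the argument of \<open>F\<close>.
\<close>

lemma deriv_at_Cauchy:
  fixes F :: "'a::complex_normed_space \<Rightarrow> complex"
  assumes hol: "hol_on S F" and S: "open S" and r: "r > 0"
    and sub: "\<And>u. norm u \<le> r \<Longrightarrow> p + u *\<^sub>C v \<in> S"
  shows "((\<lambda>t. F (p + (of_real r * cis t) *\<^sub>C v) / (of_real r * cis t)) has_integral 2 * pi * \<DD> F p v)
           {0..2*pi}"
proof -
  let ?\<phi> = "\<lambda>t. F (p + t *\<^sub>C v)"
  have hol\<phi>: "?\<phi> holomorphic_on {t. p + t *\<^sub>C v \<in> S}"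
    by (rule slice_holomorphic[OF hol S])
  have p: "p \<in> S" using sub[of 0] r by (simp add: scaleC.zero_left)
  have d: "deriv ?\<phi> 0 = \<DD> F p v"
    using slice_has_field_derivative[of F p 0 v] p hol unfolding hol_on_def
    by (intro DERIV_imp_deriv) (simp add: scaleC.zero_left)
  have "((\<lambda>u. ?\<phi> u / (u - 0) ^ Suc 1) has_contour_integral (2 * pi * \<i> / fact 1 * (deriv ^^ 1) ?\<phi> 0)) (circlepath 0 r)"
    using hol\<phi> sub r
    by (intro Cauchy_has_contour_integral_higher_derivative_circlepath)
       (auto intro!: holomorphic_on_imp_continuous_on elim!: holomorphic_on_subset)
  then have "((\<lambda>t. ?\<phi> (r * cis t) / (r * cis t)^2 * r * \<i> * cis t) has_integral 2 * pi * \<i> * \<DD> F p v) {0..2*pi}"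
    unfolding circlepath_def
    by (subst (asm) has_contour_integral_part_circlepath_iff) (use d in \<open>simp_all add: power2_eq_square\<close>)
  from has_integral_mult_right[OF this, of "-\<i>"]
  show ?thesis
    by (rule has_integral_eq_rhs[OF has_integral_eq, rotated 1])
       (use r in \<open>auto simp: field_simps power2_eq_square\<close>)
qed

lemma small_disc_in_open:
  fixes p :: "'a::complex_normed_space"
  assumes "open S" "p \<in> S"
  obtains e r where "e > 0" "r > 0" "ball p e \<subseteq> S"
    "\<And>q u. q \<in> ball p e \<Longrightarrow> norm u \<le> r \<Longrightarrow> q + u *\<^sub>C v \<in> S"
proof -
  obtain d where d: "d > 0" "ball p d \<subseteq> S" using assms open_contains_ball by blast
  \<comment> \<open>the summand \<open>1\<close> keeps the denominator positive when \<open>v = 0\<close>\<close>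
  define e r where "e = d / 2" and "r = d / (2 * (norm v + 1))"
  have r: "r * norm v < d / 2" using d by (simp add: r_def field_simps add_pos_nonneg)
  have "q + u *\<^sub>C v \<in> S" if "q \<in> ball p e" "norm u \<le> r" for q u
  proof -
    have "dist p (q + u *\<^sub>C v) \<le> dist p q + norm (u *\<^sub>C v)"
      by (metis add.commute add_diff_cancel_left' dist_norm dist_triangle dist_commute)
    also have "\<dots> \<le> dist p q + r * norm v"
      using that by (simp add: norm_scaleC mult_right_mono)
    also have "\<dots> < d" using that r by (simp add: e_def)
    finally show ?thesis using d by auto
  qed
  moreover have "e > 0" "r > 0" "ball p e \<subseteq> S"
    using d by (auto simp: e_def r_def intro!: divide_pos_pos add_nonneg_pos)
  ultimately show ?thesis using that by blast
qed

lemma continuous_on_circle_mean: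
  fixes G :: "'a::complex_normed_space \<Rightarrow> complex"
  assumes "continuous_on S G" and r: "r > 0"
    and "\<And>q u. q \<in> U \<Longrightarrow> norm u \<le> r \<Longrightarrow> q + u *\<^sub>C v \<in> S"
  shows "continuous_on (U \<times> cbox 0 (2*pi))
           (\<lambda>(q, t). G (q + (of_real r * cis t) *\<^sub>C v) / (of_real r * cis t))"
  unfolding split_beta
  using r assms(3)
  by (intro continuous_intros continuous_on_compose2[OF assms(1)] continuous_on_cis) (auto simp: norm_mult)

text \<open>
Complex differentiability at every point does not include continuity of the derivative; it holds
since the circle means of a continuous function depend continuously on the centre.
\<close>

lemma continuous_on_deriv_at:
  fixes F :: "'a::complex_normed_space \<Rightarrow> complex"
  assumes hol: "hol_on S F" and S: "open S"
  shows "continuous_on S (\<lambda>p. \<DD> F p v)"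
proof (rule continuous_at_imp_continuous_on, clarify)
  fix p assume p: "p \<in> S"
  obtain e r where er: "e > 0" "r > 0" "ball p e \<subseteq> S"
    and sub: "\<And>q u. q \<in> ball p e \<Longrightarrow> norm u \<le> r \<Longrightarrow> q + u *\<^sub>C v \<in> S"
    using small_disc_in_open[OF S p] by blast
  let ?f = "\<lambda>q t. F (q + (of_real r * cis t) *\<^sub>C v) / (of_real r * cis t)"
  have mean: "integral (cbox 0 (2*pi)) (?f q) = 2 * pi * \<DD> F q v" if "q \<in> ball p e" for q
    using integral_unique[OF deriv_at_Cauchy[OF hol S er(2) sub[OF that]]] by simp
  have "continuous_on (ball p e) (\<lambda>q. integral (cbox 0 (2*pi)) (?f q))"
    by (rule integral_continuous_on_param, rule continuous_on_circle_mean)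
       (use hol er sub in \<open>auto intro: hol_on_imp_continuous_on\<close>)
  then have "continuous_on (ball p e) (\<lambda>q. integral (cbox 0 (2*pi)) (?f q) / (2 * pi))"
    by (intro continuous_intros) auto
  also have "?this \<longleftrightarrow> continuous_on (ball p e) (\<lambda>q. \<DD> F q v)"
    by (intro continuous_on_cong) (simp_all only: mean, simp_all)
  finally show "isCont (\<lambda>p. \<DD> F p v) p"
    using er by (simp add: continuous_on_eq_continuous_at)
qed

text \<open>
The circle mean may be differentiated under the integral sign, the derivative of \<open>F\<close> being continuous
by the previous result. The formula for \<open>D w\<close> is kept because it yields both the complex linearity of
\<open>D\<close> and the symmetry of second derivatives.
\<close>

lemma deriv_at_has_derivative:
  fixes F :: "'a::{complex_normed_space,euclidean_space} \<Rightarrow> complex"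
  assumes hol: "hol_on S F" and S: "open S" and p: "p \<in> S"
  obtains D :: "'a \<Rightarrow> complex" and r :: real
  where "((\<lambda>p. \<DD> F p v) has_derivative D) (at p)" "r > 0"
    "\<And>u. norm u \<le> r \<Longrightarrow> p + u *\<^sub>C v \<in> S"
    "\<And>w. ((\<lambda>t. \<DD> F (p + (of_real r * cis t) *\<^sub>C v) w / (of_real r * cis t)) has_integral 2 * pi * D w) {0..2*pi}"
proof -
  obtain e r where er: "e > 0" "r > 0" "ball p e \<subseteq> S"
    and sub: "\<And>q u. q \<in> ball p e \<Longrightarrow> norm u \<le> r \<Longrightarrow> q + u *\<^sub>C v \<in> S"
    using small_disc_in_open[OF S p] by blast
  let ?U = "ball p e" and ?I = "cbox 0 (2*pi)"
  let ?c = "\<lambda>t. of_real r * cis t :: complex"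
  let ?f = "\<lambda>q t. F (q + ?c t *\<^sub>C v) / ?c t"
  define f' where "f' = (\<lambda>q t. Blinfun (\<lambda>w. \<DD> F (q + ?c t *\<^sub>C v) w / ?c t))"
  have cd: "complex_differentiable_at F (q + ?c t *\<^sub>C v)" if "q \<in> ?U" for q t
    using hol sub[OF that] er unfolding hol_on_def by (simp add: norm_mult)
  have f'_apply: "blinfun_apply (f' q t) w = \<DD> F (q + ?c t *\<^sub>C v) w / ?c t" if "q \<in> ?U" for q t w
    unfolding f'_def
    by (subst bounded_linear_Blinfun_apply)
       (auto intro!: bounded_linear_divide[THEN bounded_linear_compose] bounded_linear_deriv_at cd that)
  have cont: "continuous_on (?U \<times> ?I) (\<lambda>(q, t). f' q t)"
    unfolding split_beta
  proof (rule continuous_on_blinfun_componentwise)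
    fix i :: 'a assume "i \<in> Basis"
    have "continuous_on (?U \<times> ?I) (\<lambda>(q, t). \<DD> F (q + ?c t *\<^sub>C v) i / ?c t)"
      by (rule continuous_on_circle_mean[OF continuous_on_deriv_at[OF hol S] er(2) sub])
    then show "continuous_on (?U \<times> ?I) (\<lambda>x. blinfun_apply (f' (fst x) (snd x)) i)"
      by (rule continuous_on_eq) (auto simp: f'_apply)
  qed
  have pU: "p \<in> ?U" using er by simp
  have D1: "((\<lambda>q. integral ?I (?f q)) has_derivative integral ?I (f' p)) (at p within ?U)"
  proof (rule leibniz_rule[OF _ _ cont pU convex_ball])
    fix q and t :: real assume q: "q \<in> ?U"
    have "((\<lambda>q. F (q + ?c t *\<^sub>C v)) has_derivative \<DD> F (q + ?c t *\<^sub>C v)) (at q)"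
      by (rule has_derivative_compose[where f = "\<lambda>q. q + ?c t *\<^sub>C v" and f' = "\<lambda>x. x" and g = F,
            OF _ has_derivative_deriv_at[OF cd[OF q]]]) (auto intro!: derivative_eq_intros)
    then have "((\<lambda>q. ?f q t) has_derivative (\<lambda>w. \<DD> F (q + ?c t *\<^sub>C v) w / ?c t)) (at q)"
      by (rule bounded_linear.has_derivative[OF bounded_linear_divide])
    then show "((\<lambda>q. ?f q t) has_derivative blinfun_apply (f' q t)) (at q within ?U)"
      using f'_apply[OF q] by (metis (no_types, lifting) ext has_derivative_at_withinI)
  next
    fix q assume "q \<in> ?U"
    then show "?f q integrable_on ?I"
      using deriv_at_Cauchy[OF hol S er(2) sub] by auto
  qed
  then have "((\<lambda>q. integral ?I (?f q)) has_derivative integral ?I (f' p)) (at p)"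
    using at_within_open[OF pU] by simp
  then have "((\<lambda>q. integral ?I (?f q) / (2*pi)) has_derivative (\<lambda>w. integral ?I (f' p) w / (2*pi))) (at p)"
    by (rule bounded_linear.has_derivative[OF bounded_linear_divide])
  then have D2: "((\<lambda>q. \<DD> F q v) has_derivative (\<lambda>w. integral ?I (f' p) w / (2*pi))) (at p)"
  proof (rule has_derivative_transform_within_open[OF _ open_ball pU])
    fix q assume "q \<in> ?U"
    then show "integral ?I (?f q) / (2*pi) = \<DD> F q v"
      using integral_unique[OF deriv_at_Cauchy[OF hol S er(2) sub]] by simp
  qed
  have "f' p integrable_on ?I"
    by (rule integrable_continuous, rule continuous_on_compose2[OF cont, of _ "\<lambda>t. (p, t)", simplified])
       (use er in \<open>auto intro!: continuous_intros\<close>)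
  then have "((\<lambda>t. \<DD> F (p + ?c t *\<^sub>C v) w / ?c t) has_integral blinfun_apply (integral ?I (f' p)) w) ?I" for w
    using has_integral_linear[OF integrable_integral blinfun.bounded_linear_left, of "f' p" ?I w]
      pU by (simp add: o_def f'_apply)
  with D2 er sub[OF pU] show ?thesis
    by (intro that[of "\<lambda>w. integral ?I (f' p) w / (2*pi)" r]) auto
qed

lemma hol_on_deriv_at:
  fixes F :: "'a::{complex_normed_space,euclidean_space} \<Rightarrow> complex"
  assumes hol: "hol_on S F" and S: "open S"
  shows "hol_on S (\<lambda>p. \<DD> F p v)"
  unfolding hol_on_def
proof
  fix p assume "p \<in> S"
  with hol S obtain D :: "'a \<Rightarrow> complex" and r :: real
    where D: "((\<lambda>p. \<DD> F p v) has_derivative D) (at p)" and r: "r > 0"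
    and sub: "\<And>u. norm u \<le> r \<Longrightarrow> p + u *\<^sub>C v \<in> S"
    and *: "\<And>w. ((\<lambda>t. \<DD> F (p + (of_real r * cis t) *\<^sub>C v) w / (of_real r * cis t)) has_integral 2 * pi * D w) {0..2*pi}"
    by (rule deriv_at_has_derivative[where v = v]) blast
  show "complex_differentiable_at (\<lambda>p. \<DD> F p v) p"
  proof (rule complex_differentiable_atI[OF D])
    fix c w
    have "\<DD> F (p + (of_real r * cis t) *\<^sub>C v) (c *\<^sub>C w) = c * \<DD> F (p + (of_real r * cis t) *\<^sub>C v) w" for t
      using hol sub[of "of_real r * cis t"] r unfolding hol_on_def
      by (subst deriv_at_scaleC) (auto simp: norm_mult)
    then have "2 * pi * D (c *\<^sub>C w) = c * (2 * pi * D w)"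
      using *[of "c *\<^sub>C w"] has_integral_mult_right[OF *[of w], of c]
      by (auto dest: has_integral_unique)
    then show "D (c *\<^sub>C w) = c *\<^sub>C D w" by simp
  qed
qed

text \<open>
Both sides equal the circle mean, in the direction \<open>v\<close>, of the derivative of \<open>F\<close> in the direction \<open>w\<close>.
\<close>

lemma deriv_at_commute:
  fixes F :: "'a::{complex_normed_space,euclidean_space} \<Rightarrow> complex"
  assumes hol: "hol_on S F" and S: "open S" and p: "p \<in> S"
  shows "\<DD> (\<lambda>p. \<DD> F p v) p w = \<DD> (\<lambda>p. \<DD> F p w) p v"
proof -
  obtain D :: "'a \<Rightarrow> complex" and r :: real
    where D: "((\<lambda>p. \<DD> F p v) has_derivative D) (at p)" and r: "r > 0"
    and sub: "\<And>u. norm u \<le> r \<Longrightarrow> p + u *\<^sub>C v \<in> S"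
    and *: "\<And>w. ((\<lambda>t. \<DD> F (p + (of_real r * cis t) *\<^sub>C v) w / (of_real r * cis t)) has_integral 2 * pi * D w) {0..2*pi}"
    using hol S p by (rule deriv_at_has_derivative[where v = v]) blast
  have "2 * pi * D w = 2 * pi * \<DD> (\<lambda>p. \<DD> F p w) p v"
    using deriv_at_Cauchy[OF hol_on_deriv_at[OF hol S] S r sub] * by (rule has_integral_unique[rotated])
  then show ?thesis using deriv_at_eqI[OF D] by simp
qed

section \<open>Calculus of complex derivatives and the inverse function theorem\<close>

lemma complex_differentiable_at_compose:
  assumes "complex_differentiable_at G p" "complex_differentiable_at F (G p)"
  shows "complex_differentiable_at (\<lambda>x. F (G x)) p"
    and deriv_at_compose: "\<DD> (\<lambda>x. F (G x)) p v = \<DD> F (G p) (\<DD> G p v)"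
proof -
  have *: "((\<lambda>x. F (G x)) has_derivative (\<lambda>v. \<DD> F (G p) (\<DD> G p v))) (at p)"
    by (rule has_derivative_compose[OF has_derivative_deriv_at[OF assms(1)] has_derivative_deriv_at[OF assms(2)]])
  show "complex_differentiable_at (\<lambda>x. F (G x)) p"
    by (rule complex_differentiable_atI[OF *]) (simp add: deriv_at_scaleC assms)
  show "\<DD> (\<lambda>x. F (G x)) p v = \<DD> F (G p) (\<DD> G p v)"
    by (simp add: deriv_at_eqI[OF *])
qed

lemma complex_differentiable_at_linear:
  assumes "bounded_linear L" "\<And>c v. L (c *\<^sub>C v) = c *\<^sub>C L v"
  shows "complex_differentiable_at L p" and deriv_at_linear: "\<DD> L p = L"
  by (rule complex_differentiable_atI[OF bounded_linear_imp_has_derivative[OF assms(1)] assms(2)],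
      rule deriv_at_eqI[OF bounded_linear_imp_has_derivative[OF assms(1)]])

lemma complex_differentiable_at_const [simp]: "complex_differentiable_at (\<lambda>_. c) p"
  and deriv_at_const [simp]: "\<DD> (\<lambda>_. c) p = (\<lambda>_. 0)"
  by (rule complex_differentiable_atI[OF has_derivative_const], simp add: scaleC.zero_right,
      rule deriv_at_eqI[OF has_derivative_const])

lemma complex_differentiable_at_id [simp]: "complex_differentiable_at (\<lambda>x. x) p"
  and deriv_at_id [simp]: "\<DD> (\<lambda>x. x) p = (\<lambda>x. x)"
  by (rule complex_differentiable_at_linear[OF bounded_linear_ident], simp,
      rule deriv_at_linear[OF bounded_linear_ident], simp)

lemma complex_differentiable_at_diff:
  assumes "complex_differentiable_at F p" "complex_differentiable_at G p"
  shows "complex_differentiable_at (\<lambda>x. F x - G x) p"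
    and deriv_at_diff2: "\<DD> (\<lambda>x. F x - G x) p v = \<DD> F p v - \<DD> G p v"
  by (rule complex_differentiable_atI[OF has_derivative_diff[OF has_derivative_deriv_at[OF assms(1)] has_derivative_deriv_at[OF assms(2)]]], simp add: assms scaleC.diff_right deriv_at_scaleC,
      simp add: deriv_at_eqI[OF has_derivative_diff[OF has_derivative_deriv_at[OF assms(1)] has_derivative_deriv_at[OF assms(2)]]])

lemma complex_differentiable_at_Pair:
  assumes "complex_differentiable_at F p" "complex_differentiable_at G p"
  shows "complex_differentiable_at (\<lambda>x. (F x, G x)) p"
    and deriv_at_Pair: "\<DD> (\<lambda>x. (F x, G x)) p v = (\<DD> F p v, \<DD> G p v)"
  by (rule complex_differentiable_atI[OF has_derivative_Pair[OF has_derivative_deriv_at[OF assms(1)] has_derivative_deriv_at[OF assms(2)]]], simp add: assms deriv_at_scaleC,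
      simp add: deriv_at_eqI[OF has_derivative_Pair[OF has_derivative_deriv_at[OF assms(1)] has_derivative_deriv_at[OF assms(2)]]])

lemma complex_differentiable_at_fst:
  assumes "complex_differentiable_at F p"
  shows "complex_differentiable_at (\<lambda>x. fst (F x)) p"
    and deriv_at_fst: "\<DD> (\<lambda>x. fst (F x)) p v = fst (\<DD> F p v)"
  by (rule complex_differentiable_atI[OF bounded_linear.has_derivative[OF bounded_linear_fst has_derivative_deriv_at[OF assms]]], simp add: assms deriv_at_scaleC scaleC_prod_def,
      simp add: deriv_at_eqI[OF bounded_linear.has_derivative[OF bounded_linear_fst has_derivative_deriv_at[OF assms]]])

lemma complex_differentiable_at_snd:
  assumes "complex_differentiable_at F p"
  shows "complex_differentiable_at (\<lambda>x. snd (F x)) p"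
    and deriv_at_snd: "\<DD> (\<lambda>x. snd (F x)) p v = snd (\<DD> F p v)"
  by (rule complex_differentiable_atI[OF bounded_linear.has_derivative[OF bounded_linear_snd has_derivative_deriv_at[OF assms]]], simp add: assms deriv_at_scaleC scaleC_prod_def,
      simp add: deriv_at_eqI[OF bounded_linear.has_derivative[OF bounded_linear_snd has_derivative_deriv_at[OF assms]]])

lemma complex_differentiable_at_mult_left:
  fixes F :: "'a::complex_normed_space \<Rightarrow> complex"
  assumes "complex_differentiable_at F p"
  shows "complex_differentiable_at (\<lambda>x. c * F x) p"
    and deriv_at_mult_left: "\<DD> (\<lambda>x. c * F x) p v = c * \<DD> F p v"
  by (rule complex_differentiable_atI[OF has_derivative_mult_right[OF has_derivative_deriv_at[OF assms], of c]], simp add: assms deriv_at_scaleC,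
      simp add: deriv_at_eqI[OF has_derivative_mult_right[OF has_derivative_deriv_at[OF assms], of c]])

lemma complex_differentiable_at_sum:
  assumes "\<And>i. i \<in> I \<Longrightarrow> complex_differentiable_at (F i) p"
  shows "complex_differentiable_at (\<lambda>x. \<Sum>i\<in>I. F i x) p"
    and deriv_at_sum: "\<DD> (\<lambda>x. \<Sum>i\<in>I. F i x) p v = (\<Sum>i\<in>I. \<DD> (F i) p v)"
  by (rule complex_differentiable_atI[OF has_derivative_sum[OF has_derivative_deriv_at[OF assms]]],
      assumption, simp add: assms deriv_at_scaleC sum_distrib_left scaleC.sum_right,
      simp add: deriv_at_eqI[OF has_derivative_sum[OF has_derivative_deriv_at[OF assms]]])

lemmas complex_differentiable_intros =
  complex_differentiable_at_const complex_differentiable_at_id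
  complex_differentiable_at_diff complex_differentiable_at_Pair
  complex_differentiable_at_fst complex_differentiable_at_snd

lemma complex_differentiable_at_cong:
  assumes "\<forall>\<^sub>F x in nhds p. F x = G x"
  shows "complex_differentiable_at F p \<longleftrightarrow> complex_differentiable_at G p"
    and deriv_at_cong: "\<DD> F p = \<DD> G p"
proof -
  have eq: "F p = G p" using assms by (rule eventually_nhds_x_imp_x)
  have "eventually (\<lambda>x. F x = G x) (at p)"
    using assms by (simp add: eventually_nhds_conv_at)
  then have *: "(F has_derivative D) (at p) \<longleftrightarrow> (G has_derivative D) (at p)" for D
    using eq has_derivative_transform_eventually[of F D p UNIV G] has_derivative_transform_eventually[of G D p UNIV F]
    by (auto simp: eq_commute)
  show "complex_differentiable_at F p \<longleftrightarrow> complex_differentiable_at G p"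
    unfolding complex_differentiable_at_def by (simp add: *)
  show "\<DD> F p = \<DD> G p"
    unfolding frechet_derivative_def by (simp add: *)
qed

lemma hol_near0_iff: "hol_near0 F \<longleftrightarrow> (\<exists>r>0. hol_on (ball 0 r) F)"
  unfolding hol_near0_def hol_on_def eventually_nhds_metric
  by (auto simp: dist_commute)

lemma hol_near0_imp_at0: "hol_near0 F \<Longrightarrow> complex_differentiable_at F 0"
  unfolding hol_near0_def by (rule eventually_nhds_x_imp_x)

lemma hol_near0_compose:
  assumes "hol_near0 F" "hol_near0 G" "G 0 = 0"
  shows "hol_near0 (\<lambda>x. F (G x))"
proof -
  have "filterlim G (nhds 0) (nhds 0)"
    using complex_differentiable_imp_isCont[OF hol_near0_imp_at0[OF assms(2)]] assms(3)
    by (metis isCont_def tendsto_at_iff_tendsto_nhds)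
  with assms(1) have "\<forall>\<^sub>F x in nhds 0. complex_differentiable_at F (G x)"
    unfolding hol_near0_def by (rule eventually_compose_filterlim)
  with assms(2) show ?thesis
    unfolding hol_near0_def by eventually_elim (rule complex_differentiable_at_compose)
qed

lemma eventually_compose_nhds0:
  assumes "\<forall>\<^sub>F q in nhds 0. \<Phi> q" "isCont G 0" "G 0 = 0"
  shows "\<forall>\<^sub>F p in nhds 0. \<Phi> (G p)"
proof -
  have "filterlim G (nhds 0) (nhds 0)"
    using assms(2,3) by (metis isCont_def tendsto_at_iff_tendsto_nhds)
  with assms(1) show ?thesis by (rule eventually_compose_filterlim)
qed

lemma eventually_nhds_0_ball:
  "(\<forall>\<^sub>F x in nhds (0::'a::real_normed_vector). \<Phi> x) \<longleftrightarrow> (\<exists>r>0. \<forall>x. norm x < r \<longrightarrow> \<Phi> x)"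
  by (simp add: eventually_nhds_metric)

text \<open>
The complex-linear functional whose real part is the real coordinate along \<open>b\<close>. Composing with these
functionals reduces statements about vector-valued maps to complex-valued ones.
\<close>

definition complex_coord :: "'b::{complex_normed_space,euclidean_space} \<Rightarrow> 'b \<Rightarrow> complex" where
  "complex_coord b x = complex_of_real (x \<bullet> b) - \<i> * complex_of_real ((\<i> *\<^sub>C x) \<bullet> b)"

lemma complex_coord_scaleC: "complex_coord b (c *\<^sub>C x) = c *\<^sub>C complex_coord b x"
proof -
  have c: "c *\<^sub>C x = Re c *\<^sub>R x + Im c *\<^sub>R (\<i> *\<^sub>C x)"
    by (subst (1) complex_eq[of c])
       (simp add: scaleC_add_left scaleC_of_real scaleC_scaleC[symmetric] mult.commute scaleC.scaleR_right del: complex_eq)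
  have ic: "\<i> *\<^sub>C (c *\<^sub>C x) = Re c *\<^sub>R (\<i> *\<^sub>C x) - Im c *\<^sub>R x"
    unfolding c using scaleC_of_real[of "-1" x]
    by (simp add: scaleC_add_right scaleC.scaleR_right scaleC_scaleC)
  show ?thesis
    unfolding complex_coord_def ic unfolding c
    by (simp add: inner_add_left inner_diff_left complex_eq_iff)
qed

lemma bounded_linear_complex_coord: "bounded_linear (complex_coord b)"
  unfolding complex_coord_def
  by (intro bounded_linear_sub bounded_linear_const_mult bounded_linear_of_real[THEN bounded_linear_compose]
      bounded_linear_inner_left[THEN bounded_linear_compose] scaleC.bounded_linear_right bounded_linear_inner_left)

lemma Re_complex_coord: "Re (complex_coord b x) = x \<bullet> b"
  by (simp add: complex_coord_def)

lemma continuous_on_deriv_at_vec: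
  fixes F :: "'a::complex_normed_space \<Rightarrow> 'b::{complex_normed_space,euclidean_space}"
  assumes hol: "hol_on S F" and S: "open S"
  shows "continuous_on S (\<lambda>p. \<DD> F p v)"
proof (subst continuous_on_componentwise, rule ballI)
  fix b :: 'b assume "b \<in> Basis"
  note L = bounded_linear_complex_coord[of b] complex_coord_scaleC[of b]
  have D: "\<DD> (\<lambda>x. complex_coord b (F x)) p v = complex_coord b (\<DD> F p v)"
    and cd: "complex_differentiable_at (\<lambda>x. complex_coord b (F x)) p" if "p \<in> S" for p
    using that hol complex_differentiable_at_compose[of F p "complex_coord b"] deriv_at_compose[of F p "complex_coord b"]
      complex_differentiable_at_linear[OF L] deriv_at_linear[OF L]
    unfolding hol_on_def by auto
  have "continuous_on S (\<lambda>p. Re (\<DD> (\<lambda>x. complex_coord b (F x)) p v))"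
    by (intro continuous_intros continuous_on_deriv_at S) (simp add: hol_on_def cd)
  then show "continuous_on S (\<lambda>p. \<DD> F p v \<bullet> b)"
    by (rule continuous_on_eq) (simp add: D Re_complex_coord)
qed

lemma continuous_on_Blinfun_deriv_at:
  fixes F :: "'a::{complex_normed_space,euclidean_space} \<Rightarrow> 'b::{complex_normed_space,euclidean_space}"
  assumes hol: "hol_on S F" and S: "open S"
  shows "continuous_on S (\<lambda>p. Blinfun (\<DD> F p))"
proof (rule continuous_on_blinfun_componentwise)
  fix i :: 'a assume "i \<in> Basis"
  show "continuous_on S (\<lambda>p. blinfun_apply (Blinfun (\<DD> F p)) i)"
    by (rule continuous_on_eq[OF continuous_on_deriv_at_vec[OF hol S, of i]])
       (use hol in \<open>simp add: bounded_linear_Blinfun_apply bounded_linear_deriv_at hol_on_def\<close>)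
qed

lemma tendsto_deriv_at:
  fixes F :: "'a::{complex_normed_space,euclidean_space} \<Rightarrow> 'b::{complex_normed_space,euclidean_space}"
  assumes hol: "hol_on S F" and S: "open S" and p: "p \<in> S"
    and lim: "q \<longlonglongrightarrow> p" "v \<longlonglongrightarrow> w"
  shows "(\<lambda>n. \<DD> F (q n) (v n)) \<longlonglongrightarrow> \<DD> F p w"
proof -
  have "isCont (\<lambda>p. Blinfun (\<DD> F p)) p"
    using continuous_on_Blinfun_deriv_at[OF hol S] S p by (simp add: continuous_on_eq_continuous_at)
  then have "(\<lambda>n. Blinfun (\<DD> F (q n))) \<longlonglongrightarrow> Blinfun (\<DD> F p)"
    using lim(1) isCont_tendsto_compose by blast
  then have "(\<lambda>n. blinfun_apply (Blinfun (\<DD> F (q n))) (v n)) \<longlonglongrightarrow> blinfun_apply (Blinfun (\<DD> F p)) w"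
    using lim(2) by (intro tendsto_intros)
  moreover have "\<forall>\<^sub>F n in sequentially. blinfun_apply (Blinfun (\<DD> F (q n))) (v n) = \<DD> F (q n) (v n)"
    using topological_tendstoD[OF lim(1) S p]
    by eventually_elim (use hol in \<open>simp add: bounded_linear_Blinfun_apply bounded_linear_deriv_at hol_on_def\<close>)
  ultimately show ?thesis
    using p hol by (simp add: bounded_linear_Blinfun_apply bounded_linear_deriv_at hol_on_def tendsto_cong)
qed

text \<open>
The real inverse function theorem applies because the derivative is continuous, and the derivative of
the local inverse is complex linear, being the inverse of a complex-linear bijection.
\<close>

lemma biholomorphism_near0I:
  fixes F :: "'a::{complex_normed_space,euclidean_space} \<Rightarrow> 'a"
  assumes "hol_near0 F" and inj: "\<And>v. \<DD> F 0 v = 0 \<Longrightarrow> v = 0"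
  shows "biholomorphism_near0 F"
proof -
  obtain r where r: "r > 0" and hol: "hol_on (ball 0 r) F"
    using assms(1) hol_near0_iff by blast
  define f' where "f' = (\<lambda>p. Blinfun (\<DD> F p))"
  have cd: "complex_differentiable_at F p" if "p \<in> ball 0 r" for p
    using hol that by (simp add: hol_on_def)
  have f': "blinfun_apply (f' p) = \<DD> F p" if "p \<in> ball 0 r" for p
    unfolding f'_def using bounded_linear_Blinfun_apply bounded_linear_deriv_at[OF cd[OF that]] by blast
  have bl: "bounded_linear (\<DD> F 0)" by (rule bounded_linear_deriv_at[OF cd]) (use r in auto)
  have inj0: "inj (\<DD> F 0)"
    using inj linear_injective_0 bl bounded_linear.linear by blast
  obtain g where g: "linear g" "g \<circ> \<DD> F 0 = id"
    using linear_injective_left_inverse[OF bounded_linear.linear[OF bl] inj0] by blast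
  have inv: "Blinfun g o\<^sub>L f' 0 = id_blinfun"
    by (rule blinfun_eqI)
       (use g r in \<open>simp add: bounded_linear_Blinfun_apply linear_conv_bounded_linear f' o_def id_def fun_eq_iff\<close>)
  have 0: "0 \<in> ball (0::'a) r" using r by simp
  have d: "(F has_derivative blinfun_apply (f' p)) (at p)" if "p \<in> ball 0 r" for p
    unfolding f'[OF that] by (rule has_derivative_deriv_at[OF cd[OF that]])
  have c: "continuous_on (ball 0 r) f'"
    unfolding f'_def by (rule continuous_on_Blinfun_deriv_at[OF hol open_ball])
  obtain U V G G' where U: "open U" "U \<subseteq> ball 0 r" "0 \<in> U" and V: "open V"
    and hom: "homeomorphism U V F G"
    and G: "\<And>y. y \<in> V \<Longrightarrow> (G has_derivative (G' y)) (at y)"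
      "\<And>y. y \<in> V \<Longrightarrow> G' y = inv (blinfun_apply (f' (G y)))"
      "\<And>y. y \<in> V \<Longrightarrow> bij (blinfun_apply (f' (G y)))"
    using inverse_function_theorem[OF open_ball d c 0 inv] by metis
  have "complex_differentiable_at G q" if "q \<in> V" for q
  proof (rule complex_differentiable_atI[OF G(1)[OF that]])
    fix k v
    have Gq: "G q \<in> ball 0 r" using hom that U by (auto simp: homeomorphism_def)
    let ?A = "\<DD> F (G q)"
    have A: "bij ?A" "G' q = inv ?A" using G(2,3)[OF that] by (simp_all add: f'[OF Gq])
    have "?A (G' q (k *\<^sub>C v)) = ?A (k *\<^sub>C G' q v)"
      using A by (simp add: deriv_at_scaleC[OF cd[OF Gq]] bij_is_surj surj_f_inv_f)
    then show "G' q (k *\<^sub>C v) = k *\<^sub>C G' q v"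
      using A(1) by (simp add: bij_is_inj inj_eq)
  qed
  then show ?thesis
    unfolding biholomorphism_near0_def
    using U V hom cd by (intro exI[of _ U] exI[of _ V] exI[of _ G]) (auto simp: homeomorphism_def)
qed

lemma open_image_of_surj_derivative:
  fixes \<phi> :: "'a::euclidean_space \<Rightarrow> 'b::euclidean_space"
  assumes "open V" "continuous_on V \<phi>" "x \<in> V" "(\<phi> has_derivative D) (at x)" "surj D"
  obtains U where "open U" "U \<noteq> {}" "U \<subseteq> \<phi> ` V"
proof -
  have "linear D" using assms(4) has_derivative_linear by blast
  then obtain g where g: "linear g" "D \<circ> g = id"
    using linear_surjective_right_inverse assms(5) by blast
  have "\<phi> x \<in> interior (\<phi> ` V)"
    by (rule sussmann_open_mapping[OF assms(1-4)])
       (use g assms in \<open>auto simp: linear_conv_bounded_linear interior_open\<close>)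
  then show ?thesis
    using that[of "interior (\<phi> ` V)"] interior_subset by blast
qed

section \<open>Nondegeneracy and propagation of zeros off a graph\<close>

text \<open>
Many arguments need a product of two balls rather than one ball of the product space: one variable is
then allowed to move over a whole ball while the other one is fixed.
\<close>

lemma eventually_nhds0_pair:
  "(\<forall>\<^sub>F (a, b) in nhds (0::'a::real_normed_vector \<times> 'b::real_normed_vector). \<Phi> a b) \<longleftrightarrow>
     (\<exists>r>0. \<forall>a b. norm a < r \<longrightarrow> norm b < r \<longrightarrow> \<Phi> a b)"
proof
  assume "\<forall>\<^sub>F (a, b) in nhds (0::'a \<times> 'b). \<Phi> a b"
  then obtain r where r: "r > 0" "\<And>a b. norm (a, b) < r \<Longrightarrow> \<Phi> a b"
    unfolding eventually_nhds_0_ball by auto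
  have "\<Phi> a b" if "norm a < r / 2" "norm b < r / 2" for a b
    using r(2)[of a b] norm_Pair_le[of a b] that by linarith
  then show "\<exists>r>0. \<forall>a b. norm a < r \<longrightarrow> norm b < r \<longrightarrow> \<Phi> a b"
    using r(1) half_gt_zero by blast
next
  assume "\<exists>r>0. \<forall>a b. norm a < r \<longrightarrow> norm b < r \<longrightarrow> \<Phi> a b"
  then obtain r where r: "r > 0" "\<And>a b. norm a < r \<Longrightarrow> norm b < r \<Longrightarrow> \<Phi> a b" by blast
  have "\<Phi> a b" if "norm (a, b) < r" for a b
    using r(2) that norm_fst_le[of a b] norm_snd_le[of b a] by fastforce
  then show "\<forall>\<^sub>F (a, b) in nhds (0::'a \<times> 'b). \<Phi> a b"
    unfolding eventually_nhds_0_ball using r(1) by auto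
qed

text \<open>
\<open>G\<close> vanishes on the nonempty open set where \<open>F\<close> does not.
\<close>

lemma hol_on_mult_eq_zero:
  fixes F G :: "'a::complex_normed_space \<Rightarrow> complex"
  assumes "hol_on S F" "hol_on S G" "open S" "convex S"
    and zero: "\<And>p. p \<in> S \<Longrightarrow> F p * G p = 0" and p: "p \<in> S" "F p \<noteq> 0" and q: "q \<in> S"
  shows "G q = 0"
proof (rule hol_on_identity[OF assms(2-4), of "{p \<in> S. F p \<noteq> 0}"])
  have "open (S \<inter> F -` (- {0}))"
    using continuous_open_preimage[OF hol_on_imp_continuous_on[OF assms(1)] \<open>open S\<close>] open_Compl by blast
  also have "S \<inter> F -` (- {0}) = {p \<in> S. F p \<noteq> 0}" by auto
  finally show "open {p \<in> S. F p \<noteq> 0}" .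
qed (use zero p q in auto)

text \<open>
For \<open>P = bar Q\<close> or \<open>P = Q\<close> in normal coordinates this is finite nondegeneracy without coordinates: no
nonzero vector is tangent at \<open>0\<close> to all Segre varieties \<open>{Z. P (x, Z) = 0}\<close> with \<open>x\<close> near \<open>0\<close>.
\<close>

definition nondegenerate_at0 :: "('b::complex_normed_space \<times> 'a::complex_normed_space \<Rightarrow> complex) \<Rightarrow> bool" where
  "nondegenerate_at0 P \<longleftrightarrow> (\<forall>v. (\<forall>\<^sub>F x in nhds 0. \<DD> P (x, 0) (0, v) = 0) \<longrightarrow> v = 0)"

text \<open>
Nondegeneracy at \<open>Z = 0\<close> persists for nearby \<open>Z\<close>, with a radius \<open>\<delta>\<close> for \<open>x\<close> that does not
depend on \<open>Z\<close> or \<open>v\<close>: otherwise unit kernel vectors at points tending to \<open>0\<close> would accumulate at a unit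
kernel vector at \<open>0\<close>, by compactness of the sphere and continuity of the derivative.
\<close>

lemma nondegenerate_near0:
  fixes P :: "'b::{complex_normed_space,euclidean_space} \<times> 'a::{complex_normed_space,euclidean_space} \<Rightarrow> complex"
  assumes nd: "nondegenerate_at0 P" and hol: "hol_near0 P" and \<delta>: "\<delta> > 0"
  obtains \<epsilon> where "\<epsilon> > 0"
    "\<And>Z v. norm Z < \<epsilon> \<Longrightarrow> v \<noteq> 0 \<Longrightarrow> \<exists>x. norm x < \<delta> \<and> \<DD> P (x, Z) (0, v) \<noteq> 0"
proof (rule ccontr)
  note thesisI = that
  assume "\<not> thesis"
  then have *: "\<exists>Z v. norm Z < \<epsilon> \<and> v \<noteq> 0 \<and> (\<forall>x. norm x < \<delta> \<longrightarrow> \<DD> P (x, Z) (0, v) = 0)" if "\<epsilon> > 0" for \<epsilon>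
    using thesisI that by blast
  obtain r where r: "r > 0" and holr: "hol_on (ball 0 r) P" using hol hol_near0_iff by blast
  have cd: "complex_differentiable_at P (x, Z)" if "norm x < r / 2" "norm Z < r / 2" for x Z
    using holr that norm_Pair_le[of x Z] unfolding hol_on_def by auto
  have "\<exists>Z v. norm Z < min (r / 2) (1 / real (Suc n)) \<and> norm v = 1 \<and>
      (\<forall>x. norm x < min \<delta> (r / 2) \<longrightarrow> \<DD> P (x, Z) (0, v) = 0)" for n
  proof -
    obtain Z v where Z: "norm Z < min (r / 2) (1 / real (Suc n))" "v \<noteq> 0"
        "\<And>x. norm x < \<delta> \<Longrightarrow> \<DD> P (x, Z) (0, v) = 0"
      using *[of "min (r / 2) (1 / real (Suc n))"] r by auto
    have "\<DD> P (x, Z) (0, (1 / norm v) *\<^sub>R v) = 0" if "norm x < min \<delta> (r / 2)" for x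
      using Z(3)[of x] that linear_scale[OF bounded_linear.linear[OF bounded_linear_deriv_at[OF cd[of x Z]]], of "1 / norm v" "(0, v)"]
      using Z(1) by simp
    then show ?thesis
      using Z by (intro exI[of _ Z] exI[of _ "(1 / norm v) *\<^sub>R v"]) auto
  qed
  then obtain Z v where Z: "\<And>n. norm (Z n) < min (r / 2) (1 / real (Suc n))" and v: "\<And>n. norm (v n) = 1"
    and zero: "\<And>n x. norm x < min \<delta> (r / 2) \<Longrightarrow> \<DD> P (x, Z n) (0, v n) = 0"
    by metis
  have "compact (sphere (0::'a) 1)" by simp
  then obtain w s where w: "w \<in> sphere 0 1" and s: "strict_mono (s::nat \<Rightarrow> nat)" "(v \<circ> s) \<longlonglongrightarrow> w"
    using v unfolding compact_def 
    by (elim allE[of _ v]) (auto simp: o_def)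
  have Z0: "Z \<longlonglongrightarrow> 0"
    by (rule LIMSEQ_norm_0) (use Z in \<open>auto simp: less_imp_le\<close>)
  have "\<DD> P (x, 0) (0, w) = 0" if x: "norm x < min \<delta> (r / 2)" for x
  proof -
    have "(\<lambda>n. \<DD> P (x, (Z \<circ> s) n) (0, (v \<circ> s) n)) \<longlonglongrightarrow> \<DD> P (x, 0) (0, w)"
    proof (rule tendsto_deriv_at[OF holr open_ball])
      show "(x, 0::'a) \<in> ball 0 r"
        using x norm_Pair_le[of x "0::'a"] r by simp
      show "(\<lambda>n. (x, (Z \<circ> s) n)) \<longlonglongrightarrow> (x, 0)"
        using LIMSEQ_subseq_LIMSEQ[OF Z0 s(1)] by (intro tendsto_Pair tendsto_const) (simp add: o_def)
      show "(\<lambda>n. (0, (v \<circ> s) n)) \<longlonglongrightarrow> (0, w)"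
        using s(2) by (intro tendsto_Pair tendsto_const) (simp add: o_def)
    qed
    then show ?thesis using zero[OF x] by (simp add: LIMSEQ_const_iff)
  qed
  then have "\<forall>\<^sub>F x in nhds 0. \<DD> P (x, 0) (0, w) = 0"
    unfolding eventually_nhds_0_ball using \<delta> r by (intro exI[of _ "min \<delta> (r / 2)"]) auto
  then have "w = 0" using nd unfolding nondegenerate_at0_def by blast
  then show False using w by simp
qed

text \<open>
The chain rule for the function \<open>Z \<mapsto> u (Z, x, P (x, Z))\<close>, which vanishes identically.
\<close>

lemma deriv_along_graph:
  fixes u :: "'a::complex_normed_space \<times> 'b::complex_normed_space \<times> complex \<Rightarrow> complex"
  assumes "complex_differentiable_at u (Z, x, P (x, Z))" "complex_differentiable_at P (x, Z)"
    and "open U" "Z \<in> U" "\<And>Z'. Z' \<in> U \<Longrightarrow> u (Z', x, P (x, Z')) = 0"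
  shows "\<DD> u (Z, x, P (x, Z)) (v, 0, 0) + \<DD> P (x, Z) (0, v) * \<DD> u (Z, x, P (x, Z)) (0, 0, 1) = 0"
proof -
  let ?q = "(Z, x, P (x, Z))"
  note intros = complex_differentiable_intros complex_differentiable_at_compose[of "\<lambda>Z. (x, Z)" Z P]
  have cdP: "complex_differentiable_at (\<lambda>Z. P (x, Z)) Z"
    using assms(2) by (intro intros)
  have dP: "\<DD> (\<lambda>Z. P (x, Z)) Z v = \<DD> P (x, Z) (0, v)"
    using assms(2) by (simp add: deriv_at_compose[of "\<lambda>Z. (x, Z)" Z P] deriv_at_Pair intros)
  have "\<forall>\<^sub>F Z' in nhds Z. u (Z', x, P (x, Z')) = 0"
    using assms(3-5) eventually_nhds by blast
  then have "0 = \<DD> (\<lambda>Z. u (Z, x, P (x, Z))) Z v"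
    by (subst deriv_at_cong[of _ "\<lambda>_. 0"]) auto
  also have "\<dots> = \<DD> u ?q (\<DD> (\<lambda>Z. (Z, x, P (x, Z))) Z v)"
    by (rule deriv_at_compose) (use assms(1) cdP in \<open>auto intro!: intros\<close>)
  also have "\<DD> (\<lambda>Z. (Z, x, P (x, Z))) Z v = (v, 0, 0) + \<DD> P (x, Z) (0, v) *\<^sub>C (0, 0, 1)"
    using cdP dP by (simp add: deriv_at_Pair intros scaleC.zero_right)
  also have "\<DD> u ?q \<dots> = \<DD> u ?q (v, 0, 0) + \<DD> P (x, Z) (0, v) * \<DD> u ?q (0, 0, 1)"
    unfolding deriv_at_add[OF assms(1)] deriv_at_scaleC[OF assms(1)] by simp
  finally show ?thesis by simp
qed

text \<open>
If \<open>v\<close> annihilates \<open>u\<close>, the chain rule leaves a product of two holomorphic functions of \<open>x\<close> that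
vanishes; the factor coming from \<open>P\<close> is not identically zero, so the other one is.
\<close>

lemma transversal_deriv_zero:
  fixes u :: "'a::{complex_normed_space,euclidean_space} \<times> 'b::{complex_normed_space,euclidean_space} \<times> complex \<Rightarrow> complex"
  assumes S: "open S" and u: "hol_on S u"
    and P: "\<And>x Z. norm x < r \<Longrightarrow> Z \<in> U \<Longrightarrow> complex_differentiable_at P (x, Z) \<and> (Z, x, P (x, Z)) \<in> S"
    and U: "open U" "Z \<in> U" and zero: "\<And>x Z. norm x < r \<Longrightarrow> Z \<in> U \<Longrightarrow> u (Z, x, P (x, Z)) = 0"
    and v: "\<And>x. norm x < r \<Longrightarrow> \<DD> u (Z, x, P (x, Z)) (v, 0, 0) = 0"
    and nz: "norm x0 < r" "\<DD> P (x0, Z) (0, v) \<noteq> 0" and x: "norm x < r"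
    and holP: "hol_on (ball 0 r) (\<lambda>x. \<DD> P (x, Z) (0, v))"
  shows "\<DD> u (Z, x, P (x, Z)) (0, 0, 1) = 0"
proof (rule hol_on_mult_eq_zero[OF holP, where p = x0 and G = "\<lambda>x. \<DD> u (Z, x, P (x, Z)) (0, 0, 1)"])
  note hu = hol_on_deriv_at[OF u S]
  show "hol_on (ball 0 r) (\<lambda>x. \<DD> u (Z, x, P (x, Z)) (0, 0, 1))"
    unfolding hol_on_def
  proof
    fix x :: 'b assume x: "x \<in> ball 0 r"
    then have "complex_differentiable_at (\<lambda>x. (Z, x, P (x, Z))) x"
      using P[of x Z] U by (intro complex_differentiable_intros complex_differentiable_at_compose[of "\<lambda>x. (x, Z)" x P]) auto
    moreover have "complex_differentiable_at (\<lambda>p. \<DD> u p (0, 0, 1)) (Z, x, P (x, Z))"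
      using hu P[of x Z] x U unfolding hol_on_def by auto
    ultimately show "complex_differentiable_at (\<lambda>x. \<DD> u (Z, x, P (x, Z)) (0, 0, 1)) x"
      by (rule complex_differentiable_at_compose)
  qed
  show "\<DD> P (p, Z) (0, v) * \<DD> u (Z, p, P (p, Z)) (0, 0, 1) = 0" if "p \<in> ball 0 r" for p
    using deriv_along_graph[of u Z p P U v] P[of p Z] U zero[of p] v[of p] that u
    unfolding hol_on_def by simp
qed (use nz x in auto)

text \<open>
The kernel direction \<open>v\<close> may depend on \<open>Z\<close> in an arbitrary way, so there is no vector field to
integrate. It does annihilate every iterated \<open>\<tau>\<close>-derivative of \<open>h\<close>, since derivatives in constant
directions commute, and thus the previous lemma applies to each of them in turn. All \<open>\<tau>\<close>-derivatives
of \<open>h\<close> vanish on the graph, and the identity theorem in \<open>\<tau>\<close>, then in all variables, gives \<open>h = 0\<close>.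
\<close>

lemma vanishing_propagates:
  fixes h :: "'a::{complex_normed_space,euclidean_space} \<times> 'b::{complex_normed_space,euclidean_space} \<times> complex \<Rightarrow> complex"
  assumes hol: "hol_on (ball 0 R \<times> ball 0 R) h" and rR: "0 < r" "r \<le> R"
    and P: "\<And>x Z. norm x < r \<Longrightarrow> norm Z < r \<Longrightarrow> complex_differentiable_at P (x, Z) \<and> norm (x, P (x, Z)) < R"
    and holP: "\<And>Z v. norm Z < r \<Longrightarrow> hol_on (ball 0 r) (\<lambda>x. \<DD> P (x, Z) (0, v))"
    and U: "open U" "U \<noteq> {}" "U \<subseteq> ball 0 r"
    and zero: "\<And>x Z. norm x < r \<Longrightarrow> Z \<in> U \<Longrightarrow> h (Z, x, P (x, Z)) = 0"
    and sing: "\<And>Z. Z \<in> U \<Longrightarrow> \<exists>v x. norm x < r \<and> \<DD> P (x, Z) (0, v) \<noteq> 0 \<and>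
                  (\<forall>\<zeta>. norm \<zeta> < R \<longrightarrow> \<DD> h (Z, \<zeta>) (v, 0) = 0)"
    and q: "norm Z < R" "norm \<zeta> < R"
  shows "h (Z, \<zeta>) = 0"
proof -
  let ?S = "ball (0::'a) R \<times> ball (0::'b \<times> complex) R"
  have S: "open ?S" "convex ?S" by (auto intro: open_Times convex_Times)
  define u where "u = (\<lambda>k. ((\<lambda>F p. \<DD> F p (0, 0, 1)) ^^ k) h)"
  have u0: "u 0 = h" and uSuc: "u (Suc k) = (\<lambda>p. \<DD> (u k) p (0, 0, 1))" for k
    by (simp_all add: u_def)
  have hu: "hol_on ?S (u k)" for k
    by (induction k) (simp_all only: u0 uSuc hol hol_on_deriv_at S)
  have inS: "(Z, x, P (x, Z)) \<in> ?S" if "norm x < r" "Z \<in> U" for x Z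
    using P[of x Z] that U rR by auto
  have u_kernel: "\<DD> (u k) (Z, \<zeta>) (v, 0) = 0"
    if Z: "Z \<in> U" and v: "\<And>\<zeta>. norm \<zeta> < R \<Longrightarrow> \<DD> h (Z, \<zeta>) (v, 0) = 0" and \<zeta>: "norm \<zeta> < R" for k Z \<zeta> v
    using \<zeta>
  proof (induction k arbitrary: \<zeta>)
    case 0 then show ?case using v by (simp add: u0)
  next
    case (Suc k)
    have in_S: "(Z, \<zeta>) \<in> ?S" using Suc.prems Z U rR by auto
    let ?G = "\<lambda>p. \<DD> (u k) p (v, 0)"
    have G: "complex_differentiable_at ?G (Z, \<zeta>)"
      using hol_on_deriv_at[OF hu S(1)] in_S unfolding hol_on_def by blast
    have "\<forall>\<^sub>F \<zeta>' in nhds \<zeta>. ?G (Z, \<zeta>') = 0"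
      using Suc.IH Suc.prems eventually_nhds[of _ \<zeta>] by (auto intro!: exI[of _ "ball 0 R"])
    then have "0 = \<DD> (\<lambda>\<zeta>'. ?G (Z, \<zeta>')) \<zeta> (0, 1)"
      by (subst deriv_at_cong[of _ "\<lambda>_. 0"]) auto
    also have "\<dots> = \<DD> ?G (Z, \<zeta>) (0, 0, 1)"
      using deriv_at_compose[of "\<lambda>\<zeta>'. (Z, \<zeta>')" \<zeta> ?G "(0, 1)"] G
      by (simp add: deriv_at_Pair complex_differentiable_intros)
    also have "\<dots> = \<DD> (u (Suc k)) (Z, \<zeta>) (v, 0)"
      unfolding uSuc by (rule deriv_at_commute[OF hu S(1) in_S])
    finally show ?case by simp
  qed
  have u_graph: "u k (Z, x, P (x, Z)) = 0" if "norm x < r" "Z \<in> U" for k Z x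
    using that
  proof (induction k arbitrary: x Z)
    case 0 then show ?case using zero by (simp add: u0)
  next
    case (Suc k)
    obtain v x0 where v: "norm x0 < r" "\<DD> P (x0, Z) (0, v) \<noteq> 0"
      "\<And>\<zeta>. norm \<zeta> < R \<Longrightarrow> \<DD> h (Z, \<zeta>) (v, 0) = 0"
      using sing[OF Suc.prems(2)] by blast
    show ?case unfolding uSuc
    proof (rule transversal_deriv_zero[OF S(1) hu _ U(1) Suc.prems(2) Suc.IH _ v(1,2) Suc.prems(1)])
      fix x' :: 'b and Z' assume *: "norm x' < r" "Z' \<in> U"
      show "complex_differentiable_at P (x', Z') \<and> (Z', x', P (x', Z')) \<in> ?S"
        using P[of x' Z'] * U inS by auto
    next
      fix x' :: 'b assume *: "norm x' < r"
      show "\<DD> (u k) (Z, x', P (x', Z)) (v, 0, 0) = 0"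
        using u_kernel[OF Suc.prems(2) v(3), of "(x', P (x', Z))"] P[OF *, of Z] Suc.prems(2) U(3)
        by (auto simp: zero_prod_def)
    next
      show "hol_on (ball 0 r) (\<lambda>x. \<DD> P (x, Z) (0, v))"
        using holP Suc.prems U by auto
    qed
  qed
  have slice_zero: "h (Z, x, t) = 0" if Z: "Z \<in> U" and x: "norm x < r" and t: "(Z, x, t) \<in> ?S" for Z x t
  proof -
    let ?T = "{t. (Z, x, 0) + t *\<^sub>C (0, 0, 1) \<in> ?S}"
    let ?\<phi> = "\<lambda>t. h ((Z, x, 0) + t *\<^sub>C (0, 0, 1))"
    have T: "open ?T" "convex ?T" by (rule open_slice[OF S(1)], rule convex_slice[OF S(2)])
    have der: "(deriv ^^ k) ?\<phi> t = u k ((Z, x, 0) + t *\<^sub>C (0, 0, 1))" if "t \<in> ?T" for k t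
      using that
    proof (induction k arbitrary: t)
      case 0 then show ?case by (simp add: u0)
    next
      case (Suc k)
      have "\<forall>\<^sub>F t in nhds t. (deriv ^^ k) ?\<phi> t = u k ((Z, x, 0) + t *\<^sub>C (0, 0, 1))"
        by (rule eventually_mono[OF eventually_nhds_in_open[OF T(1) Suc.prems] Suc.IH])
      then have "(deriv ^^ Suc k) ?\<phi> t = deriv (\<lambda>t. u k ((Z, x, 0) + t *\<^sub>C (0, 0, 1))) t"
        unfolding funpow.simps o_def by (rule deriv_cong_ev) (rule refl)
      also have "\<dots> = \<DD> (u k) ((Z, x, 0) + t *\<^sub>C (0, 0, 1)) (0, 0, 1)"
        by (rule DERIV_imp_deriv[OF slice_has_field_derivative]) (use hu Suc.prems in \<open>auto simp: hol_on_def\<close>)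
      finally show ?case by (simp add: uSuc)
    qed
    have "?\<phi> t = 0"
    proof (rule holomorphic_fun_eq_0_on_connected[OF slice_holomorphic[OF hol S(1)] T(1) convex_connected[OF T(2)]])
      show "P (x, Z) \<in> ?T" using inS[OF x Z] by (simp add: scaleC.zero_right)
      show "t \<in> ?T" using t by (simp add: scaleC.zero_right)
      show "(deriv ^^ k) ?\<phi> (P (x, Z)) = 0" for k
        using der[OF \<open>P (x, Z) \<in> ?T\<close>] u_graph[OF x Z] by (simp add: scaleC.zero_right)
    qed
    then show ?thesis by (simp add: scaleC.zero_right)
  qed
  \<comment> \<open>an open set, nonempty because it contains points of the graph, on which \<open>h\<close> vanishes\<close>
  let ?W = "(U \<times> (ball 0 r \<times> UNIV)) \<inter> ?S"
  show ?thesis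
  proof (rule hol_on_identity[OF hol S, of ?W])
    show "open ?W" by (intro open_Int S(1) open_Times U open_ball open_UNIV)
    obtain Z0 where "Z0 \<in> U" using U by blast
    then have "(Z0, 0, P (0, Z0)) \<in> ?W" using inS[of 0 Z0] rR by simp
    then show "?W \<noteq> {}" by blast
  qed (use slice_zero q in auto)
qed

section \<open>The complexified basic equation\<close>

lemma complex_differentiable_at_of_fst:
  assumes "complex_differentiable_at F (fst p)"
  shows "complex_differentiable_at (\<lambda>p. F (fst p)) p"
    and deriv_at_of_fst: "\<DD> (\<lambda>p. F (fst p)) p v = \<DD> F (fst p) (fst v)"
proof -
  have *: "complex_differentiable_at (\<lambda>p. fst p) p" "\<DD> (\<lambda>p. fst p) p v = fst v"
    by (simp_all add: complex_differentiable_at_fst deriv_at_fst)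
  show "complex_differentiable_at (\<lambda>p. F (fst p)) p"
    by (rule complex_differentiable_at_compose(1)[OF *(1) assms])
  show "\<DD> (\<lambda>p. F (fst p)) p v = \<DD> F (fst p) (fst v)"
    unfolding deriv_at_compose[OF *(1) assms] *(2) ..
qed

lemma complex_differentiable_at_of_snd:
  assumes "complex_differentiable_at F (snd p)"
  shows "complex_differentiable_at (\<lambda>p. F (snd p)) p"
    and deriv_at_of_snd: "\<DD> (\<lambda>p. F (snd p)) p v = \<DD> F (snd p) (snd v)"
proof -
  have *: "complex_differentiable_at (\<lambda>p. snd p) p" "\<DD> (\<lambda>p. snd p) p v = snd v"
    by (simp_all add: complex_differentiable_at_snd deriv_at_snd)
  show "complex_differentiable_at (\<lambda>p. F (snd p)) p"
    by (rule complex_differentiable_at_compose(1)[OF *(1) assms])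
  show "\<DD> (\<lambda>p. F (snd p)) p v = \<DD> F (snd p) (snd v)"
    unfolding deriv_at_compose[OF *(1) assms] *(2) ..
qed

lemma isCont_hol_near0: "hol_near0 F \<Longrightarrow> isCont F 0"
  by (rule complex_differentiable_imp_isCont[OF hol_near0_imp_at0])

definition singular_at :: "('a::complex_normed_space \<Rightarrow> 'b::complex_normed_space) \<Rightarrow> 'a \<Rightarrow> bool" where
  "singular_at F p \<longleftrightarrow> (\<exists>v. v \<noteq> 0 \<and> \<DD> F p v = 0)"

lemma surj_if_not_singular_at:
  fixes F :: "'a::{complex_normed_space,euclidean_space} \<Rightarrow> 'a"
  assumes "complex_differentiable_at F p" "\<not> singular_at F p"
  shows "surj (\<DD> F p)"
proof -
  have lin: "linear (\<DD> F p)"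
    using bounded_linear_deriv_at[OF assms(1)] bounded_linear.linear by blast
  moreover have "inj (\<DD> F p)"
    unfolding linear_injective_0[OF lin] using assms(2) unfolding singular_at_def by blast
  ultimately show ?thesis by (rule linear_injective_imp_surjective) simp
qed

text \<open>
A nonsingular derivative would be onto, hence would attain a vector with last component \<open>1\<close>.
\<close>

lemma singular_at_if_last_const:
  fixes F :: "'v::{complex_normed_space,euclidean_space} \<times> complex \<Rightarrow> 'v \<times> complex"
  assumes "complex_differentiable_at F p" "\<And>v. snd (\<DD> F p v) = 0"
  shows "singular_at F p"
proof (rule ccontr)
  assume "\<not> singular_at F p"
  then obtain v where "\<DD> F p v = (0, 1)" using surj_if_not_singular_at[OF assms(1)] by (metis surjD)
  then show False using assms(2)[of v] by simp
qed

text \<open>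
The equation \<open>eq\<close> says that the pair \<open>(H, Ht)\<close> maps the graph of \<open>P\<close> into the graph of \<open>P'\<close>. A Segre
preserving map gives two instances, one for each way of solving the complexified equation, for \<open>\<tau>\<close> or
for \<open>w\<close>; they differ by exchanging \<open>H\<close> and \<open>Ht\<close>.
\<close>

locale segre_germ =
  fixes P P' :: "'v::{complex_normed_space,euclidean_space} \<times> 'v \<times> complex \<Rightarrow> complex"
    and f ft :: "'v \<times> complex \<Rightarrow> 'v" and g gt :: "'v \<times> complex \<Rightarrow> complex"
  assumes hol: "hol_near0 P" "hol_near0 P'" "hol_near0 f" "hol_near0 g" "hol_near0 ft" "hol_near0 gt"
    and zero: "f 0 = 0" "g 0 = 0" "ft 0 = 0" "gt 0 = 0"
    and P_left: "\<forall>\<^sub>F (y, t) in nhds 0. P (0, y, t) = t"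
    and P_mid: "\<forall>\<^sub>F (x, t) in nhds 0. P (x, 0, t) = t"
    and P'_left: "\<forall>\<^sub>F (y, t) in nhds 0. P' (0, y, t) = t"
    and P'_mid: "\<forall>\<^sub>F (x, t) in nhds 0. P' (x, 0, t) = t"
    and eq: "\<forall>\<^sub>F (x, Z) in nhds 0. gt (x, P (x, Z)) = P' (ft (x, P (x, Z)), f Z, g Z)"
    and nondeg: "nondegenerate_at0 P"
begin

definition "H Z = (f Z, g Z)"
definition "Ht \<zeta> = (ft \<zeta>, gt \<zeta>)"
definition "h p = gt (snd p) - P' (ft (snd p), f (fst p), g (fst p))"

lemma P_0: "P 0 = 0"
  using eventually_nhds_x_imp_x[OF P_left] by (simp add: zero_prod_def)

lemma zero': "f (0, 0) = 0" "g (0, 0) = 0" "ft (0, 0) = 0" "gt (0, 0) = 0"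
  using zero by (auto simp: zero_prod_def)

lemma P_bottom: "\<forall>\<^sub>F x in nhds 0. P (x, 0, 0) = 0"
  and P'_bottom: "\<forall>\<^sub>F x in nhds 0. P' (x, 0, 0) = 0"
  using eventually_compose_nhds0[OF P_mid, of "\<lambda>x. (x, 0)"] eventually_compose_nhds0[OF P'_mid, of "\<lambda>x. (x, 0)"]
  by (auto intro!: continuous_intros simp: zero_prod_def)

text \<open>
One radius \<open>R\<close> on which the maps and all compositions with \<open>P'\<close> are holomorphic, and a smaller radius
\<open>r\<close> for the parameters of the graph, so that the graph stays inside the domain given by \<open>R\<close>.
\<close>

lemma common_radius:
  assumes "\<epsilon> > 0"
  obtains R r where "0 < r" "r \<le> R" "R \<le> \<epsilon>"
    "\<And>Z. norm Z < R \<Longrightarrow> complex_differentiable_at f Z \<and> complex_differentiable_at g Z"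
    "\<And>\<zeta>. norm \<zeta> < R \<Longrightarrow> complex_differentiable_at ft \<zeta> \<and> complex_differentiable_at gt \<zeta>"
    "\<And>Z \<zeta>. norm Z < R \<Longrightarrow> norm \<zeta> < R \<Longrightarrow> complex_differentiable_at P' (ft \<zeta>, f Z, g Z)"
    "\<And>x Z. norm x < r \<Longrightarrow> norm Z < r \<Longrightarrow> complex_differentiable_at P (x, Z) \<and> norm (x, P (x, Z)) < R
        \<and> gt (x, P (x, Z)) = P' (ft (x, P (x, Z)), f Z, g Z)"
proof -
  note cont = hol[THEN isCont_hol_near0]
  have c1: "isCont (\<lambda>p. F (fst p)) 0" if "isCont F 0"
    for F :: "'v \<times> complex \<Rightarrow> 'z::t2_space" and p :: "('v \<times> complex) \<times> ('v \<times> complex)"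
    by (rule isCont_o2[where f = fst and g = F]) (use that in \<open>simp_all add: isCont_fst\<close>)
  have c2: "isCont (\<lambda>p. F (snd p)) 0" if "isCont F 0"
    for F :: "'v \<times> complex \<Rightarrow> 'z::t2_space" and p :: "('v \<times> complex) \<times> ('v \<times> complex)"
    by (rule isCont_o2[where f = snd and g = F]) (use that in \<open>simp_all add: isCont_snd\<close>)
  have "\<forall>\<^sub>F (Z, \<zeta>) in nhds (0::('v \<times> complex) \<times> ('v \<times> complex)). complex_differentiable_at f Z \<and> complex_differentiable_at g Z
      \<and> complex_differentiable_at ft \<zeta> \<and> complex_differentiable_at gt \<zeta>
      \<and> complex_differentiable_at P' (ft \<zeta>, f Z, g Z)"
    using hol(3-6)[unfolded hol_near0_def, THEN eventually_compose_nhds0, of fst]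
      hol(3-6)[unfolded hol_near0_def, THEN eventually_compose_nhds0, of snd]
      hol(2)[unfolded hol_near0_def, THEN eventually_compose_nhds0, of "\<lambda>p. (ft (snd p), f (fst p), g (fst p))"]
    by (simp add: case_prod_unfold eventually_conj_iff zero zero_prod_def[symmetric] c1 c2 cont isCont_fst isCont_snd isCont_Pair)
  then obtain R0 where R0: "R0 > 0" and *: "\<And>Z \<zeta>. norm Z < R0 \<Longrightarrow> norm \<zeta> < R0 \<Longrightarrow>
      complex_differentiable_at f Z \<and> complex_differentiable_at g Z
      \<and> complex_differentiable_at ft \<zeta> \<and> complex_differentiable_at gt \<zeta>
      \<and> complex_differentiable_at P' (ft \<zeta>, f Z, g Z)"
    unfolding eventually_nhds0_pair by blast
  define R where "R = min R0 \<epsilon>"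
  have R: "R > 0" "R \<le> \<epsilon>" "R \<le> R0" using R0 assms by (auto simp: R_def)
  have "\<forall>\<^sub>F q in nhds 0. norm (fst q, P q) < R"
    by (rule eventually_compose_nhds0[of "\<lambda>q. norm q < R"])
       (use R in \<open>auto simp: eventually_nhds_0_ball P_0 zero_prod_def[symmetric] intro!: continuous_intros cont\<close>)
  then have "\<forall>\<^sub>F (x, Z) in nhds 0. complex_differentiable_at P (x, Z) \<and> norm (x, P (x, Z)) < R
        \<and> gt (x, P (x, Z)) = P' (ft (x, P (x, Z)), f Z, g Z)"
    using hol(1) eq unfolding hol_near0_def by (simp add: case_prod_unfold eventually_conj_iff)
  then obtain r0 where r0: "r0 > 0" "\<And>x Z. norm x < r0 \<Longrightarrow> norm Z < r0 \<Longrightarrow> complex_differentiable_at P (x, Z) \<and> norm (x, P (x, Z)) < R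
        \<and> gt (x, P (x, Z)) = P' (ft (x, P (x, Z)), f Z, g Z)"
    unfolding eventually_nhds0_pair by blast
  show ?thesis
  proof (rule that[of "min r0 R" R])
    show "complex_differentiable_at f Z \<and> complex_differentiable_at g Z" if "norm Z < R" for Z
      using *[of Z 0] that R R0 by simp
    show "complex_differentiable_at ft \<zeta> \<and> complex_differentiable_at gt \<zeta>" if "norm \<zeta> < R" for \<zeta>
      using *[of 0 \<zeta>] that R R0 by simp
    show "complex_differentiable_at P' (ft \<zeta>, f Z, g Z)" if "norm Z < R" "norm \<zeta> < R" for Z \<zeta>
      using *[of Z \<zeta>] that R by simp
  qed (use R r0 in auto)
qed

lemma
  assumes "complex_differentiable_at f Z" "complex_differentiable_at g Z"
    "complex_differentiable_at ft \<zeta>" "complex_differentiable_at gt \<zeta>"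
    "complex_differentiable_at P' (ft \<zeta>, f Z, g Z)"
  shows hol_h: "complex_differentiable_at h (Z, \<zeta>)"
    and deriv_h: "\<DD> h (Z, \<zeta>) (v, w) = \<DD> gt \<zeta> w - \<DD> P' (ft \<zeta>, f Z, g Z) (\<DD> ft \<zeta> w, \<DD> f Z v, \<DD> g Z v)"
proof -
  let ?G = "\<lambda>p. (ft (snd p), f (fst p), g (fst p))"
  have G: "complex_differentiable_at ?G (Z, \<zeta>)" "\<DD> ?G (Z, \<zeta>) (v, w) = (\<DD> ft \<zeta> w, \<DD> f Z v, \<DD> g Z v)"
    using assms by (simp_all add: complex_differentiable_at_Pair deriv_at_Pair complex_differentiable_at_of_fst
        complex_differentiable_at_of_snd deriv_at_of_fst deriv_at_of_snd)
  have G': "complex_differentiable_at P' (?G (Z, \<zeta>))" using assms by simp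
  show "complex_differentiable_at h (Z, \<zeta>)"
    unfolding h_def
    by (intro complex_differentiable_at_diff complex_differentiable_at_compose(1)[OF G(1) G'] complex_differentiable_at_of_snd)
       (use assms in simp)
  show "\<DD> h (Z, \<zeta>) (v, w) = \<DD> gt \<zeta> w - \<DD> P' (ft \<zeta>, f Z, g Z) (\<DD> ft \<zeta> w, \<DD> f Z v, \<DD> g Z v)"
    unfolding h_def
    using deriv_at_compose[OF G(1) G'] G(2) complex_differentiable_at_compose(1)[OF G(1) G'] assms(4)
    by (simp add: deriv_at_diff2 complex_differentiable_at_of_snd deriv_at_of_snd)
qed

lemma deriv_H:
  assumes "complex_differentiable_at f Z" "complex_differentiable_at g Z"
  shows "complex_differentiable_at H Z" "\<DD> H Z v = (\<DD> f Z v, \<DD> g Z v)"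
  using assms unfolding H_def by (simp_all add: complex_differentiable_at_Pair deriv_at_Pair)

lemma deriv_Ht:
  assumes "complex_differentiable_at ft \<zeta>" "complex_differentiable_at gt \<zeta>"
  shows "complex_differentiable_at Ht \<zeta>" "\<DD> Ht \<zeta> v = (\<DD> ft \<zeta> v, \<DD> gt \<zeta> v)"
  using assms unfolding Ht_def by (simp_all add: complex_differentiable_at_Pair deriv_at_Pair)

lemma deriv_h_kernel:
  assumes "complex_differentiable_at f Z" "complex_differentiable_at g Z"
    "complex_differentiable_at ft \<zeta>" "complex_differentiable_at gt \<zeta>"
    "complex_differentiable_at P' (ft \<zeta>, f Z, g Z)" and "\<DD> H Z v = 0"
  shows "\<DD> h (Z, \<zeta>) (v, 0) = 0"
  using assms by (simp add: deriv_h deriv_H zero_prod_def[symmetric])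

lemma hol_deriv_P_slice:
  assumes "\<And>x Z. norm x < r \<Longrightarrow> norm Z < r \<Longrightarrow> complex_differentiable_at P (x, Z)" "norm Z < r"
  shows "hol_on (ball 0 r) (\<lambda>x. \<DD> P (x, Z) (0, v))"
  unfolding hol_on_def
proof
  fix x :: 'v assume x: "x \<in> ball 0 r"
  have "hol_on (ball 0 r \<times> ball 0 r) P" using assms(1) by (auto simp: hol_on_def)
  then have "hol_on (ball 0 r \<times> ball 0 r) (\<lambda>p. \<DD> P p (0, v))"
    by (rule hol_on_deriv_at) (auto intro: open_Times)
  then have "complex_differentiable_at (\<lambda>p. \<DD> P p (0, v)) (x, Z)"
    using x assms(2) by (auto simp: hol_on_def)
  then show "complex_differentiable_at (\<lambda>x. \<DD> P (x, Z) (0, v)) x"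
    by (intro complex_differentiable_at_compose[of "\<lambda>x. (x, Z)" x "\<lambda>p. \<DD> P p (0, v)"] complex_differentiable_intros)
qed

text \<open>
Every kernel vector of the derivative of \<open>H\<close> annihilates \<open>h\<close>, so the propagation of zeros applies.
The radius \<open>\<epsilon>\<close> is independent of \<open>U\<close>: it suffices to find some open set of singular points close
enough to \<open>0\<close>.
\<close>

lemma singular_open_imp_flat:
  obtains \<epsilon> where "\<epsilon> > 0"
    "\<And>U. open U \<Longrightarrow> U \<noteq> {} \<Longrightarrow> U \<subseteq> ball 0 \<epsilon> \<Longrightarrow> (\<And>Z. Z \<in> U \<Longrightarrow> singular_at H Z) \<Longrightarrow>
       \<forall>\<^sub>F (Z, \<zeta>) in nhds 0. gt \<zeta> = P' (ft \<zeta>, f Z, g Z)"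
proof -
  obtain R r where R: "0 < r" "r \<le> R"
    and cdZ: "\<And>Z. norm Z < R \<Longrightarrow> complex_differentiable_at f Z \<and> complex_differentiable_at g Z"
    and cdz: "\<And>\<zeta>. norm \<zeta> < R \<Longrightarrow> complex_differentiable_at ft \<zeta> \<and> complex_differentiable_at gt \<zeta>"
    and cdP': "\<And>Z \<zeta>. norm Z < R \<Longrightarrow> norm \<zeta> < R \<Longrightarrow> complex_differentiable_at P' (ft \<zeta>, f Z, g Z)"
    and P: "\<And>x Z. norm x < r \<Longrightarrow> norm Z < r \<Longrightarrow> complex_differentiable_at P (x, Z) \<and> norm (x, P (x, Z)) < R
        \<and> gt (x, P (x, Z)) = P' (ft (x, P (x, Z)), f Z, g Z)"
    using common_radius[OF zero_less_one] by metis
  obtain \<epsilon> where \<epsilon>: "\<epsilon> > 0"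
    and nd: "\<And>Z v. norm Z < \<epsilon> \<Longrightarrow> v \<noteq> 0 \<Longrightarrow> \<exists>x. norm x < r \<and> \<DD> P (x, Z) (0, v) \<noteq> 0"
    using nondegenerate_near0[OF nondeg hol(1) R(1)] by blast
  show ?thesis
  proof (rule that[of "min \<epsilon> r"])
    fix U assume U: "open U" "U \<noteq> {}" "U \<subseteq> ball 0 (min \<epsilon> r)" "\<And>Z. Z \<in> U \<Longrightarrow> singular_at H Z"
    have "h (Z, \<zeta>) = 0" if q: "norm Z < R" "norm \<zeta> < R" for Z \<zeta>
    proof (rule vanishing_propagates[OF _ R _ _ U(1,2), of h P])
      show "hol_on (ball 0 R \<times> ball 0 R) h"
        using cdZ cdz cdP' by (auto simp: hol_on_def intro!: hol_h)
      show "h (Z, x, P (x, Z)) = 0" if "norm x < r" "Z \<in> U" for x Z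
        using P[of x Z] that U(3) by (auto simp: h_def)
      show "hol_on (ball 0 r) (\<lambda>x. \<DD> P (x, Z) (0, v))" if "norm Z < r" for Z v
        using P that by (intro hol_deriv_P_slice) auto
      fix Z assume Z: "Z \<in> U"
      then have nZ: "norm Z < \<epsilon>" "norm Z < r" using U(3) by auto
      obtain v where v: "v \<noteq> 0" "\<DD> H Z v = 0" using U(4)[OF Z] unfolding singular_at_def by blast
      then obtain x where "norm x < r" "\<DD> P (x, Z) (0, v) \<noteq> 0" using nd nZ by blast
      moreover have "\<DD> h (Z, \<zeta>) (v, 0) = 0" if "norm \<zeta> < R" for \<zeta>
        using cdZ[of Z] cdz[OF that] cdP'[of Z \<zeta>] nZ R that v(2) by (intro deriv_h_kernel) auto
      ultimately show "\<exists>v x. norm x < r \<and> \<DD> P (x, Z) (0, v) \<noteq> 0 \<and> (\<forall>\<zeta>. norm \<zeta> < R \<longrightarrow> \<DD> h (Z, \<zeta>) (v, 0) = 0)"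
        by blast
    qed (use P U q in auto)
    then have "gt \<zeta> = P' (ft \<zeta>, f Z, g Z)" if "norm Z < R" "norm \<zeta> < R" for Z \<zeta>
      using that by (simp add: h_def)
    moreover have "R > 0" using R by simp
    ultimately show "\<forall>\<^sub>F (Z, \<zeta>) in nhds 0. gt \<zeta> = P' (ft \<zeta>, f Z, g Z)"
      unfolding eventually_nhds0_pair by blast
  qed (use \<epsilon> R in auto)
qed

text \<open>
The basic step applied once. Repeating it would require differentiating its conclusion in \<open>Z\<close>, hence
singularity on an open set; at a single point \<open>Z\<close> it gives one vanishing normal derivative.
\<close>

lemma singular_imp_normal_deriv_zero:
  obtains \<epsilon> where "\<epsilon> > 0"
    "\<And>Z x. norm Z < \<epsilon> \<Longrightarrow> norm x < \<epsilon> \<Longrightarrow> singular_at H Z \<Longrightarrow> \<DD> h (Z, x, P (x, Z)) (0, 0, 1) = 0"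
proof -
  obtain R r where R: "0 < r" "r \<le> R"
    and cdZ: "\<And>Z. norm Z < R \<Longrightarrow> complex_differentiable_at f Z \<and> complex_differentiable_at g Z"
    and cdz: "\<And>\<zeta>. norm \<zeta> < R \<Longrightarrow> complex_differentiable_at ft \<zeta> \<and> complex_differentiable_at gt \<zeta>"
    and cdP': "\<And>Z \<zeta>. norm Z < R \<Longrightarrow> norm \<zeta> < R \<Longrightarrow> complex_differentiable_at P' (ft \<zeta>, f Z, g Z)"
    and P: "\<And>x Z. norm x < r \<Longrightarrow> norm Z < r \<Longrightarrow> complex_differentiable_at P (x, Z) \<and> norm (x, P (x, Z)) < R
        \<and> gt (x, P (x, Z)) = P' (ft (x, P (x, Z)), f Z, g Z)"
    using common_radius[OF zero_less_one] by metis
  obtain \<epsilon> where \<epsilon>: "\<epsilon> > 0"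
    and nd: "\<And>Z v. norm Z < \<epsilon> \<Longrightarrow> v \<noteq> 0 \<Longrightarrow> \<exists>x. norm x < r \<and> \<DD> P (x, Z) (0, v) \<noteq> 0"
    using nondegenerate_near0[OF nondeg hol(1) R(1)] by blast
  let ?S = "ball (0::'v \<times> complex) R \<times> ball (0::'v \<times> complex) R"
  show ?thesis
  proof (rule that[of "min \<epsilon> r"])
    fix Z :: "'v \<times> complex" and x :: 'v
    assume Z: "norm Z < min \<epsilon> r" and x: "norm x < min \<epsilon> r" and sing: "singular_at H Z"
    then obtain v where v: "v \<noteq> 0" "\<DD> H Z v = 0" unfolding singular_at_def by blast
    then obtain x0 where x0: "norm x0 < r" "\<DD> P (x0, Z) (0, v) \<noteq> 0" using nd[of Z v] Z v(1) by auto
    have h: "h (Z, x, P (x, Z)) = 0" if "norm x < r" "Z \<in> ball 0 r" for x Z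
      using P[of x Z] that by (auto simp: h_def)
    show "\<DD> h (Z, x, P (x, Z)) (0, 0, 1) = 0"
    proof (rule transversal_deriv_zero[where S = ?S and r = r and U = "ball 0 r" and ?x0.0 = x0 and v = v])
      show "open ?S" by (intro open_Times open_ball)
      show "hol_on ?S h"
        using cdZ cdz cdP' by (auto simp: hol_on_def intro!: hol_h)
      fix x' :: 'v assume "norm x' < r"
      then show "\<DD> h (Z, x', P (x', Z)) (v, 0, 0) = 0"
        using deriv_h_kernel[of Z "(x', P (x', Z))" v] cdZ[of Z] cdz[of "(x', P (x', Z))"] cdP'[of Z "(x', P (x', Z))"]
          P[of x' Z] Z R v(2) by (simp add: zero_prod_def)
    next
      show "hol_on (ball 0 r) (\<lambda>x. \<DD> P (x, Z) (0, v))"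
        using P Z by (intro hol_deriv_P_slice) auto
    next
      fix x' :: 'v and Z' :: "'v \<times> complex" assume "norm x' < r" "Z' \<in> ball 0 r"
      then show "complex_differentiable_at P (x', Z') \<and> (Z', x', P (x', Z')) \<in> ?S"
        using P[of x' Z'] R by auto
    qed (use Z x x0 h in auto)
  qed (use \<epsilon> R in auto)
qed

end

section \<open>Normal derivatives along the bottom Segre variety\<close>

lemma isCont_compose0: "isCont F 0 \<Longrightarrow> isCont G 0 \<Longrightarrow> G 0 = 0 \<Longrightarrow> isCont (\<lambda>x. F (G x)) 0"
  by (rule isCont_o2[where f = G and g = F]) simp_all

context segre_germ
begin

lemmas cont0 = hol(1,3-6)[THEN isCont_hol_near0, THEN isCont_compose0] continuous_intros

lemma eventually_deriv_h:
  "\<forall>\<^sub>F (Z, \<zeta>) in nhds 0. complex_differentiable_at h (Z, \<zeta>) \<and>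
     complex_differentiable_at ft \<zeta> \<and> complex_differentiable_at gt \<zeta> \<and>
     (\<forall>v w. \<DD> h (Z, \<zeta>) (v, w) = \<DD> gt \<zeta> w - \<DD> P' (ft \<zeta>, f Z, g Z) (\<DD> ft \<zeta> w, \<DD> f Z v, \<DD> g Z v))"
proof -
  obtain R r where R: "0 < r" "r \<le> R" "R \<le> 1"
    and cdZ: "\<And>Z. norm Z < R \<Longrightarrow> complex_differentiable_at f Z \<and> complex_differentiable_at g Z"
    and cdz: "\<And>\<zeta>. norm \<zeta> < R \<Longrightarrow> complex_differentiable_at ft \<zeta> \<and> complex_differentiable_at gt \<zeta>"
    and cdP': "\<And>Z \<zeta>. norm Z < R \<Longrightarrow> norm \<zeta> < R \<Longrightarrow> complex_differentiable_at P' (ft \<zeta>, f Z, g Z)"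
    using common_radius[OF zero_less_one] by metis
  have "R > 0" using R by simp
  moreover have "complex_differentiable_at h (Z, \<zeta>) \<and>
     complex_differentiable_at ft \<zeta> \<and> complex_differentiable_at gt \<zeta> \<and>
     (\<forall>v w. \<DD> h (Z, \<zeta>) (v, w) = \<DD> gt \<zeta> w - \<DD> P' (ft \<zeta>, f Z, g Z) (\<DD> ft \<zeta> w, \<DD> f Z v, \<DD> g Z v))"
    if "norm Z < R" "norm \<zeta> < R" for Z \<zeta>
    using cdZ[OF that(1)] cdz[OF that(2)] cdP'[OF that] hol_h deriv_h by blast
  ultimately show ?thesis unfolding eventually_nhds0_pair by blast
qed

lemma eventually_h_graph: "\<forall>\<^sub>F (x, Z) in nhds 0. h (Z, x, P (x, Z)) = 0"
  using eq by (simp add: h_def)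

lemma eventually_h_diff_graph:
  "\<forall>\<^sub>F (x, Z) in nhds 0. complex_differentiable_at P (x, Z) \<and> complex_differentiable_at h (Z, x, P (x, Z)) \<and>
     complex_differentiable_at ft (x, P (x, Z)) \<and> complex_differentiable_at gt (x, P (x, Z)) \<and>
     (\<forall>v w. \<DD> h (Z, x, P (x, Z)) (v, w) = \<DD> gt (x, P (x, Z)) w
        - \<DD> P' (ft (x, P (x, Z)), f Z, g Z) (\<DD> ft (x, P (x, Z)) w, \<DD> f Z v, \<DD> g Z v))"
proof -
  have "\<forall>\<^sub>F q in nhds (0 :: 'v \<times> 'v \<times> complex). case (snd q, fst q, P q) of (Z, \<zeta>) \<Rightarrow> complex_differentiable_at h (Z, \<zeta>) \<and>
     complex_differentiable_at ft \<zeta> \<and> complex_differentiable_at gt \<zeta> \<and>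
     (\<forall>v w. \<DD> h (Z, \<zeta>) (v, w) = \<DD> gt \<zeta> w - \<DD> P' (ft \<zeta>, f Z, g Z) (\<DD> ft \<zeta> w, \<DD> f Z v, \<DD> g Z v))"
    by (rule eventually_compose_nhds0[OF eventually_deriv_h]) (auto intro!: cont0 simp: P_0 zero_prod_def[symmetric])
  then show ?thesis
    using hol(1) unfolding hol_near0_def by eventually_elim (auto simp: case_prod_unfold)
qed

lemma graph_deriv:
  "\<forall>\<^sub>F (x, Z) in nhds 0. \<forall>v. \<DD> h (Z, x, P (x, Z)) (v, 0) + \<DD> P (x, Z) (0, v) * \<DD> h (Z, x, P (x, Z)) (0, 0, 1) = 0"
proof -
  obtain r where r: "r > 0" and *: "\<And>x Z. norm x < r \<Longrightarrow> norm Z < r \<Longrightarrow> complex_differentiable_at P (x, Z)"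
      "\<And>x Z. norm x < r \<Longrightarrow> norm Z < r \<Longrightarrow> complex_differentiable_at h (Z, x, P (x, Z))"
      "\<And>x Z. norm x < r \<Longrightarrow> norm Z < r \<Longrightarrow> h (Z, x, P (x, Z)) = 0"
    using eventually_conj[OF eventually_h_graph eventually_h_diff_graph]
    unfolding case_prod_unfold eventually_nhds0_pair[of "\<lambda>a b. _ (a, b)", unfolded case_prod_unfold prod.collapse]
    by auto
  have "\<DD> h (Z, x, P (x, Z)) (v, 0) + \<DD> P (x, Z) (0, v) * \<DD> h (Z, x, P (x, Z)) (0, 0, 1) = 0"
    if "norm x < r" "norm Z < r" for x Z v
    using deriv_along_graph[of h Z x P "ball 0 r" v] *[of x] that by (simp add: zero_prod_def[symmetric])
  then show ?thesis unfolding eventually_nhds0_pair using r by blast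
qed

text \<open>
The companion of the previous identity for motion along the Segre variety of a fixed \<open>Z\<close>.
\<close>

lemma graph_deriv_x:
  "\<forall>\<^sub>F (x, Z) in nhds 0. \<forall>a. \<DD> h (Z, x, P (x, Z)) (0, a, \<DD> P (x, Z) (a, 0)) = 0"
proof -
  obtain r where r: "r > 0" and *: "\<And>x Z. norm x < r \<Longrightarrow> norm Z < r \<Longrightarrow> complex_differentiable_at P (x, Z)"
      "\<And>x Z. norm x < r \<Longrightarrow> norm Z < r \<Longrightarrow> complex_differentiable_at h (Z, x, P (x, Z))"
      "\<And>x Z. norm x < r \<Longrightarrow> norm Z < r \<Longrightarrow> h (Z, x, P (x, Z)) = 0"
    using eventually_conj[OF eventually_h_graph eventually_h_diff_graph]
    unfolding case_prod_unfold eventually_nhds0_pair[of "\<lambda>a b. _ (a, b)", unfolded case_prod_unfold prod.collapse]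
    by auto
  have "\<DD> h (Z, x, P (x, Z)) (0, a, \<DD> P (x, Z) (a, 0)) = 0" if x: "norm x < r" and Z: "norm Z < r" for x Z a
  proof -
    have cdP: "complex_differentiable_at (\<lambda>x. P (x, Z)) x"
      by (rule complex_differentiable_at_compose(1)[of "\<lambda>x. (x, Z)" x P])
         (use *(1)[OF x Z] in \<open>auto intro!: complex_differentiable_intros\<close>)
    have dP: "\<DD> (\<lambda>x. P (x, Z)) x a = \<DD> P (x, Z) (a, 0)"
      using deriv_at_compose[of "\<lambda>x. (x, Z)" x P a] *(1)[OF x Z]
      by (simp add: complex_differentiable_intros deriv_at_Pair)
    have "\<forall>\<^sub>F x' in nhds x. h (Z, x', P (x', Z)) = 0"
      by (rule eventually_mono[OF eventually_nhds_in_open[of "ball 0 r"]]) (use x Z *(3) in auto)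
    then have "0 = \<DD> (\<lambda>x'. h (Z, x', P (x', Z))) x a"
      by (subst deriv_at_cong[of _ "\<lambda>_. 0"]) auto
    also have "\<dots> = \<DD> h (Z, x, P (x, Z)) (\<DD> (\<lambda>x'. (Z, x', P (x', Z))) x a)"
      by (rule deriv_at_compose) (use *(2)[OF x Z] cdP in \<open>auto intro!: complex_differentiable_intros\<close>)
    also have "\<DD> (\<lambda>x'. (Z, x', P (x', Z))) x a = (0, a, \<DD> P (x, Z) (a, 0))"
      using cdP dP by (simp add: deriv_at_Pair complex_differentiable_intros)
    finally show ?thesis by simp
  qed
  then show ?thesis unfolding eventually_nhds0_pair using r by blast
qed

text \<open>
The Segre variety of the origin, \<open>w = 0\<close>, is mapped into the Segre variety of the origin.
\<close>

lemma g_bottom: "\<forall>\<^sub>F y in nhds 0. g (y, 0) = 0"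
proof -
  have "\<forall>\<^sub>F y in nhds 0. gt (0, P (0, y, 0)) = P' (ft (0, P (0, y, 0)), f (y, 0), g (y, 0))"
    using eventually_compose_nhds0[OF eq, of "\<lambda>y. (0, y, 0)"] by (simp add: zero_prod_def cont0)
  moreover have "\<forall>\<^sub>F y in nhds 0. P (0, y, 0) = 0"
    using eventually_compose_nhds0[OF P_left, of "\<lambda>y. (y, 0)"] by (simp add: zero_prod_def cont0)
  moreover have "\<forall>\<^sub>F y in nhds 0. P' (0, f (y, 0), g (y, 0)) = g (y, 0)"
    using eventually_compose_nhds0[OF P'_left, of "\<lambda>y. (f (y, 0), g (y, 0))"]
    by (simp add: zero_prod_def cont0 zero')
  ultimately show ?thesis by eventually_elim (simp add: zero')
qed

lemma deriv_P'_0: "\<DD> P' (0, 0, 0) (a, b, t) = t"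
proof -
  have cd: "complex_differentiable_at P' (0, 0, 0)"
    using hol_near0_imp_at0[OF hol(2)] by (simp add: zero_prod_def)
  have "\<DD> (\<lambda>(y, t). P' (0, y, t)) 0 = \<DD> snd 0" "\<DD> (\<lambda>(x, t). P' (x, 0, t)) 0 = \<DD> snd 0"
    by (rule deriv_at_cong, use P'_left P'_mid in \<open>simp add: case_prod_unfold\<close>)+
  moreover have "\<DD> (\<lambda>(y, t). P' (0, y, t)) 0 (b, t) = \<DD> P' (0, 0, 0) (0, b, t)"
    "\<DD> (\<lambda>(x, t). P' (x, 0, t)) 0 (a, 0) = \<DD> P' (0, 0, 0) (a, 0, 0)"
    using deriv_at_compose[of "\<lambda>p. (0, fst p, snd p)" 0 P' "(b, t)"] deriv_at_compose[of "\<lambda>p. (fst p, 0, snd p)" 0 P' "(a, 0)"] cd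
    by (simp_all add: case_prod_unfold complex_differentiable_intros deriv_at_Pair deriv_at_fst deriv_at_snd)
  moreover have "\<DD> snd 0 v = snd v" for v :: "'v \<times> complex"
    using deriv_at_snd[of "\<lambda>x. x" "0 :: 'v \<times> complex" v] by simp
  ultimately have "\<DD> P' (0, 0, 0) (0, b, t) = t" "\<DD> P' (0, 0, 0) (a, 0, 0) = 0" by simp_all
  then show ?thesis
    using deriv_at_add[OF cd, of "(a, 0, 0)" "(0, b, t)"] by simp
qed

lemma normal_derivs_eq: "\<DD> g (0, 0) (0, 1) = \<DD> gt (0, 0) (0, 1)"
proof -
  have "\<forall>\<^sub>F w in nhds 0. gt (0, P (0, 0, w)) = P' (ft (0, P (0, 0, w)), f (0, w), g (0, w))"
    using eventually_compose_nhds0[OF eq, of "\<lambda>w. (0, 0, w)"] by (simp add: zero_prod_def cont0)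
  moreover have "\<forall>\<^sub>F w in nhds 0. P (0, 0, w) = w"
    using eventually_compose_nhds0[OF P_left, of "\<lambda>w. (0, w)"] by (simp add: zero_prod_def cont0)
  ultimately have "\<forall>\<^sub>F w in nhds 0. gt (0, w) = P' (ft (0, w), f (0, w), g (0, w))"
    by eventually_elim simp
  then have *: "\<DD> (\<lambda>w. gt (0, w)) 0 1 = \<DD> (\<lambda>w. P' (ft (0, w), f (0, w), g (0, w))) 0 1"
    by (simp add: deriv_at_cong)
  note cd = hol[THEN hol_near0_imp_at0, unfolded zero_prod_def]
  have c: "complex_differentiable_at (\<lambda>w. F (0, w)) 0 \<and> \<DD> (\<lambda>w. F (0, w)) 0 1 = \<DD> F (0, 0) (0, 1)"
    if "complex_differentiable_at F (0, 0)" for F :: "'v \<times> complex \<Rightarrow> 'z::complex_normed_space"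
    using complex_differentiable_at_compose[of "\<lambda>w. (0, w)" 0 F] deriv_at_compose[of "\<lambda>w. (0, w)" 0 F 1] that
    by (simp add: complex_differentiable_intros deriv_at_Pair)
  have "\<DD> (\<lambda>w. P' (ft (0, w), f (0, w), g (0, w))) 0 1 = \<DD> g (0, 0) (0, 1)"
    using deriv_at_compose[of "\<lambda>w. (ft (0, w), f (0, w), g (0, w))" 0 P' 1] cd(2) c[OF cd(3)] c[OF cd(4)] c[OF cd(5)]
    by (simp add: zero' complex_differentiable_intros deriv_at_Pair deriv_P'_0)
  with * c[OF cd(6)] show ?thesis by simp
qed

lemma deriv_P'_bottom: "\<forall>\<^sub>F x in nhds 0. complex_differentiable_at P' (x, 0, 0) \<and> (\<forall>a. \<DD> P' (x, 0, 0) (a, 0, 0) = 0)"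
proof -
  have cd: "\<forall>\<^sub>F x in nhds 0. complex_differentiable_at P' (x, 0, 0)"
    using eventually_compose_nhds0[OF hol(2)[unfolded hol_near0_def], of "\<lambda>x. (x, 0, 0)"]
    by (simp add: zero_prod_def cont0)
  have "\<forall>\<^sub>F x in nhds 0. \<forall>\<^sub>F x' in nhds x. P' (x', 0, 0) = 0"
    using P'_bottom by (simp add: eventually_eventually)
  with cd show ?thesis
  proof eventually_elim
    case (elim x)
    have "\<DD> P' (x, 0, 0) (a, 0, 0) = 0" for a
    proof -
      have "\<DD> (\<lambda>x. P' (x, 0, 0)) x a = 0"
        using deriv_at_cong[OF elim(2)] by simp
      then show ?thesis
        using deriv_at_compose[of "\<lambda>x. (x, 0, 0)" x P' a] elim(1)
        by (simp add: complex_differentiable_intros deriv_at_Pair zero_prod_def)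
    qed
    then show ?case using elim(1) by simp
  qed
qed

text \<open>
At \<open>Z = 0\<close> the subtracted term of \<open>h\<close> is \<open>P' (ft \<zeta>, 0, 0)\<close>, which is zero in normal coordinates.
\<close>

lemma normal_deriv_h_bottom: "\<forall>\<^sub>F x in nhds 0. \<DD> h (0, x, 0) (0, 0, 1) = \<DD> gt (x, 0) (0, 1)"
proof -
  have "\<forall>\<^sub>F x in nhds 0. \<DD> h (0, x, 0) (0, 0, 1) = \<DD> gt (x, 0) (0, 1) -
      \<DD> P' (ft (x, 0), 0, 0) (\<DD> ft (x, 0) (0, 1), 0, 0)"
    by (rule eventually_mono[OF eventually_compose_nhds0[OF eventually_deriv_h, of "\<lambda>x. (0, x, 0)"]])
       (simp_all add: zero_prod_def[symmetric] cont0 zero hol(3,4)[THEN hol_near0_imp_at0] del: split_paired_All)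
  moreover have "\<forall>\<^sub>F x in nhds 0. complex_differentiable_at P' (ft (x, 0), 0, 0) \<and> (\<forall>a. \<DD> P' (ft (x, 0), 0, 0) (a, 0, 0) = 0)"
    using eventually_compose_nhds0[OF deriv_P'_bottom, of "\<lambda>x. ft (x, 0)"]
    by (simp add: zero_prod_def cont0 zero')
  ultimately show ?thesis by eventually_elim simp
qed

lemma singular_0_imp_normal_deriv_zero:
  assumes "singular_at H 0"
  shows "\<forall>\<^sub>F x in nhds 0. \<DD> gt (x, 0) (0, 1) = 0"
proof -
  obtain \<epsilon> where "\<epsilon> > 0"
    "\<And>Z x. norm Z < \<epsilon> \<Longrightarrow> norm x < \<epsilon> \<Longrightarrow> singular_at H Z \<Longrightarrow> \<DD> h (Z, x, P (x, Z)) (0, 0, 1) = 0"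
    using singular_imp_normal_deriv_zero by blast
  then have "\<forall>\<^sub>F x in nhds 0. \<DD> h (0, x, P (x, 0)) (0, 0, 1) = 0"
    unfolding eventually_nhds_0_ball using assms by (intro exI[of _ \<epsilon>]) auto
  then show ?thesis using normal_deriv_h_bottom P_bottom
    by eventually_elim (simp add: zero_prod_def)
qed

text \<open>
At \<open>Z = 0\<close> the identity \<open>graph_deriv\<close> equates, up to the factor \<open>\<partial>gt/\<partial>\<tau>\<close>, the differential of \<open>P\<close>
with the differential of \<open>P'\<close> pulled back by the derivative of \<open>H\<close>. The factor is nonzero and the
derivative of \<open>H\<close> is onto, so a kernel vector for \<open>P'\<close> lifts to one for \<open>P\<close>.
\<close>

lemma nondegenerate_target:
  assumes ns: "\<not> singular_at H 0" and nz: "\<DD> gt (0, 0) (0, 1) \<noteq> 0"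
  shows "nondegenerate_at0 P'"
  unfolding nondegenerate_at0_def
proof (intro allI impI)
  fix v' :: "'v \<times> complex" assume v': "\<forall>\<^sub>F x in nhds 0. \<DD> P' (x, 0) (0, v') = 0"
  note cd0 = hol[THEN hol_near0_imp_at0]
  note cdH = deriv_H(1)[OF cd0(3,4)]
  obtain v where v: "\<DD> H 0 v = v'"
    using surj_if_not_singular_at[OF cdH ns] by (metis surjD)
  have "\<forall>\<^sub>F x in nhds 0. \<DD> P' (ft (x, 0), 0) (0, v') = 0"
    using eventually_compose_nhds0[OF v', of "\<lambda>x. ft (x, 0)"] by (simp add: zero_prod_def cont0 zero')
  moreover have "\<forall>\<^sub>F x in nhds 0. \<DD> h (0, x, P (x, 0)) (v, 0) = - \<DD> P' (ft (x, P (x, 0)), 0) (0, v')"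
    by (rule eventually_mono[OF eventually_compose_nhds0[OF eventually_h_diff_graph, of "\<lambda>x. (x, 0)"]])
       (simp_all add: zero_prod_def[symmetric] cont0 zero v[symmetric] deriv_H[OF cd0(3,4)] del: split_paired_All)
  moreover have "\<forall>\<^sub>F x in nhds 0. \<forall>v. \<DD> h (0, x, P (x, 0)) (v, 0) + \<DD> P (x, 0) (0, v) * \<DD> h (0, x, P (x, 0)) (0, 0, 1) = 0"
    using eventually_compose_nhds0[OF graph_deriv, of "\<lambda>x. (x, 0)"] by (simp add: zero_prod_def[symmetric] cont0)
  moreover have "\<forall>\<^sub>F x in nhds 0. \<DD> gt (x, 0) (0, 1) \<noteq> 0"
  proof -
    obtain r where r: "r > 0" "hol_on (ball 0 r) gt" using hol(6) hol_near0_iff by blast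
    have "isCont (\<lambda>\<zeta>. \<DD> gt \<zeta> (0, 1)) 0"
      using continuous_on_deriv_at[OF r(2) open_ball] r(1) by (simp add: continuous_on_eq_continuous_at)
    then have "isCont (\<lambda>x. \<DD> gt (x, 0) (0, 1)) 0"
      by (rule isCont_compose0) (auto intro!: continuous_intros simp: zero_prod_def)
    then have "\<forall>\<^sub>F x in at 0. \<DD> gt (x, 0) (0, 1) \<noteq> 0"
      using nz unfolding isCont_def by (rule tendsto_imp_eventually_ne)
    then show ?thesis using nz by (simp add: eventually_nhds_conv_at)
  qed
  ultimately have "\<forall>\<^sub>F x in nhds 0. \<DD> P (x, 0) (0, v) = 0"
    using normal_deriv_h_bottom P_bottom
  proof eventually_elim
    case (elim x)
    have "P (x, 0) = 0" using elim(6) by (simp add: zero_prod_def)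
    with elim(1-5) show ?case by (metis add_0 minus_zero mult_eq_0_iff)
  qed
  then have "v = 0" using nondeg unfolding nondegenerate_at0_def by blast
  then show "v' = 0" using v cdH by simp
qed

end

section \<open>Sweeping out an open set by Segre varieties\<close>

context segre_germ
begin

abbreviation "sweep \<equiv> \<lambda>(x, y). (x, P (x, y, 0))"

lemma deriv_T:
  assumes "complex_differentiable_at P (x, y, 0)"
  shows "complex_differentiable_at sweep (x, y)" and "\<DD> sweep (x, y) (a, b) = (a, \<DD> P (x, y, 0) (a, b, 0))"
proof -
  let ?G = "\<lambda>q. (fst q, snd q, 0 :: complex)"
  have G: "complex_differentiable_at ?G (x, y)" "\<DD> ?G (x, y) (a, b) = (a, b, 0)"
    by (simp_all add: complex_differentiable_intros deriv_at_Pair deriv_at_fst deriv_at_snd)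
  have P: "complex_differentiable_at (\<lambda>q. P (?G q)) (x, y)" "\<DD> (\<lambda>q. P (?G q)) (x, y) (a, b) = \<DD> P (x, y, 0) (a, b, 0)"
    using complex_differentiable_at_compose(1)[OF G(1), of P] deriv_at_compose[OF G(1), of P "(a, b)"] G(2) assms by simp_all
  show "complex_differentiable_at sweep (x, y)" "\<DD> sweep (x, y) (a, b) = (a, \<DD> P (x, y, 0) (a, b, 0))"
    using P by (simp_all add: case_prod_unfold complex_differentiable_intros deriv_at_Pair deriv_at_fst)
qed

text \<open>
The Segre varieties of the points \<open>(y, 0)\<close> sweep out an open set: the derivative of \<open>P\<close> in some
direction \<open>y\<close> is nonzero at points \<open>(x, 0)\<close> with \<open>x\<close> arbitrarily small, by nondegeneracy, and there
the parametrization is a submersion.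
\<close>

lemma sweep_open:
  assumes "e > 0"
  obtains U where "open U" "U \<noteq> {}" "U \<subseteq> sweep ` (ball 0 e \<times> ball 0 e)"
proof -
  obtain R r where r: "0 < r" and "r \<le> R" "R \<le> 1"
    and cdP: "\<And>x Z. norm x < r \<Longrightarrow> norm Z < r \<Longrightarrow> complex_differentiable_at P (x, Z) \<and> norm (x, P (x, Z)) < R
        \<and> gt (x, P (x, Z)) = P' (ft (x, P (x, Z)), f Z, g Z)"
    using common_radius[OF zero_less_one] by metis
  define d where "d = min e r"
  have d: "d > 0" "d \<le> e" "d \<le> r" using assms r by (auto simp: d_def)
  let ?V = "ball (0::'v) d \<times> ball (0::'v) d"
  have cd: "complex_differentiable_at P (x, y, 0)" if "(x, y) \<in> ?V" for x y
    using cdP[of x "(y, 0)"] that d by simp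
  obtain b :: 'v where b: "b \<noteq> 0" using nonzero_Basis SOME_Basis by blast
  obtain \<epsilon> where "\<epsilon> > 0" "\<And>Z v. norm Z < \<epsilon> \<Longrightarrow> v \<noteq> 0 \<Longrightarrow> \<exists>x. norm x < d \<and> \<DD> P (x, Z) (0, v) \<noteq> 0"
    using nondegenerate_near0[OF nondeg hol(1) d(1)] by blast
  then obtain x where x: "norm x < d" "\<DD> P (x, 0) (0, b, 0) \<noteq> 0"
    using b by (metis fst_conv fst_zero norm_zero)
  have xV: "(x, 0) \<in> ?V" using x d by simp
  let ?D = "\<DD> sweep (x, 0)" and ?m = "\<DD> P (x, 0, 0) (0, b, 0)"
  have cdx: "complex_differentiable_at P (x, 0, 0)" using cd[OF xV] .
  have m: "?m \<noteq> 0" using x(2) by (simp add: zero_prod_def)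
  \<comment> \<open>the last component is reached by adding a multiple of \<open>b\<close>, which moves only the Segre variety\<close>
  have surj: "surj ?D"
  proof (rule surjI[where f = "\<lambda>(a, t). (a, ((t - \<DD> P (x, 0, 0) (a, 0, 0)) / ?m) *\<^sub>C b)"], clarify)
    fix a :: 'v and t :: complex
    let ?c = "(t - \<DD> P (x, 0, 0) (a, 0, 0)) / ?m"
    have "\<DD> P (x, 0, 0) (a, ?c *\<^sub>C b, 0) = \<DD> P (x, 0, 0) (a, 0, 0) + \<DD> P (x, 0, 0) (?c *\<^sub>C (0, b, 0))"
      using deriv_at_add[OF cdx, of "(a, 0, 0)" "?c *\<^sub>C (0, b, 0)"] by (simp add: scaleC.zero_right)
    also have "\<dots> = t" unfolding deriv_at_scaleC[OF cdx] using m by simp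
    finally show "?D (a, ?c *\<^sub>C b) = (a, t)" by (simp add: deriv_T[OF cdx])
  qed
  have der: "(sweep has_derivative ?D) (at (x, 0))"
    by (rule has_derivative_deriv_at[OF deriv_T(1)[OF cdx]])
  have cont: "continuous_on ?V sweep"
    by (rule hol_on_imp_continuous_on) (use deriv_T(1)[OF cd] in \<open>auto simp: hol_on_def\<close>)
  have "open ?V" by (intro open_Times open_ball)
  from open_image_of_surj_derivative[OF this cont xV der surj]
  obtain U where U: "open U" "U \<noteq> {}" "U \<subseteq> sweep ` ?V" .
  have "sweep ` ?V \<subseteq> sweep ` (ball 0 e \<times> ball 0 e)"
    using d by (intro image_mono) auto
  with U show ?thesis by (intro that[of U]) auto
qed

lemma deriv_g_bottom:
  assumes "\<forall>\<^sub>F y in nhds 0. \<DD> g (y, 0) (0, 1) = 0"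
  shows "\<forall>\<^sub>F y in nhds 0. complex_differentiable_at f (y, 0) \<and> complex_differentiable_at g (y, 0) \<and>
           (\<forall>v. \<DD> g (y, 0) v = 0) \<and> g (y, 0) = 0"
proof -
  have "\<forall>\<^sub>F y in nhds 0. \<forall>\<^sub>F y' in nhds y. g (y', 0) = 0"
    using g_bottom by (simp add: eventually_eventually)
  moreover have "\<forall>\<^sub>F y in nhds 0. complex_differentiable_at f (y, 0)" "\<forall>\<^sub>F y in nhds 0. complex_differentiable_at g (y, 0)"
    using hol(3,4)[unfolded hol_near0_def, THEN eventually_compose_nhds0, of "\<lambda>y. (y, 0)"]
    by (simp_all add: zero_prod_def cont0)
  ultimately show ?thesis using assms g_bottom
  proof eventually_elim
    case (elim y)
    have "\<DD> g (y, 0) (b, t) = 0" for b t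
    proof -
      have "\<DD> (\<lambda>y. g (y, 0)) y b = 0" using deriv_at_cong[OF elim(1)] by simp
      then have "\<DD> g (y, 0) (b, 0) = 0"
        using deriv_at_compose[of "\<lambda>y. (y, 0)" y g b] elim(3)
        by (simp add: complex_differentiable_intros deriv_at_Pair)
      moreover have "(b, t) = (b, 0) + t *\<^sub>C (0, 1)" by (simp add: scaleC.zero_right)
      ultimately show ?thesis
        using elim(3,4) deriv_at_add[OF elim(3)] deriv_at_scaleC[OF elim(3)] by (metis add_0 mult_zero_right scaleC_complex)
    qed
    then show ?case using elim by auto
  qed
qed

text \<open>
The right-hand side of the basic equation over the points \<open>(y, 0)\<close>, where \<open>g\<close> vanishes: there the
equation reads \<open>gt (sweep (x, y)) = bottom_slice (ft (sweep (x, y)), y)\<close>.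
\<close>

definition "bottom_slice p = P' (fst p, f (snd p, 0), 0)"

lemma deriv_bottom_slice:
  assumes "complex_differentiable_at P' (x, f (y, 0), 0)" "complex_differentiable_at f (y, 0)"
  shows "complex_differentiable_at bottom_slice (x, y)"
    and "\<DD> bottom_slice (x, y) (a, b) = \<DD> P' (x, f (y, 0), 0) (a, \<DD> f (y, 0) (b, 0), 0)"
proof -
  have 1: "complex_differentiable_at (\<lambda>y. f (y, 0)) y" "\<DD> (\<lambda>y. f (y, 0)) y b = \<DD> f (y, 0) (b, 0)"
    using complex_differentiable_at_compose[of "\<lambda>y. (y, 0)" y f] deriv_at_compose[of "\<lambda>y. (y, 0)" y f b] assms(2)
    by (simp_all add: complex_differentiable_intros deriv_at_Pair)
  let ?G = "\<lambda>p. (fst p, f (snd p, 0), 0 :: complex)"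
  have 2: "complex_differentiable_at ?G (x, y)" "\<DD> ?G (x, y) (a, b) = (a, \<DD> f (y, 0) (b, 0), 0)"
    using complex_differentiable_at_of_snd[of "\<lambda>y. f (y, 0)" "(x, y)"] deriv_at_of_snd[of "\<lambda>y. f (y, 0)" "(x, y)" "(a, b)"] 1
    by (simp_all add: complex_differentiable_intros deriv_at_Pair deriv_at_fst)
  show "complex_differentiable_at bottom_slice (x, y)"
    and "\<DD> bottom_slice (x, y) (a, b) = \<DD> P' (x, f (y, 0), 0) (a, \<DD> f (y, 0) (b, 0), 0)"
    using complex_differentiable_at_compose[OF 2(1), of P'] deriv_at_compose[OF 2(1), of P' "(a, b)"] 2(2) assms(1)
    by (simp_all add: bottom_slice_def[abs_def])
qed

lemma eventually_deriv_bottom_slice: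
  "\<forall>\<^sub>F (x, y) in nhds 0. complex_differentiable_at bottom_slice (x, y) \<and>
     (\<forall>a b. \<DD> bottom_slice (x, y) (a, b) = \<DD> P' (x, f (y, 0), 0) (a, \<DD> f (y, 0) (b, 0), 0))"
proof -
  have "\<forall>\<^sub>F p in nhds (0::'v \<times> 'v). complex_differentiable_at f (snd p, 0)"
    by (rule eventually_compose_nhds0[OF hol(3)[unfolded hol_near0_def], of "\<lambda>p. (snd p, 0)"]) (auto intro!: cont0 simp: zero_prod_def[symmetric])
  moreover have "\<forall>\<^sub>F p in nhds (0::'v \<times> 'v). complex_differentiable_at P' (fst p, f (snd p, 0), 0)"
    by (rule eventually_compose_nhds0[OF hol(2)[unfolded hol_near0_def], of "\<lambda>p. (fst p, f (snd p, 0), 0)"]) (auto intro!: cont0 simp: zero_prod_def[symmetric] zero)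
  ultimately show ?thesis
    by eventually_elim (auto simp: deriv_bottom_slice)
qed

text \<open>
As \<open>g\<close> vanishes to second order along \<open>w = 0\<close>, \<open>H\<close> is singular at every \<open>(y, 0)\<close>. So the normal derivative of \<open>h\<close> vanishes
on the Segre varieties of these points, and then \<open>graph_deriv\<close> gives the vanishing of
the derivatives of \<open>h\<close> with respect to \<open>Z\<close>, in particular in the directions \<open>(b, 0)\<close>.
\<close>

lemma deriv_bottom_slice_sweep:
  assumes flat: "\<forall>\<^sub>F y in nhds 0. \<DD> g (y, 0) (0, 1) = 0"
  shows "\<forall>\<^sub>F (x, y) in nhds 0. \<forall>b. \<DD> bottom_slice (ft (sweep (x, y)), y) (0, b) = 0"
proof -
  have sing: "\<forall>\<^sub>F y in nhds 0. singular_at H (y, 0)"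
    using deriv_g_bottom[OF flat] by eventually_elim (auto intro!: singular_at_if_last_const simp: deriv_H)
  obtain \<epsilon> where \<epsilon>: "\<epsilon> > 0"
    "\<And>Z x. norm Z < \<epsilon> \<Longrightarrow> norm x < \<epsilon> \<Longrightarrow> singular_at H Z \<Longrightarrow> \<DD> h (Z, x, P (x, Z)) (0, 0, 1) = 0"
    using singular_imp_normal_deriv_zero by blast
  have "\<forall>\<^sub>F (x, y) in nhds 0. norm x < \<epsilon> \<and> norm y < \<epsilon>"
    unfolding eventually_nhds0_pair using \<epsilon>(1) by blast
  moreover have "\<forall>\<^sub>F q in nhds (0::'v \<times> 'v). singular_at H (snd q, 0)"
    by (rule eventually_compose_nhds0[OF sing, of snd]) (auto intro!: cont0)
  moreover have "\<forall>\<^sub>F q in nhds (0::'v \<times> 'v). complex_differentiable_at f (snd q, 0) \<and> complex_differentiable_at g (snd q, 0) \<and>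
           (\<forall>v. \<DD> g (snd q, 0) v = 0) \<and> g (snd q, 0) = 0"
    by (rule eventually_compose_nhds0[OF deriv_g_bottom[OF flat], of snd]) (auto intro!: cont0)
  moreover have "\<forall>\<^sub>F q in nhds (0::'v \<times> 'v). case (fst q, snd q, 0) of (x, Z) \<Rightarrow>
      \<forall>v. \<DD> h (Z, x, P (x, Z)) (v, 0) + \<DD> P (x, Z) (0, v) * \<DD> h (Z, x, P (x, Z)) (0, 0, 1) = 0"
    by (rule eventually_compose_nhds0[OF graph_deriv, of "\<lambda>q. (fst q, snd q, 0)"]) (auto intro!: cont0 simp: zero_prod_def[symmetric])
  moreover have "\<forall>\<^sub>F q in nhds (0::'v \<times> 'v). case (fst q, snd q, 0) of (x, Z) \<Rightarrow>
     complex_differentiable_at P (x, Z) \<and> complex_differentiable_at h (Z, x, P (x, Z)) \<and>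
     complex_differentiable_at ft (x, P (x, Z)) \<and> complex_differentiable_at gt (x, P (x, Z)) \<and>
     (\<forall>v w. \<DD> h (Z, x, P (x, Z)) (v, w) = \<DD> gt (x, P (x, Z)) w
        - \<DD> P' (ft (x, P (x, Z)), f Z, g Z) (\<DD> ft (x, P (x, Z)) w, \<DD> f Z v, \<DD> g Z v))"
    by (rule eventually_compose_nhds0[OF eventually_h_diff_graph, of "\<lambda>q. (fst q, snd q, 0)"]) (auto intro!: cont0 simp: zero_prod_def[symmetric])
  moreover have "\<forall>\<^sub>F q in nhds (0::'v \<times> 'v). case (ft (fst q, P (fst q, snd q, 0)), snd q) of (x, y) \<Rightarrow>
     complex_differentiable_at bottom_slice (x, y) \<and>
     (\<forall>a b. \<DD> bottom_slice (x, y) (a, b) = \<DD> P' (x, f (y, 0), 0) (a, \<DD> f (y, 0) (b, 0), 0))"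
    by (rule eventually_compose_nhds0[OF eventually_deriv_bottom_slice, of "\<lambda>q. (ft (fst q, P (fst q, snd q, 0)), snd q)"]) (auto intro!: cont0 simp: P_0 zero_prod_def[symmetric] zero)
  ultimately show ?thesis
  proof eventually_elim
    case (elim q)
    obtain x y where q: "q = (x, y)" by (cases q)
    let ?Z = "(y, 0)" and ?sweep = "(x, P (x, y, 0))"
    have "norm ?Z < \<epsilon>" "norm x < \<epsilon>" using elim(1) q by auto
    then have n: "\<DD> h (?Z, ?sweep) (0, 0, 1) = 0" using \<epsilon>(2) elim(2) q by auto
    have "\<DD> bottom_slice (ft ?sweep, y) (0, b) = 0" for b
    proof -
      have "\<DD> h (?Z, ?sweep) ((b, 0), 0) = 0"
        using elim(4) n q by (simp del: split_paired_All)
      moreover have "\<DD> h (?Z, ?sweep) ((b, 0), 0) = - \<DD> P' (ft ?sweep, f ?Z, 0) (0, \<DD> f ?Z (b, 0), 0)"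
        using elim(5) elim(3) q by (simp del: split_paired_All)
      ultimately show ?thesis using elim(6) q by simp
    qed
    then show ?case using q by simp
  qed
qed

lemma deriv_ft_T:
  assumes "complex_differentiable_at P (x, y, 0)" "complex_differentiable_at ft (sweep (x, y))"
  shows "complex_differentiable_at (\<lambda>q. (ft (sweep q), snd q)) (x, y)"
    and "\<DD> (\<lambda>q. (ft (sweep q), snd q)) (x, y) (a, b) = (\<DD> ft (sweep (x, y)) (a, \<DD> P (x, y, 0) (a, b, 0)), b)"
proof -
  note sweep = deriv_T[OF assms(1)]
  have 1: "complex_differentiable_at (\<lambda>q. ft (sweep q)) (x, y)"
    by (rule complex_differentiable_at_compose(1)[OF sweep(1) assms(2)])
  have 2: "\<DD> (\<lambda>q. ft (sweep q)) (x, y) (a, b) = \<DD> ft (sweep (x, y)) (a, \<DD> P (x, y, 0) (a, b, 0))"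
    unfolding deriv_at_compose[OF sweep(1) assms(2)] sweep(2) ..
  show "complex_differentiable_at (\<lambda>q. (ft (sweep q), snd q)) (x, y)"
    by (rule complex_differentiable_at_Pair(1)[OF 1]) (rule complex_differentiable_at_snd(1)[OF complex_differentiable_at_id])
  show "\<DD> (\<lambda>q. (ft (sweep q), snd q)) (x, y) (a, b) = (\<DD> ft (sweep (x, y)) (a, \<DD> P (x, y, 0) (a, b, 0)), b)"
    using deriv_at_Pair[OF 1 complex_differentiable_at_snd(1)[OF complex_differentiable_at_id]] 2
    by (simp add: deriv_at_snd)
qed

text \<open>
Collects what holds at all swept points near \<open>0\<close>. The last conjunct is the basic equation
differentiated along the Segre variety: a tangent vector killed by the derivative of \<open>ft\<close> is also
killed by that of \<open>gt\<close>.
\<close>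

lemma eventually_sweep:
  assumes "\<epsilon> > 0" "\<rho> > 0"
    and flat: "\<forall>\<^sub>F y in nhds 0. \<DD> g (y, 0) (0, 1) = 0"
  shows "\<forall>\<^sub>F (x, y) in nhds 0.
      complex_differentiable_at P (x, y, 0) \<and> complex_differentiable_at ft (sweep (x, y)) \<and> complex_differentiable_at gt (sweep (x, y)) \<and>
      norm (sweep (x, y)) < \<epsilon> \<and> norm (ft (sweep (x, y))) < \<rho> \<and> gt (sweep (x, y)) = bottom_slice (ft (sweep (x, y)), y) \<and>
      (\<forall>b. \<DD> bottom_slice (ft (sweep (x, y)), y) (0, b) = 0) \<and>
      (\<forall>a. \<DD> ft (sweep (x, y)) (a, \<DD> P (x, y, 0) (a, 0)) = 0 \<longrightarrow> \<DD> gt (sweep (x, y)) (a, \<DD> P (x, y, 0) (a, 0)) = 0)"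
proof -
  have small: "\<forall>\<^sub>F q in nhds (0::'v \<times> 'v). norm (fst q, P (fst q, snd q, 0)) < \<epsilon>"
    by (rule eventually_compose_nhds0[of "\<lambda>p. norm p < \<epsilon>", of "\<lambda>q. (fst q, P (fst q, snd q, 0))"])
       (use assms in \<open>auto intro!: cont0 simp: eventually_nhds_0_ball P_0 zero_prod_def[symmetric]\<close>)
  have small': "\<forall>\<^sub>F q in nhds (0::'v \<times> 'v). norm (ft (fst q, P (fst q, snd q, 0))) < \<rho>"
    by (rule eventually_compose_nhds0[of "\<lambda>p. norm p < \<rho>", of "\<lambda>q. ft (fst q, P (fst q, snd q, 0))"])
       (use assms in \<open>auto intro!: cont0 simp: eventually_nhds_0_ball P_0 zero zero_prod_def[symmetric]\<close>)
  have bottom: "\<forall>\<^sub>F q in nhds (0::'v \<times> 'v). g (snd q, 0) = 0"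
    by (rule eventually_compose_nhds0[OF g_bottom, of snd]) (auto intro!: cont0)
  have fZ: "\<forall>\<^sub>F q in nhds (0::'v \<times> 'v). case (fst q, snd q, 0) of (x, Z) \<Rightarrow>
      gt (x, P (x, Z)) = P' (ft (x, P (x, Z)), f Z, g Z)"
    by (rule eventually_compose_nhds0[OF eq, of "\<lambda>q. (fst q, snd q, 0)"]) (auto intro!: cont0 simp: zero_prod_def[symmetric])
  have cdfg: "\<forall>\<^sub>F q in nhds (0::'v \<times> 'v). complex_differentiable_at f (snd q, 0)"
    "\<forall>\<^sub>F q in nhds (0::'v \<times> 'v). complex_differentiable_at g (snd q, 0)"
    using hol(3,4)[unfolded hol_near0_def, THEN eventually_compose_nhds0, of "\<lambda>q. (snd q, 0)"]
    by (simp_all add: cont0 zero_prod_def[symmetric])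
  have diff: "\<forall>\<^sub>F q in nhds (0::'v \<times> 'v). case (fst q, snd q, 0) of (x, Z) \<Rightarrow>
     complex_differentiable_at P (x, Z) \<and> complex_differentiable_at h (Z, x, P (x, Z)) \<and>
     complex_differentiable_at ft (x, P (x, Z)) \<and> complex_differentiable_at gt (x, P (x, Z)) \<and>
     (\<forall>v w. \<DD> h (Z, x, P (x, Z)) (v, w) = \<DD> gt (x, P (x, Z)) w
        - \<DD> P' (ft (x, P (x, Z)), f Z, g Z) (\<DD> ft (x, P (x, Z)) w, \<DD> f Z v, \<DD> g Z v))"
    by (rule eventually_compose_nhds0[OF eventually_h_diff_graph, of "\<lambda>q. (fst q, snd q, 0)"])
       (auto intro!: cont0 simp: zero_prod_def[symmetric])
  have cdP': "\<forall>\<^sub>F q in nhds (0::'v \<times> 'v). complex_differentiable_at P' (ft (fst q, P (fst q, snd q, 0)), f (snd q, 0), g (snd q, 0))"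
    by (rule eventually_compose_nhds0[OF hol(2)[unfolded hol_near0_def],
          of "\<lambda>q. (ft (fst q, P (fst q, snd q, 0)), f (snd q, 0), g (snd q, 0))"])
       (auto intro!: cont0 simp: zero P_0 zero_prod_def[symmetric])
  have gx: "\<forall>\<^sub>F q in nhds (0::'v \<times> 'v). case (fst q, snd q, 0) of (x, Z) \<Rightarrow>
      \<forall>a. \<DD> h (Z, x, P (x, Z)) (0, a, \<DD> P (x, Z) (a, 0)) = 0"
    by (rule eventually_compose_nhds0[OF graph_deriv_x, of "\<lambda>q. (fst q, snd q, 0)"])
       (auto intro!: cont0 simp: zero_prod_def[symmetric])
  show ?thesis
    using small small' bottom fZ cdfg diff cdP' gx deriv_bottom_slice_sweep[OF flat]
  proof eventually_elim
    case (elim q)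
    obtain x y where q: "q = (x, y)" by (cases q)
    let ?Z = "(y, 0)" and ?sweep = "(x, P (x, y, 0))"
    have "\<DD> gt ?sweep (a, \<DD> P (x, y, 0) (a, 0)) = 0" if "\<DD> ft ?sweep (a, \<DD> P (x, y, 0) (a, 0)) = 0" for a
    proof -
      have "\<DD> h (?Z, ?sweep) (0, a, \<DD> P (x, y, 0) (a, 0)) = 0" using elim(9) q by simp
      moreover have "\<DD> h (?Z, ?sweep) (0, a, \<DD> P (x, y, 0) (a, 0)) = \<DD> gt ?sweep (a, \<DD> P (x, y, 0) (a, 0))"
        using elim(7) elim(5,6,8) that q by (simp add: zero_prod_def[symmetric] del: split_paired_All)
      ultimately show ?thesis by simp
    qed
    then show ?case using elim q by (simp add: bottom_slice_def)
  qed
qed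

text \<open>
There are two cases, according to whether the map \<open>(x, y) \<mapsto> (ft (sweep (x, y)), y)\<close> has a point of
full rank. If it does, its image contains an open set, on which the \<open>y\<close>-derivatives of
\<open>bottom_slice\<close> vanish; hence they vanish identically, \<open>bottom_slice\<close> is constant in \<open>y\<close> and therefore zero, and so is
\<open>gt\<close> on the swept open set. If it does not, some tangent vector of a Segre variety is killed by the
derivative of \<open>ft\<close>, and by the basic equation also by that of \<open>gt\<close>, at each point of the swept set.
\<close>

lemma flat_bottom_imp_singular:
  assumes flat: "\<forall>\<^sub>F y in nhds 0. \<DD> g (y, 0) (0, 1) = 0" and \<epsilon>: "\<epsilon> > 0"
  obtains U where "open U" "U \<noteq> {}" "U \<subseteq> ball 0 \<epsilon>" "\<And>\<zeta>. \<zeta> \<in> U \<Longrightarrow> singular_at Ht \<zeta>"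
proof -
  have "\<forall>\<^sub>F q in nhds (0::'v \<times> 'v). P' (fst q, 0, 0) = 0"
    by (rule eventually_compose_nhds0[OF P'_bottom, of fst]) (auto intro!: cont0)
  then have "\<forall>\<^sub>F (x, y) in nhds (0::'v \<times> 'v). complex_differentiable_at bottom_slice (x, y) \<and> P' (x, 0, 0) = 0"
    using eventually_deriv_bottom_slice by eventually_elim auto
  then obtain \<rho> where \<rho>: "\<rho> > 0"
    and bottom_slice: "\<And>x y. norm x < \<rho> \<Longrightarrow> norm y < \<rho> \<Longrightarrow> complex_differentiable_at bottom_slice (x, y) \<and> P' (x, 0, 0) = 0"
    unfolding eventually_nhds0_pair by blast
  obtain e0 where e0: "e0 > 0" and sw0: "\<And>x y. norm x < e0 \<Longrightarrow> norm y < e0 \<Longrightarrow>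
      complex_differentiable_at P (x, y, 0) \<and> complex_differentiable_at ft (sweep (x, y)) \<and> complex_differentiable_at gt (sweep (x, y)) \<and>
      norm (sweep (x, y)) < \<epsilon> \<and> norm (ft (sweep (x, y))) < \<rho> \<and> gt (sweep (x, y)) = bottom_slice (ft (sweep (x, y)), y) \<and>
      (\<forall>b. \<DD> bottom_slice (ft (sweep (x, y)), y) (0, b) = 0) \<and>
      (\<forall>a. \<DD> ft (sweep (x, y)) (a, \<DD> P (x, y, 0) (a, 0)) = 0 \<longrightarrow> \<DD> gt (sweep (x, y)) (a, \<DD> P (x, y, 0) (a, 0)) = 0)"
    using eventually_sweep[OF \<epsilon> \<rho> flat] unfolding eventually_nhds0_pair by blast
  define e where "e = min e0 \<rho>"
  have e: "e > 0" using e0 \<rho> by (simp add: e_def)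
  define V where "V = ball (0::'v) e \<times> ball (0::'v) e"
  have V: "open V" unfolding V_def by (intro open_Times open_ball)
  have sw: "complex_differentiable_at P (x, y, 0)" "complex_differentiable_at ft (sweep (x, y))" "complex_differentiable_at gt (sweep (x, y))"
      "norm (sweep (x, y)) < \<epsilon>" "norm (ft (sweep (x, y))) < \<rho>" "gt (sweep (x, y)) = bottom_slice (ft (sweep (x, y)), y)"
      "\<And>b. \<DD> bottom_slice (ft (sweep (x, y)), y) (0, b) = 0"
      "\<And>a. \<DD> ft (sweep (x, y)) (a, \<DD> P (x, y, 0) (a, 0)) = 0 \<Longrightarrow> \<DD> gt (sweep (x, y)) (a, \<DD> P (x, y, 0) (a, 0)) = 0"
      "norm y < \<rho>"
    if "(x, y) \<in> V" for x y
    using sw0[of x y] that unfolding V_def e_def by auto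
  obtain U where U: "open U" "U \<noteq> {}" "U \<subseteq> sweep ` V"
    using sweep_open[OF e] unfolding V_def by blast
  let ?\<psi> = "\<lambda>q. (ft (sweep q), snd q)"
  have UT: "\<exists>x y. (x, y) \<in> V \<and> \<zeta> = sweep (x, y)" if "\<zeta> \<in> U" for \<zeta>
  proof -
    have "\<zeta> \<in> sweep ` V" using U(3) that by (rule subsetD)
    then obtain q where "\<zeta> = sweep q" "q \<in> V" by (rule imageE)
    then show ?thesis by (cases q) blast
  qed
  have U\<epsilon>: "U \<subseteq> ball 0 \<epsilon>"
  proof
    fix \<zeta> assume "\<zeta> \<in> U"
    then obtain x y where "(x, y) \<in> V" "\<zeta> = sweep (x, y)" using UT by blast
    then show "\<zeta> \<in> ball 0 \<epsilon>" using sw(4)[of x y] by simp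
  qed
  have cdU: "complex_differentiable_at ft \<zeta>" "complex_differentiable_at gt \<zeta>" if "\<zeta> \<in> U" for \<zeta>
  proof -
    obtain x y where "(x, y) \<in> V" "\<zeta> = sweep (x, y)" using UT[OF \<open>\<zeta> \<in> U\<close>] by blast
    then show "complex_differentiable_at ft \<zeta>" "complex_differentiable_at gt \<zeta>"
      using sw(2,3) by blast+
  qed
  have "singular_at Ht \<zeta>" if \<zeta>: "\<zeta> \<in> U" for \<zeta>
  proof (cases "\<exists>q\<in>V. \<not> singular_at ?\<psi> q")
    case True
    then obtain q where q: "q \<in> V" "\<not> singular_at ?\<psi> q" by blast
    have cd\<psi>: "complex_differentiable_at ?\<psi> q" if "q \<in> V" for q
    proof -
      obtain x y where xy: "q = (x, y)" by (cases q)
      with that have "(x, y) \<in> V" by simp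
      then show ?thesis unfolding xy by (intro deriv_ft_T(1) sw(1,2))
    qed
    have surj: "surj (\<DD> ?\<psi> q)"
      by (rule surj_if_not_singular_at[OF cd\<psi>[OF q(1)] q(2)])
    have "continuous_on V ?\<psi>"
      by (rule hol_on_imp_continuous_on) (use cd\<psi> in \<open>auto simp: hol_on_def\<close>)
    from open_image_of_surj_derivative[OF V this q(1) has_derivative_deriv_at[OF cd\<psi>[OF q(1)]] surj]
    obtain W where W: "open W" "W \<noteq> {}" "W \<subseteq> ?\<psi> ` V" .
    let ?B = "ball (0::'v) \<rho> \<times> ball (0::'v) \<rho>"
    have B: "open ?B" "convex ?B" by (auto intro: open_Times convex_Times)
    have holk: "hol_on ?B bottom_slice" using bottom_slice by (auto simp: hol_on_def)
    have W\<psi>: "\<exists>x y. (x, y) \<in> V \<and> p = (ft (sweep (x, y)), y)" if "p \<in> W" for p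
    proof -
      have "p \<in> ?\<psi> ` V" using W(3) that by (rule subsetD)
      then obtain q where "p = ?\<psi> q" "q \<in> V" by (rule imageE)
      then show ?thesis by (cases q) auto
    qed
    have "W \<subseteq> ?B"
    proof
      fix p assume "p \<in> W"
      then obtain x y where xy: "(x, y) \<in> V" and p: "p = (ft (sweep (x, y)), y)" using W\<psi> by blast
      show "p \<in> ?B" unfolding p using sw(5,9)[OF xy] by simp
    qed
    have dk: "\<DD> bottom_slice p (0, b) = 0" if "p \<in> ?B" for p b
    proof (rule hol_on_identity[OF hol_on_deriv_at[OF holk B(1)] B W(1,2) \<open>W \<subseteq> ?B\<close> _ that])
      fix p assume "p \<in> W"
      then obtain x y where xy: "(x, y) \<in> V" and p: "p = (ft (sweep (x, y)), y)" using W\<psi> by blast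
      show "\<DD> bottom_slice p (0, b) = 0" unfolding p by (rule sw(7)[OF xy])
    qed
    have k0: "bottom_slice (x, y) = 0" if xy: "norm x < \<rho>" "norm y < \<rho>" for x y
    proof -
      have "((\<lambda>y. bottom_slice (x, y)) has_derivative (\<lambda>h. 0)) (at y' within ball 0 \<rho>)" if "y' \<in> ball 0 \<rho>" for y'
      proof -
        have cd: "complex_differentiable_at bottom_slice (x, y')" using bottom_slice[of x y'] xy that by simp
        have "((\<lambda>y. bottom_slice (x, y)) has_derivative (\<lambda>b. \<DD> bottom_slice (x, y') (0, b))) (at y')"
          by (rule has_derivative_compose[where f = "\<lambda>y. (x, y)" and f' = "\<lambda>b. (0, b)" and g = bottom_slice,
                OF _ has_derivative_deriv_at[OF cd]]) (intro has_derivative_Pair has_derivative_const has_derivative_ident)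
        then show ?thesis using dk[of "(x, y')"] xy that by (simp add: has_derivative_at_withinI)
      qed
      then obtain c where "\<And>y. y \<in> ball 0 \<rho> \<Longrightarrow> bottom_slice (x, y) = c"
        using has_derivative_zero_constant[OF convex_ball] by metis
      then have "bottom_slice (x, y) = bottom_slice (x, 0)" using xy \<rho> by simp
      then show ?thesis using bottom_slice[of x 0] xy \<rho> by (simp add: bottom_slice_def zero')
    qed
    have gtU: "gt \<zeta> = 0" if "\<zeta> \<in> U" for \<zeta>
    proof -
      obtain x y where xy: "(x, y) \<in> V" and \<zeta>: "\<zeta> = sweep (x, y)" using UT[OF \<open>\<zeta> \<in> U\<close>] by blast
      show ?thesis
        unfolding \<zeta> sw(6)[OF xy] by (rule k0[OF sw(5,9)[OF xy]])
    qed
    have "\<forall>\<^sub>F \<zeta>' in nhds \<zeta>. gt \<zeta>' = 0"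
      by (rule eventually_mono[OF eventually_nhds_in_open[OF U(1) \<zeta>] gtU])
    then have "\<DD> gt \<zeta> = \<DD> (\<lambda>_. 0) \<zeta>" by (rule deriv_at_cong)
    then show ?thesis
      using cdU[OF \<zeta>] by (intro singular_at_if_last_const) (simp_all add: deriv_Ht)
  next
    case False
    obtain x y where xy: "(x, y) \<in> V" and \<zeta>sweep: "\<zeta> = sweep (x, y)" using UT[OF \<zeta>] by blast
    have "singular_at ?\<psi> (x, y)" using False xy by blast
    then obtain v where v: "v \<noteq> 0" "\<DD> ?\<psi> (x, y) v = 0" unfolding singular_at_def by blast
    obtain a b where vab: "v = (a, b)" by (cases v)
    have ab: "(a, b) \<noteq> (0, 0)" "\<DD> ?\<psi> (x, y) (a, b) = 0"
      using v unfolding vab by (simp_all add: zero_prod_def)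
    then have "b = 0" and a: "\<DD> ft (sweep (x, y)) (a, \<DD> P (x, y, 0) (a, 0)) = 0" "a \<noteq> 0"
      using deriv_ft_T(2)[OF sw(1,2)[OF xy]] by (auto simp: zero_prod_def)
    then have "\<DD> Ht \<zeta> (a, \<DD> P (x, y, 0) (a, 0)) = 0"
      using sw(8)[OF xy a(1)] deriv_Ht[OF cdU[OF \<zeta>]] \<zeta>sweep by (simp add: zero_prod_def)
    then show ?thesis
      unfolding singular_at_def using a(2) by (intro exI[of _ "(a, \<DD> P (x, y, 0) (a, 0))"]) (simp add: zero_prod_def)
  qed
  with U U\<epsilon> show ?thesis by (intro that[of U]) auto
qed

end

section \<open>Finite nondegeneracy in terms of iterated derivatives\<close>

text \<open>
The vectors span exactly when no nonzero linear form annihilates them, and a spanning family in finite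
dimension contains a finite one, so that some level \<open>K\<close> suffices.
\<close>

lemma finite_spanning_levels_iff:
  fixes c :: "'b list \<Rightarrow> complex^'n"
  shows "(\<exists>K. vec.dim {c \<alpha> | \<alpha>. length \<alpha> \<le> K} = CARD('n)) \<longleftrightarrow>
         (\<forall>a. (\<forall>\<alpha>. (\<Sum>j\<in>UNIV. a $ j * c \<alpha> $ j) = 0) \<longrightarrow> a = 0)"
proof
  assume "\<exists>K. vec.dim {c \<alpha> | \<alpha>. length \<alpha> \<le> K} = CARD('n)"
  then obtain K where "vec.dim {c \<alpha> | \<alpha>. length \<alpha> \<le> K} = CARD('n)" (is "vec.dim ?C = _") by blast
  then have span: "vec.span ?C = UNIV"
    by (intro vec.dim_eq_full[THEN iffD1]) (simp add: vec.dimension_def card_cart_basis)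
  show "\<forall>a. (\<forall>\<alpha>. (\<Sum>j\<in>UNIV. a $ j * c \<alpha> $ j) = 0) \<longrightarrow> a = 0"
  proof (intro allI impI)
    fix a :: "complex^'n" assume a: "\<forall>\<alpha>. (\<Sum>j\<in>UNIV. a $ j * c \<alpha> $ j) = 0"
    have all: "(\<Sum>j\<in>UNIV. a $ j * x $ j) = 0" for x
    proof (rule vec.span_induct[where S = ?C and P = "\<lambda>x. (\<Sum>j\<in>UNIV. a $ j * x $ j) = 0"])
      show "vec.subspace {x. (\<Sum>j\<in>UNIV. a $ j * x $ j) = 0}"
        unfolding vec.subspace_def
        by (auto simp: algebra_simps sum.distrib simp flip: sum_distrib_left)
    qed (use span a in auto)
    show "a = 0"
    proof (rule vec_eq_iff[THEN iffD2], rule allI)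
      fix i
      show "a $ i = 0 $ i" using all[of "axis i 1"] by (simp add: axis_def if_distrib cong: if_cong)
    qed
  qed
next
  assume ann: "\<forall>a. (\<forall>\<alpha>. (\<Sum>j\<in>UNIV. a $ j * c \<alpha> $ j) = 0) \<longrightarrow> a = 0"
  obtain B where B: "B \<subseteq> range c" "vec.independent B" "range c \<subseteq> vec.span B"
    by (rule vec.maximal_independent_subset)
  define E where "E = vec.extend_basis B"
  have E: "B \<subseteq> E" "vec.independent E" "vec.span E = UNIV"
    using B(2) by (simp_all add: E_def vec.extend_basis_superset vec.independent_extend_basis vec.span_extend_basis)
  \<comment> \<open>a basis vector outside \<open>B\<close> would have a coordinate function annihilating \<open>range c\<close>\<close>
  have "E \<subseteq> B"
  proof
    fix b assume b: "b \<in> E"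
    show "b \<in> B"
    proof (rule ccontr)
      assume nb: "b \<notin> B"
      define \<phi> where "\<phi> = (\<lambda>x. vec.representation E x b)"
      have add: "\<phi> (x + y) = \<phi> x + \<phi> y" and scale: "\<phi> (r *s x) = r * \<phi> x" for x y r
        unfolding \<phi>_def using E by (simp_all add: vec.representation_add vec.representation_scale)
      have zero: "\<phi> 0 = 0" using scale[of 0 0] by simp
      have sum: "\<phi> (sum X I) = (\<Sum>i\<in>I. \<phi> (X i))" if "finite I" for X :: "'n \<Rightarrow> complex^'n" and I
        using that by (induction I rule: finite_induct) (simp_all add: zero add)
      define a where "a = (\<chi> j. \<phi> (axis j 1))"
      have \<phi>: "\<phi> x = (\<Sum>j\<in>UNIV. a $ j * x $ j)" for x
        by (subst basis_expansion[symmetric]) (simp add: sum scale a_def mult.commute)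
      have "\<phi> x = 0" if "x \<in> vec.span B" for x
      proof (rule vec.span_induct[OF that, where P = "\<lambda>x. \<phi> x = 0"])
        show "vec.subspace {x. \<phi> x = 0}"
          by (simp add: vec.subspace_def zero add scale)
        fix x assume "x \<in> B"
        then show "\<phi> x = 0"
          using E nb by (auto simp: \<phi>_def vec.representation_basis subset_iff)
      qed
      then have "a = 0" using ann B(3) \<phi> by (metis rangeI subsetD)
      then have "\<phi> b = 0" by (simp add: \<phi>)
      then show False using E b by (simp add: \<phi>_def vec.representation_basis)
    qed
  qed
  then have spanB: "vec.span B = UNIV" using E by auto
  have "finite B" using B(2) by (rule vec.finiteI_independent)
  then obtain A where A: "finite A" "B = c ` A" using B(1) by (metis finite_subset_image subset_UNIV)
  define K where "K = Max (insert 0 (length ` A))"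
  let ?C = "{c \<alpha> | \<alpha>. length \<alpha> \<le> K}"
  have "length \<alpha> \<le> K" if "\<alpha> \<in> A" for \<alpha> using that A(1) by (simp add: K_def)
  then have "B \<subseteq> ?C" using A(2) by blast
  then have "vec.span ?C = UNIV" using spanB vec.span_mono by blast
  then have "vec.dim ?C = CARD('n)" by (simp add: card_cart_basis flip: vec.dim_span[of ?C])
  then show "\<exists>K. vec.dim {c \<alpha> | \<alpha>. length \<alpha> \<le> K} = CARD('n)" by blast
qed

lemma finitely_nondegenerate_iff_annihilator:
  "finitely_nondegenerate Q \<longleftrightarrow>
     (\<forall>a. (\<forall>\<alpha>. (\<Sum>j\<in>UNIV. a $ j * d_z_list \<alpha> (d_chi j Q) (0, 0, 0)) = 0) \<longrightarrow> a = 0)"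
  unfolding finitely_nondegenerate_def
  using finite_spanning_levels_iff[of "\<lambda>\<alpha>. \<chi> j. d_z_list \<alpha> (d_chi j Q) (0, 0, 0)"] by simp

lemma deriv_at_linear_combination:
  fixes F :: "'a::complex_normed_space \<Rightarrow> complex"
  assumes "complex_differentiable_at F p" "finite I"
  shows "\<DD> F p (\<Sum>j\<in>I. c j *\<^sub>C v j) = (\<Sum>j\<in>I. c j * \<DD> F p (v j))"
  using assms(2) by (induction I rule: finite_induct) (simp_all add: assms(1) deriv_at_add deriv_at_scaleC)

lemma hol_on_linear_combination:
  fixes F :: "'i \<Rightarrow> 'a::complex_normed_space \<Rightarrow> complex"
  assumes "\<And>j. j \<in> I \<Longrightarrow> hol_on S (F j)"
  shows "hol_on S (\<lambda>p. \<Sum>j\<in>I. c j * F j p)"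
  using assms unfolding hol_on_def
  by (intro ballI complex_differentiable_at_sum(1) complex_differentiable_at_mult_left(1)) blast

lemma scaleC_axis: "t *\<^sub>C axis j (1::complex) = axis j t"
  by (simp add: vec_eq_iff axis_def)

lemma axis_zero_right [simp]: "axis j 0 = 0"
  by (simp add: vec_eq_iff axis_def)

lemma d_z_eq:
  assumes "complex_differentiable_at F p"
  shows "d_z j F p = \<DD> F p (axis j 1, 0, 0)"
proof -
  obtain z x t where p: "p = (z, x, t)" by (cases p)
  have "((\<lambda>s. F (p + s *\<^sub>C (axis j 1, 0, 0))) has_field_derivative \<DD> F (p + 0 *\<^sub>C (axis j 1, 0, 0)) (axis j 1, 0, 0)) (at 0)"
    by (rule slice_has_field_derivative) (use assms in \<open>simp add: scaleC.zero_left zero_prod_def[symmetric]\<close>)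
  then show ?thesis
    unfolding d_z_def p by (simp add: scaleC_axis scaleC.zero_right scaleC.zero_left zero_prod_def[symmetric] DERIV_imp_deriv)
qed

lemma d_chi_eq:
  assumes "complex_differentiable_at F p"
  shows "d_chi j F p = \<DD> F p (0, axis j 1, 0)"
proof -
  obtain z x t where p: "p = (z, x, t)" by (cases p)
  have "((\<lambda>s. F (p + s *\<^sub>C (0, axis j 1, 0))) has_field_derivative \<DD> F (p + 0 *\<^sub>C (0, axis j 1, 0)) (0, axis j 1, 0)) (at 0)"
    by (rule slice_has_field_derivative) (use assms in \<open>simp add: scaleC.zero_left zero_prod_def[symmetric]\<close>)
  then show ?thesis
    unfolding d_chi_def p by (simp add: scaleC_axis scaleC.zero_right scaleC.zero_left zero_prod_def[symmetric] DERIV_imp_deriv)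
qed

lemma hol_on_cong:
  assumes "open S" "\<And>p. p \<in> S \<Longrightarrow> F p = G p"
  shows "hol_on S F \<longleftrightarrow> hol_on S G"
proof -
  have "complex_differentiable_at F p \<longleftrightarrow> complex_differentiable_at G p" if "p \<in> S" for p
    by (rule complex_differentiable_at_cong(1)[OF eventually_mono[OF eventually_nhds_in_open[OF assms(1) that] assms(2)]])
  then show ?thesis by (simp add: hol_on_def)
qed

lemma hol_on_d_z: "open S \<Longrightarrow> hol_on S F \<Longrightarrow> hol_on S (d_z j F)"
  using hol_on_cong[of S "d_z j F" "\<lambda>p. \<DD> F p (axis j 1, 0, 0)"] d_z_eq hol_on_deriv_at
  unfolding hol_on_def by blast

lemma hol_on_d_chi: "open S \<Longrightarrow> hol_on S F \<Longrightarrow> hol_on S (d_chi j F)"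
  using hol_on_cong[of S "d_chi j F" "\<lambda>p. \<DD> F p (0, axis j 1, 0)"] d_chi_eq hol_on_deriv_at
  unfolding hol_on_def by blast

lemma d_z_list_simps [simp]: "d_z_list [] F = F" "d_z_list (j # \<alpha>) F = d_z j (d_z_list \<alpha> F)"
  by (simp_all add: d_z_list_def)

lemma d_z_list_append: "d_z_list (\<alpha> @ \<beta>) F = d_z_list \<alpha> (d_z_list \<beta> F)"
  by (simp add: d_z_list_def)

lemma hol_on_d_z_list: "open S \<Longrightarrow> hol_on S F \<Longrightarrow> hol_on S (d_z_list \<alpha> F)"
  by (induction \<alpha>) (simp_all add: hol_on_d_z)

lemma d_z_list_linear_combination:
  fixes F :: "'n::finite \<Rightarrow> (complex^'n) \<times> (complex^'n) \<times> complex \<Rightarrow> complex"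
  assumes S: "open S" and F: "\<And>j. hol_on S (F j)" and p: "p \<in> S"
  shows "d_z_list \<alpha> (\<lambda>p. \<Sum>j\<in>UNIV. c j * F j p) p = (\<Sum>j\<in>UNIV. c j * d_z_list \<alpha> (F j) p)"
  using p
proof (induction \<alpha> arbitrary: p)
  case (Cons i \<alpha>)
  let ?G = "\<lambda>p. \<Sum>j\<in>UNIV. c j * d_z_list \<alpha> (F j) p"
  have cd: "complex_differentiable_at (d_z_list \<alpha> (F j)) p" for j
    using hol_on_d_z_list[OF S F] Cons.prems by (simp add: hol_on_def)
  note cd' = complex_differentiable_at_mult_left(1)[OF cd]
  have ev: "\<forall>\<^sub>F p in nhds p. d_z_list \<alpha> (\<lambda>p. \<Sum>j\<in>UNIV. c j * F j p) p = ?G p"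
    by (rule eventually_mono[OF eventually_nhds_in_open[OF S Cons.prems] Cons.IH])
  have "complex_differentiable_at ?G p"
    by (rule complex_differentiable_at_sum(1)) (rule cd')
  then have "d_z_list (i # \<alpha>) (\<lambda>p. \<Sum>j\<in>UNIV. c j * F j p) p = \<DD> ?G p (axis i 1, 0, 0)"
    using complex_differentiable_at_cong(1)[OF ev] deriv_at_cong[OF ev] by (simp add: d_z_eq)
  also have "\<dots> = (\<Sum>j\<in>UNIV. c j * d_z_list (i # \<alpha>) (F j) p)"
    using deriv_at_sum[of UNIV "\<lambda>j p. c j * d_z_list \<alpha> (F j) p" p] cd cd'
    by (simp add: deriv_at_mult_left d_z_eq)
  finally show ?case .
qed simp

text \<open>
The derivative of \<open>G\<close> along the line in direction \<open>z\<close> is again the restriction of a holomorphic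
function all of whose iterated derivatives vanish at \<open>0\<close>, namely \<open>\<Sum>j. z $ j * d_z j G\<close>; hence the
induction over all such \<open>G\<close>.
\<close>

lemma higher_deriv_along_line_zero:
  fixes G :: "(complex^'n) \<times> (complex^'n) \<times> complex \<Rightarrow> complex"
  assumes S: "open S" "0 \<in> S" and G: "hol_on S G" and zero: "\<And>\<alpha>. d_z_list \<alpha> G (0, 0, 0) = 0"
  shows "(deriv ^^ k) (\<lambda>t. G (0 + t *\<^sub>C (z, 0, 0))) 0 = 0"
  using G zero
proof (induction k arbitrary: G)
  case 0
  then show ?case using "0.prems"(2)[of "[]"] by (simp add: scaleC.zero_left zero_prod_def)
next
  case (Suc k)
  let ?G' = "\<lambda>p. \<Sum>j\<in>UNIV. z $ j * d_z j G p"
  have cd: "complex_differentiable_at G p" if "p \<in> S" for p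
    using Suc.prems(1) that by (simp add: hol_on_def)
  have G': "\<DD> G p (z, 0, 0) = ?G' p" if "p \<in> S" for p
  proof -
    have "(z, 0 :: complex^'n, 0 :: complex) = (\<Sum>j\<in>UNIV. z $ j *\<^sub>C (axis j 1, 0, 0))"
      by (simp add: prod_eq_iff fst_sum snd_sum scaleC.zero_right scaleC_axis vec_eq_iff axis_def
            if_distrib[of "(*) _"] cong: if_cong)
    then have "\<DD> G p (z, 0, 0) = (\<Sum>j\<in>UNIV. z $ j * \<DD> G p (axis j 1, 0, 0))"
      by (simp only: deriv_at_linear_combination[OF cd[OF that]] finite)
    then show ?thesis by (simp add: d_z_eq[OF cd[OF that]])
  qed
  have "\<forall>\<^sub>F t in nhds 0. deriv (\<lambda>t. G (0 + t *\<^sub>C (z, 0, 0))) t = ?G' (0 + t *\<^sub>C (z, 0, 0))"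
  proof (rule eventually_mono[OF eventually_nhds_in_open[OF open_slice[OF S(1)]]])
    show "0 \<in> {t. 0 + t *\<^sub>C (z, 0, 0) \<in> S}" using S by (simp add: scaleC.zero_left scaleC.zero_right zero_prod_def[symmetric])
    fix t assume "t \<in> {t. 0 + t *\<^sub>C (z, 0, 0) \<in> S}"
    then have t: "0 + t *\<^sub>C (z, 0, 0) \<in> S" by simp
    show "deriv (\<lambda>t. G (0 + t *\<^sub>C (z, 0, 0))) t = ?G' (0 + t *\<^sub>C (z, 0, 0))"
      using DERIV_imp_deriv[OF slice_has_field_derivative[OF cd[OF t]]] G'[OF t] by simp
  qed
  then have "(deriv ^^ Suc k) (\<lambda>t. G (0 + t *\<^sub>C (z, 0, 0))) 0 = (deriv ^^ k) (\<lambda>t. ?G' (0 + t *\<^sub>C (z, 0, 0))) 0"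
    unfolding funpow_Suc_right o_def by (rule higher_deriv_cong_ev) (rule refl)
  also have "\<dots> = 0"
  proof (rule Suc.IH)
    show "hol_on S ?G'"
      by (rule hol_on_linear_combination) (rule hol_on_d_z[OF S(1) Suc.prems(1)])
    have "d_z_list \<alpha> (d_z j G) (0, 0, 0) = 0" for \<alpha> j
      using Suc.prems(2)[of "\<alpha> @ [j]"] by (simp add: d_z_list_append)
    then show "d_z_list \<alpha> ?G' (0, 0, 0) = 0" for \<alpha>
      using d_z_list_linear_combination[OF S(1) hol_on_d_z[OF S(1) Suc.prems(1)] S(2), where c = "\<lambda>j. z $ j" and \<alpha> = \<alpha>]
      by (simp add: zero_prod_def)
  qed
  finally show ?case .
qed

text \<open>
Taylor's theorem at \<open>0\<close>, obtained from the one-variable identity theorem on each line through \<open>0\<close>.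
\<close>

lemma d_z_list_zero_iff:
  fixes G :: "(complex^'n) \<times> (complex^'n) \<times> complex \<Rightarrow> complex"
  assumes r: "r > 0" and G: "hol_on (ball 0 r) G"
  shows "(\<forall>\<alpha>. d_z_list \<alpha> G (0, 0, 0) = 0) \<longleftrightarrow> (\<forall>\<^sub>F z in nhds 0. G (z, 0, 0) = 0)"
proof
  assume zero: "\<forall>\<alpha>. d_z_list \<alpha> G (0, 0, 0) = 0"
  have "G (z, 0, 0) = 0" if z: "norm z < r" for z
  proof -
    let ?T = "{t. 0 + t *\<^sub>C (z, 0, 0) \<in> ball (0 :: (complex^'n) \<times> (complex^'n) \<times> complex) r}" and ?\<phi> = "\<lambda>t. G (0 + t *\<^sub>C (z, 0, 0))"
    have "?\<phi> 1 = 0"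
    proof (rule holomorphic_fun_eq_0_on_connected[of ?\<phi> ?T 0])
      show "?\<phi> holomorphic_on ?T" by (rule slice_holomorphic[OF G open_ball])
      show "open ?T" by (rule open_slice[OF open_ball])
      show "connected ?T" by (rule convex_connected[OF convex_slice[OF convex_ball]])
      show "(deriv ^^ k) ?\<phi> 0 = 0" for k
        by (rule higher_deriv_along_line_zero[OF open_ball _ G]) (use r zero in auto)
      show "0 \<in> ?T" using r by (simp add: scaleC.zero_left scaleC.zero_right zero_prod_def[symmetric])
      show "1 \<in> ?T" using z by (simp add: norm_Pair zero_prod_def[symmetric])
    qed
    then show ?thesis by simp
  qed
  then show "\<forall>\<^sub>F z in nhds 0. G (z, 0, 0) = 0"
    unfolding eventually_nhds_0_ball using r by blast
next
  assume ev: "\<forall>\<^sub>F z in nhds 0. G (z, 0, 0) = 0"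
  have "\<forall>\<^sub>F z in nhds 0. d_z_list \<alpha> G (z, 0, 0) = 0" for \<alpha>
  proof (induction \<alpha>)
    case (Cons j \<alpha>)
    then have "\<forall>\<^sub>F z in nhds 0. \<forall>\<^sub>F z' in nhds z. d_z_list \<alpha> G (z', 0, 0) = 0"
      by (simp add: eventually_eventually)
    then show ?case
    proof eventually_elim
      case (elim z)
      have "isCont (\<lambda>t. z + t *\<^sub>C axis j 1) 0"
        by (intro continuous_intros scaleC.isCont)
      then have "isCont (\<lambda>t::complex. z + axis j t) 0" by (simp add: scaleC_axis)
      then have "filterlim (\<lambda>t::complex. z + axis j t) (nhds z) (nhds 0)"
        by (metis (no_types, lifting) add.right_neutral axis_eq_0_iff isCont_def tendsto_at_iff_tendsto_nhds)
      from eventually_compose_filterlim[OF elim this]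
      have "deriv (\<lambda>t. d_z_list \<alpha> G (z + axis j t, 0, 0)) 0 = deriv (\<lambda>_. 0) 0"
        by (intro deriv_cong_ev) auto
      then show ?case by (simp add: d_z_def)
    qed
  qed (use ev in simp)
  then show "\<forall>\<alpha>. d_z_list \<alpha> G (0, 0, 0) = 0" using eventually_nhds_x_imp_x by blast
qed

text \<open>
The derivative of \<open>Q\<close> at \<open>(z, 0, 0)\<close> in direction \<open>(0, a, b)\<close> is
\<open>(\<Sum>j. a $ j * d_chi j Q (z, 0, 0)) + b\<close>. The sum vanishes at \<open>z = 0\<close>, so a kernel vector has
\<open>b = 0\<close>, and then the iterated \<open>z\<close>-derivatives of the sum at \<open>0\<close> decide whether it vanishes near \<open>0\<close>.
\<close>

lemma finitely_nondegenerate_iff_nondegenerate_at0: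
  fixes Q :: "(complex^'n) \<times> (complex^'n) \<times> complex \<Rightarrow> complex"
  assumes hol: "hol_near0 Q"
    and left: "\<forall>\<^sub>F (x, t) in nhds 0. Q (0, x, t) = t" and mid: "\<forall>\<^sub>F (z, t) in nhds 0. Q (z, 0, t) = t"
  shows "finitely_nondegenerate Q \<longleftrightarrow> nondegenerate_at0 Q"
proof -
  obtain r where r: "r > 0" and holr: "hol_on (ball 0 r) Q" using hol hol_near0_iff by blast
  have cd: "complex_differentiable_at Q (z, 0, 0)" if "norm z < r" for z
    using holr that by (simp add: hol_on_def norm_Pair)
  obtain r' where r': "r' > 0" and Qmid: "\<And>z t. norm z < r' \<Longrightarrow> norm t < r' \<Longrightarrow> Q (z, 0, t) = t"
    using mid unfolding eventually_nhds0_pair by blast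
  have formula: "\<DD> Q (z, 0, 0) (0, a, b) = (\<Sum>j\<in>UNIV. a $ j * d_chi j Q (z, 0, 0)) + b"
    if z: "norm z < min r r'" for z a b
  proof -
    have cdz: "complex_differentiable_at Q (z, 0, 0)" using cd z by simp
    have ev: "\<forall>\<^sub>F t in nhds 0. Q ((z, 0, 0) + t *\<^sub>C (0, 0, 1)) = t"
      unfolding eventually_nhds_0_ball using Qmid[of z] z r'
      by (intro exI[of _ r']) (simp add: scaleC.zero_right)
    have "\<DD> Q (z, 0, 0) (0, 0, 1) = deriv (\<lambda>t. Q ((z, 0, 0) + t *\<^sub>C (0, 0, 1))) 0"
      using DERIV_imp_deriv[OF slice_has_field_derivative[of Q "(z, 0, 0)" 0 "(0, 0, 1)"]] cdz
      by (simp add: scaleC.zero_left zero_prod_def[symmetric])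
    also have "\<dots> = deriv (\<lambda>t. t) 0" by (rule deriv_cong_ev[OF ev refl])
    finally have one: "\<DD> Q (z, 0, 0) (0, 0, 1) = 1" by simp
    have "(0 :: complex^'n, a, b) = (\<Sum>j\<in>UNIV. a $ j *\<^sub>C (0, axis j 1, 0)) + b *\<^sub>C (0, 0, 1)"
      by (simp add: prod_eq_iff fst_sum snd_sum scaleC.zero_right scaleC_axis vec_eq_iff axis_def
            if_distrib[of "(*) _"] cong: if_cong)
    then have "\<DD> Q (z, 0, 0) (0, a, b) = (\<Sum>j\<in>UNIV. a $ j * \<DD> Q (z, 0, 0) (0, axis j 1, 0)) + b * \<DD> Q (z, 0, 0) (0, 0, 1)"
      using cdz by (simp only: deriv_at_add deriv_at_scaleC deriv_at_linear_combination finite scaleC_complex)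
    then show ?thesis using one by (simp add: d_chi_eq[OF cdz])
  qed
  have chi0: "d_chi j Q (0, 0, 0) = 0" for j
  proof -
    have "\<forall>\<^sub>F t in nhds 0. Q (0, axis j t, 0) = 0"
      using eventually_compose_nhds0[OF left, of "\<lambda>t. (t *\<^sub>C axis j 1, 0)"]
      by (simp add: scaleC.zero_left zero_prod_def continuous_intros scaleC.isCont) (simp add: scaleC_axis)
    then have "deriv (\<lambda>t. Q (0, axis j t, 0)) 0 = deriv (\<lambda>_. 0) 0" by (rule deriv_cong_ev) (rule refl)
    then show ?thesis by (simp add: d_chi_def)
  qed
  define G where "G = (\<lambda>a p. \<Sum>j\<in>UNIV. a $ j * d_chi j Q p)"
  note holchi = hol_on_d_chi[OF open_ball holr]
  have holG: "hol_on (ball 0 r) (G a)" for a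
    unfolding G_def by (rule hol_on_linear_combination) (rule holchi)
  have derivs: "(\<forall>\<alpha>. (\<Sum>j\<in>UNIV. a $ j * d_z_list \<alpha> (d_chi j Q) (0, 0, 0)) = 0) \<longleftrightarrow> (\<forall>\<^sub>F z in nhds 0. G a (z, 0, 0) = 0)" for a
    using d_z_list_zero_iff[OF r holG, of a]
      d_z_list_linear_combination[OF open_ball holchi, where p = "(0, 0, 0)" and c = "\<lambda>j. a $ j"] r
    by (simp add: G_def zero_prod_def[symmetric])
  have near: "\<forall>\<^sub>F z in nhds (0::complex^'n). norm z < min r r'"
    unfolding eventually_nhds_0_ball using r r' by (intro exI[of _ "min r r'"]) simp
  have kernel: "(\<forall>\<^sub>F z in nhds 0. \<DD> Q (z, 0) (0, a, b) = 0) \<longleftrightarrow> (\<forall>\<^sub>F z in nhds 0. G a (z, 0, 0) = 0) \<and> b = 0" (is "?L \<longleftrightarrow> ?R") for a b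
  proof
    assume ?L
    with near have *: "\<forall>\<^sub>F z in nhds 0. G a (z, 0, 0) + b = 0"
      by eventually_elim (simp add: formula G_def zero_prod_def)
    then have "b = 0" using eventually_nhds_x_imp_x[OF *] chi0 by (simp add: G_def)
    with * show ?R by simp
  next
    assume ?R
    then have G0: "\<forall>\<^sub>F z in nhds 0. G a (z, 0, 0) = 0" and b: "b = 0" by auto
    from near G0 show ?L
      by eventually_elim (simp add: formula G_def zero_prod_def b)
  qed
  show ?thesis
    unfolding finitely_nondegenerate_iff_annihilator nondegenerate_at0_def derivs split_paired_All kernel
    by (auto simp: zero_prod_def)
qed

section \<open>Nonsingular and singular Segre preserving maps\<close>

context segre_germ
begin

text \<open>
Setting \<open>\<zeta> = 0\<close> and \<open>Z = 0\<close> in the hypothesis gives the first two claims, since \<open>P'\<close> is in normal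
coordinates.
\<close>

lemma flat_imp_null:
  assumes flat: "\<forall>\<^sub>F (Z, \<zeta>) in nhds 0. gt \<zeta> = P' (ft \<zeta>, f Z, g Z)"
  shows "\<forall>\<^sub>F Z in nhds 0. g Z = 0" and "\<forall>\<^sub>F \<zeta> in nhds 0. gt \<zeta> = 0"
    and "\<forall>\<^sub>F (Z, \<zeta>) in nhds 0. P' (ft \<zeta>, f Z, 0) = 0"
proof -
  have "\<forall>\<^sub>F Z in nhds 0. gt 0 = P' (ft 0, f Z, g Z)"
    using eventually_compose_nhds0[OF flat, of "\<lambda>Z. (Z, 0)"] by (simp add: zero_prod_def[symmetric] cont0)
  moreover have "\<forall>\<^sub>F Z in nhds 0. P' (0, f Z, g Z) = g Z"
    using eventually_compose_nhds0[OF P'_left, of "\<lambda>Z. (f Z, g Z)"] by (simp add: zero zero_prod_def[symmetric] cont0)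
  ultimately show g0: "\<forall>\<^sub>F Z in nhds 0. g Z = 0"
    by eventually_elim (simp add: zero)
  have "\<forall>\<^sub>F \<zeta> in nhds 0. gt \<zeta> = P' (ft \<zeta>, 0, 0)"
    using eventually_compose_nhds0[OF flat, of "\<lambda>\<zeta>. (0, \<zeta>)"] by (simp add: zero zero_prod_def[symmetric] cont0)
  moreover have "\<forall>\<^sub>F \<zeta> in nhds 0. P' (ft \<zeta>, 0, 0) = 0"
    using eventually_compose_nhds0[OF P'_bottom, of ft] by (simp add: zero isCont_hol_near0 hol)
  ultimately show gt0: "\<forall>\<^sub>F \<zeta> in nhds 0. gt \<zeta> = 0"
    by eventually_elim simp
  have "\<forall>\<^sub>F p in nhds (0 :: ('v \<times> complex) \<times> ('v \<times> complex)). g (fst p) = 0"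
    "\<forall>\<^sub>F p in nhds (0 :: ('v \<times> complex) \<times> ('v \<times> complex)). gt (snd p) = 0"
    by (rule eventually_compose_nhds0[OF g0, of fst], simp_all add: isCont_fst)
       (rule eventually_compose_nhds0[OF gt0, of snd], simp_all add: isCont_snd)
  with flat show "\<forall>\<^sub>F (Z, \<zeta>) in nhds 0. P' (ft \<zeta>, f Z, 0) = 0"
    by eventually_elim auto
qed

lemma deriv_g_0: "\<DD> g 0 (a, 0) = 0"
proof -
  have "\<DD> (\<lambda>y. g (y, 0)) 0 a = 0" using deriv_at_cong[OF g_bottom] by simp
  then show ?thesis
    using deriv_at_compose[of "\<lambda>y. (y, 0)" 0 g a] hol_near0_imp_at0[OF hol(4)]
    by (simp add: zero_prod_def[symmetric] complex_differentiable_intros deriv_at_Pair)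
qed

lemma singular_at_H_0:
  assumes "\<DD> g 0 (0, 1) = 0"
  shows "singular_at H 0"
proof -
  note cd = hol(3,4)[THEN hol_near0_imp_at0]
  have "\<DD> g 0 v = 0" for v
  proof -
    have v: "v = (fst v, 0) + snd v *\<^sub>C (0, 1)" by (simp add: prod_eq_iff scaleC.zero_right)
    show ?thesis
      by (subst v, unfold deriv_at_add[OF cd(2)] deriv_at_scaleC[OF cd(2)]) (simp add: assms deriv_g_0)
  qed
  then show ?thesis
    by (intro singular_at_if_last_const) (simp_all add: deriv_H cd)
qed

end

lemma deriv_at_nth:
  fixes F :: "'a::complex_normed_space \<Rightarrow> complex^'n"
  assumes "complex_differentiable_at F p"
  shows "complex_differentiable_at (\<lambda>x. F x $ i) p" and "\<DD> (\<lambda>x. F x $ i) p v = \<DD> F p v $ i"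
proof -
  have *: "((\<lambda>x. F x $ i) has_derivative (\<lambda>v. \<DD> F p v $ i)) (at p)"
    by (rule bounded_linear.has_derivative[OF bounded_linear_vec_nth has_derivative_deriv_at[OF assms]])
  show "complex_differentiable_at (\<lambda>x. F x $ i) p"
    by (rule complex_differentiable_atI[OF *]) (simp add: deriv_at_scaleC assms)
  show "\<DD> (\<lambda>x. F x $ i) p v = \<DD> F p v $ i"
    by (simp add: deriv_at_eqI[OF *])
qed

lemma jacobian_mult_vec:
  fixes f :: "(complex^'n) \<times> complex \<Rightarrow> complex^'n"
  assumes "complex_differentiable_at f 0"
  shows "jacobian_at0 f *v v = \<DD> f 0 (v, 0)"
proof -
  have "jacobian_at0 f $ i $ j = \<DD> (\<lambda>p. f p $ i) 0 (axis j 1, 0)" for i j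
  proof -
    have "((\<lambda>s. f (0 + s *\<^sub>C (axis j 1, 0)) $ i) has_field_derivative
        \<DD> (\<lambda>p. f p $ i) (0 + 0 *\<^sub>C (axis j 1, 0)) (axis j 1, 0)) (at 0)"
      by (rule slice_has_field_derivative) (use deriv_at_nth(1)[OF assms] in \<open>simp add: scaleC.zero_left zero_prod_def[symmetric]\<close>)
    then show ?thesis
      unfolding jacobian_at0_def
      by (simp add: scaleC_axis scaleC.zero_right scaleC.zero_left zero_prod_def[symmetric] DERIV_imp_deriv)
  qed
  moreover have "(v, 0 :: complex) = (\<Sum>j\<in>UNIV. v $ j *\<^sub>C (axis j 1, 0))"
    by (simp add: prod_eq_iff fst_sum snd_sum scaleC.zero_right scaleC_axis vec_eq_iff axis_def
          if_distrib[of "(*) _"] cong: if_cong)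
  then have "\<DD> (\<lambda>p. f p $ i) 0 (v, 0) = (\<Sum>j\<in>UNIV. v $ j * \<DD> (\<lambda>p. f p $ i) 0 (axis j 1, 0))" for i
    by (simp only: deriv_at_linear_combination[OF deriv_at_nth(1)[OF assms]] finite)
  ultimately show ?thesis
    by (simp add: vec_eq_iff matrix_vector_mult_def mult.commute flip: deriv_at_nth(2)[OF assms])
qed

text \<open>
The derivative of \<open>(f, g)\<close> at \<open>0\<close> is block triangular because \<open>g\<close> has no first-order term in \<open>z\<close>; a
kernel vector of the diagonal block is a kernel vector of the whole.
\<close>

lemma det_jacobian_nonzero:
  fixes f :: "(complex^'n) \<times> complex \<Rightarrow> complex^'n"
  assumes "complex_differentiable_at f 0" "complex_differentiable_at g 0"
    and ns: "\<not> singular_at (\<lambda>Z. (f Z, g Z)) 0" and g0: "\<And>a. \<DD> g 0 (a, 0) = 0"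
  shows "det (jacobian_at0 f) \<noteq> 0"
proof
  assume "det (jacobian_at0 f) = 0"
  then have "\<not> (\<exists>B. B ** jacobian_at0 f = mat 1)"
    using invertible_det_nz invertible_left_inverse by blast
  then obtain v where v: "v \<noteq> 0" "jacobian_at0 f *v v = 0"
    unfolding matrix_left_invertible_ker by blast
  then have "\<DD> (\<lambda>Z. (f Z, g Z)) 0 (v, 0) = 0"
    using assms by (simp add: deriv_at_Pair jacobian_mult_vec zero_prod_def)
  then show False
    using ns v(1) unfolding singular_at_def by (metis Pair_inject zero_prod_def)
qed

text \<open>
The real-linear involution for which \<open>bar Q = cnj \<circ> Q \<circ> cnj3\<close>.
\<close>

definition cnj3 :: "(complex^'n) \<times> (complex^'n) \<times> complex \<Rightarrow> (complex^'n) \<times> (complex^'n) \<times> complex" where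
  "cnj3 = (\<lambda>(x, y, t). (vcnj x, vcnj y, cnj t))"

lemma bar_eq: "bar Q p = cnj (Q (cnj3 p))"
  by (cases p) (simp add: bar_def cnj3_def)

lemma vcnj_simps [simp]: "vcnj (vcnj x) = x" "vcnj 0 = 0" "vcnj (x + y) = vcnj x + vcnj y"
  "vcnj (r *\<^sub>R x) = r *\<^sub>R vcnj x" "vcnj (c *\<^sub>C x) = cnj c *\<^sub>C vcnj x" "norm (vcnj x) = norm x"
  by (simp_all add: vcnj_def vec_eq_iff norm_vec_def)

lemma bounded_linear_vcnj: "bounded_linear vcnj"
  by (rule bounded_linear_intro[where K = 1]) simp_all

lemma bounded_linear_cnj3: "bounded_linear cnj3"
proof (rule bounded_linear_intro[where K = 1])
  show "norm (cnj3 p) \<le> norm p * 1" for p by (cases p) (simp add: cnj3_def norm_Pair)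
qed (auto simp: cnj3_def)

lemma cnj3_scaleC: "cnj3 (c *\<^sub>C p) = cnj c *\<^sub>C cnj3 p"
  by (cases p) (simp add: cnj3_def)

lemma isCont_vcnj: "isCont vcnj x"
  by (rule linear_continuous_at[OF bounded_linear_vcnj])

lemma isCont_cnj3: "isCont cnj3 x"
  by (rule linear_continuous_at[OF bounded_linear_cnj3])

lemma deriv_bar:
  assumes "complex_differentiable_at Q (cnj3 p)"
  shows "complex_differentiable_at (bar Q) p" and "\<DD> (bar Q) p v = cnj (\<DD> Q (cnj3 p) (cnj3 v))"
proof -
  have "((\<lambda>p. cnj (Q (cnj3 p))) has_derivative (\<lambda>v. cnj (\<DD> Q (cnj3 p) (cnj3 v)))) (at p)"
    by (intro bounded_linear.has_derivative[OF bounded_linear_cnj]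
        has_derivative_compose[OF bounded_linear_imp_has_derivative[OF bounded_linear_cnj3] has_derivative_deriv_at[OF assms]])
  then have *: "(bar Q has_derivative (\<lambda>v. cnj (\<DD> Q (cnj3 p) (cnj3 v)))) (at p)"
    by (simp add: bar_eq[abs_def])
  show "complex_differentiable_at (bar Q) p"
    by (rule complex_differentiable_atI[OF *]) (simp add: cnj3_scaleC deriv_at_scaleC[OF assms])
  show "\<DD> (bar Q) p v = cnj (\<DD> Q (cnj3 p) (cnj3 v))" by (simp add: deriv_at_eqI[OF *])
qed

lemma cnj3_0 [simp]: "cnj3 0 = 0"
  by (simp add: cnj3_def zero_prod_def)

lemma hol_near0_bar:
  assumes "hol_near0 Q"
  shows "hol_near0 (bar Q)"
proof -
  have "\<forall>\<^sub>F p in nhds 0. complex_differentiable_at Q (cnj3 p)"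
    by (rule eventually_compose_nhds0[OF assms[unfolded hol_near0_def] isCont_cnj3 cnj3_0])
  then show ?thesis
    unfolding hol_near0_def by eventually_elim (rule deriv_bar(1))
qed

lemma nondegenerate_at0_bar:
  assumes "hol_near0 Q" "nondegenerate_at0 Q"
  shows "nondegenerate_at0 (bar Q)"
  unfolding nondegenerate_at0_def
proof (intro allI impI)
  fix v :: "(complex^'a) \<times> complex"
  assume "\<forall>\<^sub>F x in nhds 0. \<DD> (bar Q) (x, 0) (0, v) = 0"
  then have "\<forall>\<^sub>F x in nhds 0. \<DD> (bar Q) (vcnj x, 0) (0, v) = 0"
    by (rule eventually_compose_nhds0) (simp_all add: isCont_vcnj)
  moreover have "\<forall>\<^sub>F x in nhds 0. complex_differentiable_at Q (x, 0)"
    using eventually_compose_nhds0[OF assms(1)[unfolded hol_near0_def], of "\<lambda>x. (x, 0)"]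
    by (simp add: zero_prod_def[symmetric])
  ultimately have "\<forall>\<^sub>F x in nhds 0. \<DD> Q (x, 0) (0, vcnj (fst v), cnj (snd v)) = 0"
  proof eventually_elim
    case (elim x)
    have "cnj3 (vcnj x, 0) = (x, 0)" by (simp add: cnj3_def zero_prod_def)
    moreover have "cnj3 (0, v) = (0, vcnj (fst v), cnj (snd v))" by (simp add: cnj3_def case_prod_unfold)
    ultimately show ?case using elim deriv_bar(2)[of Q "(vcnj x, 0)" "(0, v)"] by simp
  qed
  then have "(vcnj (fst v), cnj (snd v)) = 0" using assms(2) unfolding nondegenerate_at0_def by blast
  then have "vcnj (fst v) = 0" "snd v = 0" by (simp_all add: zero_prod_def)
  moreover from this have "fst v = 0" by (metis vcnj_simps(1,2))
  ultimately show "v = 0" by (simp add: prod_eq_iff)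
qed

lemma bar_boundary_left:
  assumes "\<forall>\<^sub>F (y, t) in nhds 0. Q (0, y, t) = t"
  shows "\<forall>\<^sub>F (y, t) in nhds 0. bar Q (0, y, t) = t"
proof -
  have "\<forall>\<^sub>F p in nhds 0. case (vcnj (fst p), cnj (snd p)) of (y, t) \<Rightarrow> Q (0, y, t) = t"
    by (rule eventually_compose_nhds0[OF assms, of "\<lambda>p. (vcnj (fst p), cnj (snd p))"])
       (auto intro!: continuous_intros isCont_o2[OF _ isCont_vcnj] simp: zero_prod_def)
  then show ?thesis by eventually_elim (auto simp: bar_def)
qed

lemma bar_boundary_mid:
  assumes "\<forall>\<^sub>F (y, t) in nhds 0. Q (y, 0, t) = t"
  shows "\<forall>\<^sub>F (y, t) in nhds 0. bar Q (y, 0, t) = t"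
proof -
  have "\<forall>\<^sub>F p in nhds 0. case (vcnj (fst p), cnj (snd p)) of (y, t) \<Rightarrow> Q (y, 0, t) = t"
    by (rule eventually_compose_nhds0[OF assms, of "\<lambda>p. (vcnj (fst p), cnj (snd p))"])
       (auto intro!: continuous_intros isCont_o2[OF _ isCont_vcnj] simp: zero_prod_def)
  then show ?thesis by eventually_elim (auto simp: bar_def)
qed

text \<open>
The conjugate of the reality identity: it inverts \<open>t \<mapsto> Q (chi, z, t)\<close>, so that the complexified
equation can be solved for \<open>\<tau>\<close> instead of \<open>w\<close>.
\<close>

lemma bar_reality:
  assumes "\<forall>\<^sub>F (z, chi, w) in nhds 0. Q (z, chi, bar Q (chi, z, w)) = w"
  shows "\<forall>\<^sub>F (z, chi, w) in nhds 0. bar Q (z, chi, Q (chi, z, w)) = w"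
proof -
  have "\<forall>\<^sub>F p in nhds 0. case cnj3 p of (z, chi, w) \<Rightarrow> Q (z, chi, bar Q (chi, z, w)) = w"
    by (rule eventually_compose_nhds0[OF assms isCont_cnj3]) simp
  then show ?thesis
    by eventually_elim (auto simp: bar_def cnj3_def)
qed

lemma hol_near0_fst: "hol_near0 F \<Longrightarrow> hol_near0 (\<lambda>x. fst (F x))"
  and hol_near0_snd: "hol_near0 F \<Longrightarrow> hol_near0 (\<lambda>x. snd (F x))"
  unfolding hol_near0_def
  by (auto elim!: eventually_mono intro: complex_differentiable_at_fst complex_differentiable_at_snd)

lemma hol_near0_inject: "hol_near0 (\<lambda>x. (x, 0))" "hol_near0 (\<lambda>x. (0, x))"
  unfolding hol_near0_def by (auto intro!: always_eventually complex_differentiable_intros)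

lemma hol_near0_segre_map_components:
  assumes "hol_near0 (segre_map f g ft gt)"
  shows "hol_near0 f" "hol_near0 g" "hol_near0 ft" "hol_near0 gt"
proof -
  have 1: "hol_near0 (\<lambda>Z. segre_map f g ft gt (Z, 0))" "hol_near0 (\<lambda>\<zeta>. segre_map f g ft gt (0, \<zeta>))"
    by (rule hol_near0_compose[OF assms hol_near0_inject(1)], simp add: zero_prod_def)
       (rule hol_near0_compose[OF assms hol_near0_inject(2)], simp add: zero_prod_def)
  show "hol_near0 f" "hol_near0 g"
    using hol_near0_fst[OF hol_near0_fst[OF 1(1)]] hol_near0_snd[OF hol_near0_fst[OF 1(1)]]
    by (simp_all add: segre_map_def case_prod_unfold)
  show "hol_near0 ft" "hol_near0 gt"
    using hol_near0_fst[OF hol_near0_snd[OF 1(2)]] hol_near0_snd[OF hol_near0_snd[OF 1(2)]]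
    by (simp_all add: segre_map_def case_prod_unfold)
qed

context
  fixes M M' :: "((complex^'n) \<times> complex) set"
    and Q Q' :: "(complex^'n) \<times> (complex^'n) \<times> complex \<Rightarrow> complex"
    and f ft :: "(complex^'n) \<times> complex \<Rightarrow> complex^'n"
    and g gt :: "(complex^'n) \<times> complex \<Rightarrow> complex"
  assumes Q: "normal_coordinates M Q" and Q': "normal_coordinates M' Q'"
    and fnd: "finitely_nondegenerate Q" and H: "HSPM Q Q' f g ft gt"
begin

lemma map_zero: "f 0 = 0" "g 0 = 0" "ft 0 = 0" "gt 0 = 0"
  using H by (auto simp: HSPM_def segre_map_def zero_prod_def)

lemma map_hol: "hol_near0 f" "hol_near0 g" "hol_near0 ft" "hol_near0 gt"
  using H hol_near0_segre_map_components unfolding HSPM_def by blast+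

lemma segre_equation:
  "\<forall>\<^sub>F (z, \<zeta>) in nhds 0. g (z, Q (z, \<zeta>)) = Q' (f (z, Q (z, \<zeta>)), ft \<zeta>, gt \<zeta>)"
proof -
  have Q0: "Q 0 = 0" "hol_near0 Q"
    using Q eventually_nhds_x_imp_x unfolding normal_coordinates_def by (fastforce simp: zero_prod_def)+
  have "\<forall>\<^sub>F q in nhds 0. ((fst q, Q q), snd q) \<in> complexification Q \<longrightarrow>
      segre_map f g ft gt ((fst q, Q q), snd q) \<in> complexification Q'"
    by (rule eventually_compose_nhds0[where G = "\<lambda>q. ((fst q, Q q), snd q)"])
       (use H Q0 in \<open>auto simp: HSPM_def zero_prod_def[symmetric] intro!: continuous_intros isCont_hol_near0[OF Q0(2)]\<close>)
  then show ?thesis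
    by eventually_elim (auto simp: complexification_def segre_map_def)
qed

text \<open>
A point \<open>(Z, \<chi>, bar Q (\<chi>, Z))\<close> lies on the complexification by the reality identity of \<open>Q\<close>; its
image satisfies the equation solved for \<open>w'\<close>, and the conjugate identity of \<open>Q'\<close> turns this into the
equation solved for \<open>\<tau>'\<close>.
\<close>

lemma segre_equation_bar:
  "\<forall>\<^sub>F (chi, Z) in nhds 0. gt (chi, bar Q (chi, Z)) = bar Q' (ft (chi, bar Q (chi, Z)), f Z, g Z)"
proof -
  have holb: "hol_near0 (bar Q)"
    using Q hol_near0_bar unfolding normal_coordinates_def by blast
  have b0: "bar Q 0 = 0"
    using eventually_nhds_x_imp_x[OF bar_boundary_left[of Q]] Q unfolding normal_coordinates_def
    by (auto simp: zero_prod_def)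
  note cont = isCont_hol_near0[OF holb] map_hol[THEN isCont_hol_near0, THEN isCont_compose0] continuous_intros
  have "\<forall>\<^sub>F q in nhds (0 :: (complex^'n) \<times> (complex^'n) \<times> complex).
      (snd q, fst q, bar Q q) \<in> complexification Q \<longrightarrow> segre_map f g ft gt (snd q, fst q, bar Q q) \<in> complexification Q'"
    by (rule eventually_compose_nhds0[where G = "\<lambda>q. (snd q, fst q, bar Q q)"])
       (use H b0 in \<open>auto simp: HSPM_def zero_prod_def[symmetric] intro!: cont\<close>)
  moreover have "\<forall>\<^sub>F q in nhds (0 :: (complex^'n) \<times> (complex^'n) \<times> complex).
      case (fst (snd q), fst q, snd (snd q)) of (z, chi, w) \<Rightarrow> Q (z, chi, bar Q (chi, z, w)) = w"
    by (rule eventually_compose_nhds0[where G = "\<lambda>q. (fst (snd q), fst q, snd (snd q))"])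
       (use Q in \<open>auto simp: normal_coordinates_def zero_prod_def[symmetric] intro!: continuous_intros\<close>)
  moreover have "\<forall>\<^sub>F q in nhds (0 :: (complex^'n) \<times> (complex^'n) \<times> complex).
      case (ft (fst q, bar Q q), f (snd q), gt (fst q, bar Q q)) of (z, chi, w) \<Rightarrow> bar Q' (z, chi, Q' (chi, z, w)) = w"
    by (rule eventually_compose_nhds0[where G = "\<lambda>q. (ft (fst q, bar Q q), f (snd q), gt (fst q, bar Q q))"], rule bar_reality)
       (use Q' in \<open>auto simp: normal_coordinates_def map_zero b0 zero_prod_def[symmetric] intro!: cont\<close>)
  ultimately show ?thesis
    by eventually_elim (auto simp: complexification_def segre_map_def)
qed

lemma nondegenerate_Q: "nondegenerate_at0 Q"
  using Q fnd finitely_nondegenerate_iff_nondegenerate_at0[of Q] unfolding normal_coordinates_def by blast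

lemma segre_germ_direct: "segre_germ Q Q' ft f gt g"
  using Q Q' map_zero map_hol segre_equation nondegenerate_Q
  unfolding normal_coordinates_def by unfold_locales blast+

lemma segre_germ_bar: "segre_germ (bar Q) (bar Q') f ft g gt"
  using Q Q' map_zero map_hol segre_equation_bar nondegenerate_at0_bar[OF _ nondegenerate_Q]
  unfolding normal_coordinates_def
  by unfold_locales (blast intro: hol_near0_bar bar_boundary_left bar_boundary_mid)+

interpretation R: segre_germ Q Q' ft f gt g by (rule segre_germ_direct)
interpretation S: segre_germ "bar Q" "bar Q'" f ft g gt by (rule segre_germ_bar)

lemma Ht_eq: "S.Ht = R.H" "R.Ht = S.H"
  by (auto simp: S.Ht_def R.H_def R.Ht_def S.H_def)

lemma null_case:
  assumes "\<forall>\<^sub>F Z in nhds 0. g Z = 0" "\<forall>\<^sub>F \<zeta> in nhds 0. gt \<zeta> = 0"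
    and flat: "\<forall>\<^sub>F (Z, \<zeta>) in nhds 0. Q' (f Z, ft \<zeta>, 0) = 0"
  shows "transversally_null g gt \<and>
          (\<forall>\<^sub>F ((z, w), (chi, \<tau>)) in nhds 0. Q' (f (z, w), ft (chi, \<tau>), 0) = 0) \<and>
          (\<forall>\<^sub>F p in nhds 0. segre_map f g ft gt p \<in> complexification Q')"
proof (intro conjI)
  show "transversally_null g gt" using assms(1,2) by (simp add: transversally_null_def case_prod_unfold)
  show "\<forall>\<^sub>F ((z, w), (chi, \<tau>)) in nhds 0. Q' (f (z, w), ft (chi, \<tau>), 0) = 0"
    using flat by (simp add: case_prod_unfold)
  have "\<forall>\<^sub>F p in nhds (0 :: ((complex^'n) \<times> complex) \<times> ((complex^'n) \<times> complex)). g (fst p) = 0"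
    "\<forall>\<^sub>F p in nhds (0 :: ((complex^'n) \<times> complex) \<times> ((complex^'n) \<times> complex)). gt (snd p) = 0"
    by (rule eventually_compose_nhds0[OF assms(1), of fst], simp_all add: isCont_fst)
       (rule eventually_compose_nhds0[OF assms(2), of snd], simp_all add: isCont_snd)
  with flat show "\<forall>\<^sub>F p in nhds 0. segre_map f g ft gt p \<in> complexification Q'"
    by eventually_elim (auto simp: complexification_def segre_map_def)
qed

text \<open>
A singularity of \<open>H\<close> at \<open>0\<close> makes \<open>gt\<close> flat along \<open>\<tau> = 0\<close>; with the roles exchanged this makes \<open>H\<close>
singular on open sets close to \<open>0\<close>, and then \<open>h\<close> vanishes identically.
\<close>

lemma singular_H_null:
  assumes "singular_at S.H 0"
  shows "\<forall>\<^sub>F Z in nhds 0. g Z = 0" "\<forall>\<^sub>F \<zeta> in nhds 0. gt \<zeta> = 0" "\<forall>\<^sub>F (Z, \<zeta>) in nhds 0. Q' (f Z, ft \<zeta>, 0) = 0"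
proof -
  obtain \<epsilon> where \<epsilon>: "\<epsilon> > 0"
    "\<And>U. open U \<Longrightarrow> U \<noteq> {} \<Longrightarrow> U \<subseteq> ball 0 \<epsilon> \<Longrightarrow> (\<And>Z. Z \<in> U \<Longrightarrow> singular_at S.H Z) \<Longrightarrow>
       \<forall>\<^sub>F (Z, \<zeta>) in nhds 0. gt \<zeta> = bar Q' (ft \<zeta>, f Z, g Z)"
    using S.singular_open_imp_flat by blast
  obtain U where "open U" "U \<noteq> {}" "U \<subseteq> ball 0 \<epsilon>" "\<And>Z. Z \<in> U \<Longrightarrow> singular_at S.H Z"
    using R.flat_bottom_imp_singular[OF S.singular_0_imp_normal_deriv_zero[OF assms] \<epsilon>(1)] unfolding Ht_eq by blast
  then have flat: "\<forall>\<^sub>F (Z, \<zeta>) in nhds 0. gt \<zeta> = bar Q' (ft \<zeta>, f Z, g Z)" by (rule \<epsilon>(2))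
  show "\<forall>\<^sub>F Z in nhds 0. g Z = 0" "\<forall>\<^sub>F \<zeta> in nhds 0. gt \<zeta> = 0"
    using S.flat_imp_null[OF flat] by blast+
  have "\<forall>\<^sub>F p in nhds 0. case (f (fst p), ft (snd p), 0) of (z, chi, w) \<Rightarrow> Q' (z, chi, bar Q' (chi, z, w)) = w"
    by (rule eventually_compose_nhds0[where G = "\<lambda>p. (f (fst p), ft (snd p), 0)"])
       (use Q' in \<open>auto simp: normal_coordinates_def map_zero zero_prod_def[symmetric]
          intro!: map_hol[THEN isCont_hol_near0, THEN isCont_compose0] continuous_intros\<close>)
  with S.flat_imp_null(3)[OF flat] show "\<forall>\<^sub>F (Z, \<zeta>) in nhds 0. Q' (f Z, ft \<zeta>, 0) = 0"
    by eventually_elim auto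
qed

lemma singular_Ht_null:
  assumes "singular_at R.H 0"
  shows "\<forall>\<^sub>F Z in nhds 0. g Z = 0" "\<forall>\<^sub>F \<zeta> in nhds 0. gt \<zeta> = 0" "\<forall>\<^sub>F (Z, \<zeta>) in nhds 0. Q' (f Z, ft \<zeta>, 0) = 0"
proof -
  obtain \<epsilon> where \<epsilon>: "\<epsilon> > 0"
    "\<And>U. open U \<Longrightarrow> U \<noteq> {} \<Longrightarrow> U \<subseteq> ball 0 \<epsilon> \<Longrightarrow> (\<And>Z. Z \<in> U \<Longrightarrow> singular_at R.H Z) \<Longrightarrow>
       \<forall>\<^sub>F (\<zeta>, Z) in nhds 0. g Z = Q' (f Z, ft \<zeta>, gt \<zeta>)"
    using R.singular_open_imp_flat by blast
  obtain U where "open U" "U \<noteq> {}" "U \<subseteq> ball 0 \<epsilon>" "\<And>Z. Z \<in> U \<Longrightarrow> singular_at R.H Z"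
    using S.flat_bottom_imp_singular[OF R.singular_0_imp_normal_deriv_zero[OF assms] \<epsilon>(1)] unfolding Ht_eq by blast
  then have flat: "\<forall>\<^sub>F (\<zeta>, Z) in nhds 0. g Z = Q' (f Z, ft \<zeta>, gt \<zeta>)" by (rule \<epsilon>(2))
  show "\<forall>\<^sub>F Z in nhds 0. g Z = 0" "\<forall>\<^sub>F \<zeta> in nhds 0. gt \<zeta> = 0"
    using R.flat_imp_null[OF flat] by blast+
  have "\<forall>\<^sub>F p in nhds 0. case (snd p, fst p) of (\<zeta>, Z) \<Rightarrow> Q' (f Z, ft \<zeta>, 0) = 0"
    by (rule eventually_compose_nhds0[OF R.flat_imp_null(3)[OF flat], of "\<lambda>p. (snd p, fst p)"])
       (auto simp: zero_prod_def intro!: continuous_intros)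
  then show "\<forall>\<^sub>F (Z, \<zeta>) in nhds 0. Q' (f Z, ft \<zeta>, 0) = 0"
    by (simp add: case_prod_unfold)
qed

lemma nonsingular_case:
  assumes ns: "\<not> singular_at S.H 0" "\<not> singular_at R.H 0"
  shows "segre_transversal_at0 g gt" "det (jacobian_at0 f) \<noteq> 0" "det (jacobian_at0 ft) \<noteq> 0"
    "biholomorphism_near0 (segre_map f g ft gt)" "finitely_nondegenerate Q'"
proof -
  note cd = map_hol[THEN hol_near0_imp_at0]
  have d_last: "d_last_at0 F = \<DD> F 0 (0, 1)" if "complex_differentiable_at F 0" for F :: "(complex^'n) \<times> complex \<Rightarrow> complex"
  proof -
    have "((\<lambda>t. F (0 + t *\<^sub>C (0, 1))) has_field_derivative \<DD> F (0 + 0 *\<^sub>C (0, 1)) (0, 1)) (at 0)"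
      by (rule slice_has_field_derivative) (use that in \<open>simp add: scaleC.zero_left scaleC.zero_right zero_prod_def[symmetric]\<close>)
    then show ?thesis
      unfolding d_last_at0_def by (simp add: scaleC.zero_right scaleC.zero_left zero_prod_def[symmetric] DERIV_imp_deriv)
  qed
  have nz: "\<DD> gt 0 (0, 1) \<noteq> 0" "\<DD> g 0 (0, 1) \<noteq> 0"
    using R.singular_at_H_0 S.singular_at_H_0 ns by blast+
  have "\<DD> g 0 (0, 1) = \<DD> gt 0 (0, 1)" using S.normal_derivs_eq by (simp add: zero_prod_def)
  then show "segre_transversal_at0 g gt"
    unfolding segre_transversal_at0_def d_last[OF cd(2)] d_last[OF cd(4)] using nz by simp
  show "det (jacobian_at0 f) \<noteq> 0"
    by (rule det_jacobian_nonzero[OF cd(1,2)]) (use ns(1) S.deriv_g_0 in \<open>simp_all add: S.H_def[abs_def]\<close>)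
  show "det (jacobian_at0 ft) \<noteq> 0"
    by (rule det_jacobian_nonzero[OF cd(3,4)]) (use ns(2) R.deriv_g_0 in \<open>simp_all add: R.H_def[abs_def]\<close>)
  have seg: "segre_map f g ft gt = (\<lambda>p. (S.H (fst p), R.H (snd p)))"
    by (simp add: segre_map_def S.H_def R.H_def case_prod_unfold)
  show "biholomorphism_near0 (segre_map f g ft gt)"
  proof (rule biholomorphism_near0I)
    show "hol_near0 (segre_map f g ft gt)" using H by (simp add: HSPM_def)
    fix v assume v: "\<DD> (segre_map f g ft gt) 0 v = 0"
    have "\<DD> (segre_map f g ft gt) 0 v = (\<DD> S.H 0 (fst v), \<DD> R.H 0 (snd v))"
      unfolding seg using S.deriv_H(1)[OF cd(1,2)] R.deriv_H(1)[OF cd(3,4)]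
      by (simp add: deriv_at_Pair complex_differentiable_at_of_fst complex_differentiable_at_of_snd deriv_at_of_fst deriv_at_of_snd)
    then have "\<DD> S.H 0 (fst v) = 0" "\<DD> R.H 0 (snd v) = 0" using v by (simp_all add: zero_prod_def)
    then show "v = 0" using ns unfolding singular_at_def by (metis prod_eq_iff fst_zero snd_zero)
  qed
  have "nondegenerate_at0 Q'"
    by (rule R.nondegenerate_target[OF ns(2)]) (use nz in \<open>simp add: zero_prod_def\<close>)
  then show "finitely_nondegenerate Q'"
    using Q' finitely_nondegenerate_iff_nondegenerate_at0[of Q'] unfolding normal_coordinates_def by blast
qed

lemma dichotomy:
  "(transversally_null g gt \<and>
          (\<forall>\<^sub>F ((z, w), (chi, \<tau>)) in nhds 0. Q' (f (z, w), ft (chi, \<tau>), 0) = 0) \<and>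
          (\<forall>\<^sub>F p in nhds 0. segre_map f g ft gt p \<in> complexification Q'))
       \<or> (segre_transversal_at0 g gt \<and>
          det (jacobian_at0 f) \<noteq> 0 \<and> det (jacobian_at0 ft) \<noteq> 0 \<and>
          biholomorphism_near0 (segre_map f g ft gt) \<and>
          finitely_nondegenerate Q')"
proof (cases "singular_at S.H 0 \<or> singular_at R.H 0")
  case True
  then show ?thesis using null_case singular_H_null singular_Ht_null by blast
next
  case False
  then show ?thesis using nonsingular_case by blast
qed

end

theorem theorem1p4:
  fixes M M' :: "((complex^'n) \<times> complex) set"
    and Q Q' :: "(complex^'n) \<times> (complex^'n) \<times> complex \<Rightarrow> complex"
    and f ft :: "(complex^'n) \<times> complex \<Rightarrow> complex^'n"
    and g gt :: "(complex^'n) \<times> complex \<Rightarrow> complex"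
  assumes "real_analytic_hypersurface_at0 M" and "normal_coordinates M Q"
    and "real_analytic_hypersurface_at0 M'" and "normal_coordinates M' Q'"
    and "finitely_nondegenerate Q"
    and "HSPM Q Q' f g ft gt"
  shows "(transversally_null g gt \<and>
          (\<forall>\<^sub>F ((z, w), (chi, \<tau>)) in nhds 0. Q' (f (z, w), ft (chi, \<tau>), 0) = 0) \<and>
          (\<forall>\<^sub>F p in nhds 0. segre_map f g ft gt p \<in> complexification Q'))
       \<or> (segre_transversal_at0 g gt \<and>
          det (jacobian_at0 f) \<noteq> 0 \<and> det (jacobian_at0 ft) \<noteq> 0 \<and>
          biholomorphism_near0 (segre_map f g ft gt) \<and>
          finitely_nondegenerate Q')"
  using assms(2,4-6) by (rule dichotomy)

end
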